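(* Let $n\in\mathbb Z_{>0}$, $\tau\in\mathbb H$ and $p\in E_\tau\setminus E_\tau[2]$. Let $V_{n,p}(\tau)\subset\mathbb C^2$ be the log-free variety, i.e. the set of $(T_1,T_2)\in\mathbb C^2$ for which there is $B\in\mathbb C$ such that the equation $w''(z)=q_n(z;p,T_1,T_2,B)\,w(z)$ is log-free at each of $z=0,\pm p$. Then $$V_{n,p}(\tau)=V^{(0)}_{n,p}(\tau)\cup V^{(1)}_{n,p}(\tau),$$ where the two irreducible components are $$V^{(0)}_{n,p}(\tau)=\{(T_1,T_2)\in V_{n,p}(\tau): T_1+T_2=0\},$$ $$V^{(1)}_{n,p}(\tau)=\Bigl\{(T_1,T_2)\in V_{n,p}(\tau): T_1-T_2+\tfrac{\wp''(p)}{2\wp'(p)}=0\Bigr\}.$$ They are respectively even and non-even, and they meet exactly at the point $$\mathbf T_*=\Bigl(-\tfrac{\wp''(p)}{4\wp'(p)},\ \tfrac{\wp''(p)}{4\wp'(p)}\Bigr).$$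
   Context: Notation: $\Lambda_\tau=\mathbb Z+\mathbb Z\tau$, $E_\tau=\mathbb C/\Lambda_\tau$, $E_\tau[2]$ is the set of 2-torsion points; $\wp,\zeta$ are the Weierstrass functions of $\Lambda_\tau$. The potential is $$q_n(z;p,T_1,T_2,B)=n(n+1)\wp(z)+\tfrac34\bigl(\wp(z+p)+\wp(z-p)\bigr)+T_1\bigl(\zeta(z+p)-\zeta(z)\bigr)+T_2\bigl(\zeta(z-p)-\zeta(z)\bigr)+B.$$ The equation has regular singularities at $0$ (exponents $-n,n+1$) and $\pm p$ (exponents $-\tfrac12,\tfrac32$). "Log-free" at a singularity means that no solution has a logarithmic term there. "Even component" means that the corresponding potential is an even function of $z$ for all points of the component; "non-even" means that the potential is not even for a general point of the component. *)

theory Defs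
  imports
    "HOL-Complex_Analysis.Complex_Analysis"
    "HOL-Computational_Algebra.Polynomial"
begin

section \<open>Weierstrass functions and the potential\<close>

definition period_lattice :: "complex \<Rightarrow> complex set" where
  "period_lattice \<tau> = {of_int a + of_int b * \<tau> |a b :: int. True}"

text \<open>The values at lattice points are meaningless (they come from \<open>1 / 0 = 0\<close>) and are never used:
  every condition below is tested away from the poles.\<close>

definition weierstrass_p :: "complex \<Rightarrow> complex \<Rightarrow> complex" where
  "weierstrass_p \<tau> z =
     1 / z\<^sup>2 + (\<Sum>\<^sub>\<infinity>\<omega>\<in>period_lattice \<tau> - {0}. 1 / (z - \<omega>)\<^sup>2 - 1 / \<omega>\<^sup>2)"

definition weierstrass_zeta :: "complex \<Rightarrow> complex \<Rightarrow> complex" where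
  "weierstrass_zeta \<tau> z =
     1 / z + (\<Sum>\<^sub>\<infinity>\<omega>\<in>period_lattice \<tau> - {0}. 1 / (z - \<omega>) + 1 / \<omega> + z / \<omega>\<^sup>2)"

text \<open>Points of the torus are given by complex representatives. Replacing \<open>p\<close> by a lattice
  translate changes \<open>\<zeta>(z \<plusminus> p)\<close> by constants, which are absorbed by \<open>B\<close>.\<close>

definition potential ::
  "nat \<Rightarrow> complex \<Rightarrow> complex \<Rightarrow> complex \<Rightarrow> complex \<Rightarrow> complex \<Rightarrow> complex \<Rightarrow> complex" where
  "potential n \<tau> p T1 T2 B z =
     of_nat (n * (n + 1)) * weierstrass_p \<tau> z
     + 3 / 4 * (weierstrass_p \<tau> (z + p) + weierstrass_p \<tau> (z - p))
     + T1 * (weierstrass_zeta \<tau> (z + p) - weierstrass_zeta \<tau> z)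
     + T2 * (weierstrass_zeta \<tau> (z - p) - weierstrass_zeta \<tau> z)
     + B"

definition even_potential ::
  "nat \<Rightarrow> complex \<Rightarrow> complex \<Rightarrow> complex \<Rightarrow> complex \<Rightarrow> complex \<Rightarrow> bool" where
  "even_potential n \<tau> p T1 T2 B \<longleftrightarrow>
     (\<forall>z. z \<notin> period_lattice \<tau> \<and> z + p \<notin> period_lattice \<tau> \<and> z - p \<notin> period_lattice \<tau> \<longrightarrow>
        potential n \<tau> p T1 T2 B (- z) = potential n \<tau> p T1 T2 B z)"


section \<open>Logarithmic terms\<close>

definition slit_disc :: "complex \<Rightarrow> real \<Rightarrow> complex set" where
  "slit_disc z0 r = {z \<in> ball z0 r. z - z0 \<notin> \<real>\<^sub>\<le>\<^sub>0}"

definition solution_on :: "(complex \<Rightarrow> complex) \<Rightarrow> complex set \<Rightarrow> (complex \<Rightarrow> complex) \<Rightarrow> bool" where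
  "solution_on q S w \<longleftrightarrow> w holomorphic_on S \<and> (\<forall>z\<in>S. deriv (deriv w) z = q z * w z)"

text \<open>At a regular singularity every local solution of a second order equation is a combination of
  Frobenius series. Logarithms occur only if the exponents differ by an integer, and then every
  solution has the form \<open>(z - z0)\<^sup>a (h1(z) + h2(z) log (z - z0))\<close> with \<open>h1\<close>, \<open>h2\<close>
  holomorphic at \<open>z0\<close>; the logarithmic term is present iff \<open>h2\<close> does not vanish identically.\<close>

definition has_log_term :: "complex \<Rightarrow> real \<Rightarrow> (complex \<Rightarrow> complex) \<Rightarrow> bool" where
  "has_log_term z0 r w \<longleftrightarrow>
     (\<exists>a h1 h2. h1 holomorphic_on ball z0 r \<and> h2 holomorphic_on ball z0 r \<and>
        (\<exists>z\<in>ball z0 r. h2 z \<noteq> 0) \<and>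
        (\<forall>z\<in>slit_disc z0 r. w z = (z - z0) powr a * (h1 z + h2 z * Ln (z - z0))))"

definition log_free_at :: "(complex \<Rightarrow> complex) \<Rightarrow> complex \<Rightarrow> bool" where
  "log_free_at q z0 \<longleftrightarrow>
     \<not> (\<exists>r>0. \<exists>w. solution_on q (slit_disc z0 r) w \<and> has_log_term z0 r w)"

definition log_free_equation ::
  "nat \<Rightarrow> complex \<Rightarrow> complex \<Rightarrow> complex \<Rightarrow> complex \<Rightarrow> complex \<Rightarrow> bool" where
  "log_free_equation n \<tau> p T1 T2 B \<longleftrightarrow>
     (\<forall>z0\<in>{0, p, - p}. log_free_at (potential n \<tau> p T1 T2 B) z0)"


section \<open>The log-free variety\<close>

definition log_free_variety :: "nat \<Rightarrow> complex \<Rightarrow> complex \<Rightarrow> (complex \<times> complex) set" where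
  "log_free_variety n \<tau> p = {(T1, T2). \<exists>B. log_free_equation n \<tau> p T1 T2 B}"

definition log_free_variety0 :: "nat \<Rightarrow> complex \<Rightarrow> complex \<Rightarrow> (complex \<times> complex) set" where
  "log_free_variety0 n \<tau> p = {(T1, T2) \<in> log_free_variety n \<tau> p. T1 + T2 = 0}"

definition log_free_variety1 :: "nat \<Rightarrow> complex \<Rightarrow> complex \<Rightarrow> (complex \<times> complex) set" where
  "log_free_variety1 n \<tau> p =
     {(T1, T2) \<in> log_free_variety n \<tau> p.
        T1 - T2 + deriv (deriv (weierstrass_p \<tau>)) p / (2 * deriv (weierstrass_p \<tau>) p) = 0}"


section \<open>Zariski topology of the affine plane\<close>

text \<open>An element of \<^typ>\<open>complex poly poly\<close> is a polynomial in \<open>y\<close> with coefficients in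
  \<open>\<complex>[x]\<close>; the condition below is its vanishing at \<open>(x, y)\<close>.\<close>

definition algebraic_set :: "(complex \<times> complex) set \<Rightarrow> bool" where
  "algebraic_set A \<longleftrightarrow>
     (\<exists>F :: complex poly poly set. A = {(x, y). \<forall>f\<in>F. poly (poly f [:y:]) x = 0})"

definition irreducible_set :: "(complex \<times> complex) set \<Rightarrow> bool" where
  "irreducible_set S \<longleftrightarrow>
     S \<noteq> {} \<and>
     (\<forall>A B. algebraic_set A \<and> algebraic_set B \<and> S \<subseteq> A \<union> B \<longrightarrow> S \<subseteq> A \<or> S \<subseteq> B)"

definition irreducible_component :: "(complex \<times> complex) set \<Rightarrow> (complex \<times> complex) set \<Rightarrow> bool" where
  "irreducible_component V S \<longleftrightarrow>
     S \<subseteq> V \<and> irreducible_set S \<and> (\<forall>S'. S \<subseteq> S' \<and> S' \<subseteq> V \<and> irreducible_set S' \<longrightarrow> S' = S)"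


section \<open>Even and non-even components\<close>

text \<open>The potential corresponding to a point \<open>(T1, T2)\<close> of the variety is the one with a \<open>B\<close> that
  makes the equation log-free.\<close>

definition even_component ::
  "nat \<Rightarrow> complex \<Rightarrow> complex \<Rightarrow> (complex \<times> complex) set \<Rightarrow> bool" where
  "even_component n \<tau> p S \<longleftrightarrow>
     (\<forall>(T1, T2)\<in>S. \<forall>B. log_free_equation n \<tau> p T1 T2 B \<longrightarrow> even_potential n \<tau> p T1 T2 B)"

text \<open>A general point is one outside a proper Zariski-closed subset of the component.\<close>

definition noneven_component ::
  "nat \<Rightarrow> complex \<Rightarrow> complex \<Rightarrow> (complex \<times> complex) set \<Rightarrow> bool" where
  "noneven_component n \<tau> p S \<longleftrightarrow>
     (\<exists>Z. algebraic_set Z \<and> \<not> S \<subseteq> Z \<and>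
        (\<forall>(T1, T2)\<in>S - Z. \<forall>B. log_free_equation n \<tau> p T1 T2 B \<longrightarrow>
           \<not> even_potential n \<tau> p T1 T2 B))"

end

theory Submission
  imports Defs
begin

unbundle no vec_syntax

text \<open>
  Write \<open>q = z\<^bsup>-2\<^esup> (U\<^sub>0 + U\<^sub>1 z + \<dots>)\<close> at a singular point. At \<open>\<plusminus>p\<close>, where the exponents are
  \<open>-1/2\<close> and \<open>3/2\<close>, the Frobenius recursion is unobstructed iff \<open>U\<^sub>2 = U\<^sub>1\<^sup>2\<close>. Either of the two
  resulting conditions determines \<open>B\<close>, and their difference is
  \<open>(T\<^sub>1 + T\<^sub>2) (T\<^sub>1 - T\<^sub>2 + c) = 0\<close> with \<open>c = \<zeta>(2p) - 2 \<zeta>(p) = \<wp>''(p) / (2 \<wp>'(p))\<close>.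
  Conversely, both lines consist of log-free points. On the first one the potential is even, and as
  the difference \<open>2n + 1\<close> of the exponents at \<open>0\<close> is odd, the recursion at \<open>0\<close> is unobstructed by
  parity. On the second one, put \<open>s = T\<^sub>1 + T\<^sub>2\<close> and \<open>f = \<wp> - \<wp>(p)\<close>; the equation is then a Darboux
  transform of a Lame equation: if \<open>V'' = (n(n+1) f + s\<^sup>2/4) V\<close>, then
  \<open>w = f\<^bsup>-1/2\<^esup> (V' - s V / 2)\<close> solves \<open>w'' = q w\<close>. The Lame potential is even, so it has a
  log-free solution with exponent \<open>-n\<close> at \<open>0\<close>, and since \<open>n > 0\<close> its transform has the same exponent.
\<close>

section \<open>The Frobenius method\<close>

text \<open>Log-freeness at 0 is an obstruction at index 2n + 1 of a recursion that involves
  \<open>T1\<close>, \<open>T2\<close> and \<open>B\<close>. It is never computed; a formal solution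
  with the lowest exponent is exhibited instead.

  Origin of the Darboux transform: put \<sigma> = s/2 and u = V' - \<sigma> V. The equation for V
  gives u' + \<sigma> u = n(n+1) f V, hence (d/dz - \<sigma>) (1/f) (d/dz + \<sigma>) u = n(n+1) u.
  Substituting u = f^(1/2) w removes the first derivative and leaves w'' = (n(n+1) f + \<sigma>^2 +
  \<sigma> F + F^2/4 - F'/2) w with F = f'/f. The simple zeros of f at p and -p produce the
  exponents -1/2 and 3/2. Near p one has F = 1/x + c + ..., and F is odd, so F^2 has residues 2c at
  p and -2c at -p. The residues of the new potential there are therefore T2 = (s + c)/2 and T1 = (s
  - c)/2, which is the second line.

  The definition of log-freeness admits any radius, any complex exponent and any function on a slit
  disc. So a logarithmic solution is first reduced to formal power series to be excluded, whereas
  refuting log-freeness at p or -p takes a convergent logarithmic solution.\<close>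

definition euler :: "complex fps \<Rightarrow> complex fps" where
  "euler F = fps_X * fps_deriv F"

lemma euler_nth [simp]: "euler F $ k = of_nat k * F $ k"
  unfolding euler_def by (cases k) auto

lemma euler_diff: "euler (F - G) = euler F - euler G"
  and euler_add: "euler (F + G) = euler F + euler G"
  and euler_mult: "euler (F * G) = euler F * G + F * euler G"
  and euler_const: "euler (fps_const c) = 0"
  and euler_X: "euler fps_X = fps_X"
  by (simp_all add: euler_def algebra_simps)

text \<open>With \<open>U = z\<^sup>2 q\<close>, this is \<open>z\<^bsup>2-a\<^esup> (w'' - q w)\<close> for \<open>w = z\<^sup>a H\<close>.\<close>

definition frobenius_op :: "complex fps \<Rightarrow> complex \<Rightarrow> complex fps \<Rightarrow> complex fps" where
  "frobenius_op U a H =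
     euler (euler H) + fps_const (2 * a - 1) * euler H + fps_const (a * (a - 1)) * H - U * H"

lemma frobenius_op_nth:
  "frobenius_op U a H $ k =
     (a + of_nat k) * (a + of_nat k - 1) * H $ k - (\<Sum>i=0..k. U $ i * H $ (k - i))"
proof -
  have "(U * H) $ k = (\<Sum>i=0..k. U $ i * H $ (k - i))" by (rule fps_mult_nth)
  thus ?thesis
    by (simp only: frobenius_op_def fps_add_nth fps_sub_nth fps_mult_left_const_nth euler_nth)
       (simp add: algebra_simps)
qed

text \<open>The first nonzero coefficient of \<open>H\<close> meets only \<open>U $ 0\<close>. Hence
  a formal solution starts at a root of the indicial polynomial.\<close>

lemma frobenius_op_nth_lowest:
  assumes "\<And>i. i < k \<Longrightarrow> H $ i = 0"
  shows "frobenius_op U a H $ k = ((a + of_nat k) * (a + of_nat k - 1) - U $ 0) * H $ k"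
proof -
  have "(\<Sum>i=0..k. U $ i * H $ (k - i)) = (\<Sum>i\<in>{0}. U $ i * H $ (k - i))"
    by (rule sum.mono_neutral_right) (auto simp: assms)
  thus ?thesis by (simp add: frobenius_op_nth algebra_simps)
qed

lemma frobenius_op_diff:
  "frobenius_op U a (F - G) = frobenius_op U a F - frobenius_op U a G"
  by (simp add: frobenius_op_def euler_diff algebra_simps)

lemma frobenius_op_cmult:
  "frobenius_op U a (fps_const c * F) = fps_const c * frobenius_op U a F"
  by (simp add: frobenius_op_def euler_mult euler_const algebra_simps)

lemma euler_X_power: "euler (fps_X ^ j) = fps_const (of_nat j) * fps_X ^ j"
  by (rule fps_ext) (simp add: fps_X_power_nth)

text \<open>A power of z can be moved between the series and the exponent: z^a (z^j F) = z^(a+j) F.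
  This lets a solution with exponent \<rho> be subtracted from a series that is written with
  exponent a.\<close>

lemma frobenius_op_X_power_mult:
  "frobenius_op U a (fps_X ^ j * F) = fps_X ^ j * frobenius_op U (a + of_nat j) F"
proof -
  have 1: "fps_const (2 * (a + of_nat j) - 1) = fps_const (2 * a - 1) + 2 * fps_const (of_nat j)"
    by (simp add: numeral_fps_const algebra_simps)
  have 2: "fps_const ((a + of_nat j) * (a + of_nat j - 1)) =
      fps_const (a * (a - 1)) + fps_const (of_nat j) * fps_const (2 * a - 1) +
      fps_const (of_nat j) * fps_const (of_nat j)"
    by (simp add: algebra_simps)
  show ?thesis
    unfolding frobenius_op_def 1 2 euler_mult euler_add euler_const euler_X_power
    by (simp only: algebra_simps) (simp del: fps_const_mult)
qed

text \<open>The hypotheses on \<open>h1\<close> and \<open>h2\<close> say that \<open>z\<^sup>a (h1 + h2 log z)\<close> is a formal solution. A suitable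
  multiple of \<open>z\<^bsup>m-N\<^esup> G\<close>, where \<open>m\<close> is the order of \<open>h2\<close>, is subtracted from \<open>h1\<close> so that the
  coefficients below \<open>m\<close> vanish; the coefficient at \<open>m\<close> is then contradictory.\<close>

lemma logarithmic_part_zero:
  assumes U0: "U $ 0 = \<rho> * (\<rho> - 1)" and \<rho>: "2 * \<rho> = 1 - of_nat N" and N: "N > 0"
    and G: "frobenius_op U \<rho> G = 0" "G $ 0 \<noteq> 0"
    and h2: "frobenius_op U a h2 = 0"
    and h1: "frobenius_op U a h1 + (fps_const 2 * euler h2 + fps_const (2 * a - 1) * h2) = 0"
  shows "h2 = 0"
proof (rule ccontr)
  assume "h2 \<noteq> 0"
  define m where "m = subdegree h2"
  have m: "h2 $ m \<noteq> 0" "\<And>i. i < m \<Longrightarrow> h2 $ i = 0"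
    using \<open>h2 \<noteq> 0\<close> by (auto simp: m_def)
  have fac: "(a + of_nat k) * (a + of_nat k - 1) - U $ 0 = (a + of_nat k - \<rho>) * (a + of_nat k + \<rho> - 1)" for k
    by (simp add: U0 algebra_simps)
  have "frobenius_op U a h2 $ m = ((a + of_nat m) * (a + of_nat m - 1) - U $ 0) * h2 $ m"
    by (rule frobenius_op_nth_lowest) (use m in auto)
  hence root: "(a + of_nat m - \<rho>) * (a + of_nat m + \<rho> - 1) = 0"
    using m h2 by (simp only: fac fps_zero_nth mult_eq_0_iff) simp
  moreover have rN: "\<rho> + of_nat N = 1 - \<rho>"
    using \<rho> by (simp add: algebra_simps)
  ultimately have exps: "a + of_nat m = \<rho> \<or> a + of_nat m = \<rho> + of_nat N"
    unfolding rN mult_eq_0_iff by (auto simp: algebra_simps)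
  \<comment> \<open>A correction is called for only if \<open>h2\<close> starts at the upper root.
    Then the index \<open>m - N\<close> sits at the lower root, where the recursion leaves the
    coefficient of \<open>h1\<close> free. If \<open>m < N\<close>, there is no such index.\<close>
  define g where "g = (if a + of_nat m = \<rho> + of_nat N \<and> N \<le> m
     then h1 - fps_const (h1 $ (m - N) / G $ 0) * (fps_X ^ (m - N) * G) else h1)"
  have "frobenius_op U a g = frobenius_op U a h1"
  proof (cases "a + of_nat m = \<rho> + of_nat N \<and> N \<le> m")
    case True
    hence "a + of_nat (m - N) = \<rho>" by (simp add: of_nat_diff algebra_simps)
    thus ?thesis using True G
      by (simp add: g_def frobenius_op_diff frobenius_op_cmult frobenius_op_X_power_mult)
  qed (auto simp: g_def)
  hence g: "frobenius_op U a g $ k + (2 * (a + of_nat k) - 1) * h2 $ k = 0" for k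
    using arg_cong[OF h1, of "\<lambda>F. F $ k"]
    by (simp add: algebra_simps)
  have N': "of_nat N \<noteq> (0::complex)" using N by simp
  have gz: "g $ j = 0" if "j < m" for j
    using that
  proof (induction j rule: less_induct)
    case (less j)
    have "((a + of_nat j) * (a + of_nat j - 1) - U $ 0) * g $ j = 0"
      using g[of j] frobenius_op_nth_lowest[of j g U a] less m by simp
    hence eq: "(a + of_nat j - \<rho>) * (a + of_nat j + \<rho> - 1) * g $ j = 0" by (simp only: fac)
    show ?case
    proof (cases "a + of_nat m = \<rho>")
      case True
      have 1: "a + of_nat j - \<rho> = of_nat j - of_nat m" using True by (simp add: algebra_simps)
      have 2: "a + of_nat j + \<rho> - 1 = of_nat j - of_nat (m + N)"
      proof -
        have "of_nat N = 1 - 2 * \<rho>" "a = \<rho> - of_nat m" using True \<rho> by (simp_all add: algebra_simps)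
        thus ?thesis by simp
      qed
      show ?thesis using eq less.prems unfolding 1 2 by (simp flip: of_nat_add)
    next
      case False
      hence e: "a + of_nat m = \<rho> + of_nat N" using exps by blast
      have 1: "a + of_nat j - \<rho> = of_nat (j + N) - of_nat m" using e by (simp add: algebra_simps)
      have 2: "a + of_nat j + \<rho> - 1 = of_nat j - of_nat m" using e \<rho> by (simp add: algebra_simps)
      have "j + N = m \<or> g $ j = 0" using eq less.prems unfolding 1 2 by (simp flip: of_nat_add)
      moreover have "g $ j = 0" if "j + N = m"
        using that e G by (auto simp: g_def fps_X_power_mult_nth)
      ultimately show ?thesis by blast
    qed
  qed
  have "frobenius_op U a g $ m = 0"
    using frobenius_op_nth_lowest[of m g U a] gz by (simp only: fac root) simp
  \<comment> \<open>The factor on the left is the derivative of the indicial polynomial at the root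
    \<open>a + m\<close>, so it is N or -N.\<close>
  hence "2 * (a + of_nat m) - 1 = 0" using g[of m] m by simp
  moreover have "2 * \<rho> - 1 = - of_nat N" "2 * (\<rho> + of_nat N) - 1 = of_nat N"
    using \<rho> by (simp_all add: algebra_simps)
  moreover have "2 * (a + of_nat m) - 1 = 2 * \<rho> - 1 \<or> 2 * (a + of_nat m) - 1 = 2 * (\<rho> + of_nat N) - 1"
    using exps by metis
  ultimately show False using N' by (metis neg_equal_0_iff_equal)
qed

text \<open>The coefficients at \<open>0\<close> and \<open>N\<close>, where the indicial factor \<open>k (k - N)\<close> vanishes, are prescribed by
  \<open>c\<close>.\<close>

function frobenius_coeff ::
  "(nat \<Rightarrow> complex) \<Rightarrow> nat \<Rightarrow> (nat \<Rightarrow> complex) \<Rightarrow> (nat \<Rightarrow> complex) \<Rightarrow> nat \<Rightarrow> complex" where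
  "frobenius_coeff U N c e k = (if k = 0 \<or> k = N then c k else
     ((\<Sum>j\<in>{..<k}. U (k - j) * frobenius_coeff U N c e j) + e k) / (of_nat k * (of_nat k - of_nat N)))"
  by pat_completeness auto
termination by (relation "Wellfounded.measure (\<lambda>(U, N, c, e, k). k)") auto

declare frobenius_coeff.simps [simp del]

text \<open>At exponent \<rho> + k the indicial factor is k (k - N), so the recursion meets every
  prescribed value \<open>e k\<close> except at the indices 0 and N. The value at N is the
  obstruction. The right-hand side \<open>e\<close> is there for the series that accompanies a
  logarithm.\<close>

lemma frobenius_op_frobenius_coeff:
  fixes U :: "complex fps" and c e :: "nat \<Rightarrow> complex"
  assumes U0: "U $ 0 = \<rho> * (\<rho> - 1)" and \<rho>: "2 * \<rho> = 1 - of_nat N"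
  defines "a \<equiv> frobenius_coeff (fps_nth U) N c e"
  shows "frobenius_op U \<rho> (Abs_fps a) $ k =
    (if k = 0 then 0 else if k = N then - (\<Sum>j<N. U $ (N - j) * a j) else e k)"
proof -
  have "(\<Sum>i=0..k. U $ i * a (k - i)) = (\<Sum>i=0..k. U $ (k - i) * a i)"
    by (subst sum.atLeastAtMost_rev) (simp add: atLeast0AtMost)
  also have "\<dots> = (\<Sum>i\<in>insert k {..<k}. U $ (k - i) * a i)" by (rule sum.cong) auto
  finally have s: "(\<Sum>i=0..k. U $ i * a (k - i)) = (\<Sum>j<k. U $ (k - j) * a j) + U $ 0 * a k"
    by (simp add: algebra_simps)
  have "(\<rho> + of_nat k) * (\<rho> + of_nat k - 1) = \<rho> * (\<rho> - 1) + of_nat k * (2 * \<rho> - 1 + of_nat k)"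
    by (simp add: algebra_simps)
  also have "2 * \<rho> - 1 + of_nat k = of_nat k - of_nat N" using \<rho> by (simp add: algebra_simps)
  finally have t: "frobenius_op U \<rho> (Abs_fps a) $ k =
      of_nat k * (of_nat k - of_nat N) * a k - (\<Sum>j<k. U $ (k - j) * a j)"
    by (simp only: frobenius_op_nth fps_nth_Abs_fps s U0) (simp add: algebra_simps)
  show ?thesis
  proof (cases "k = 0 \<or> k = N")
    case True
    thus ?thesis by (auto simp: t)
  next
    case False
    have "a k = ((\<Sum>j<k. U $ (k - j) * a j) + e k) / (of_nat k * (of_nat k - of_nat N))"
      unfolding a_def by (subst frobenius_coeff.simps) (use False in simp)
    thus ?thesis using False by (simp add: t)
  qed
qed

text \<open>If k is odd, one of j and k - j is odd, so each product \<open>U $ (k - j) * a j\<close>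
  vanishes once the earlier odd coefficients do. For k = N the same sum is the obstruction.\<close>

lemma even_frobenius_solution:
  assumes U0: "U $ 0 = \<rho> * (\<rho> - 1)" and \<rho>: "2 * \<rho> = 1 - of_nat N" and "odd N"
    and ev: "\<And>k. odd k \<Longrightarrow> U $ k = 0"
  shows "\<exists>G. frobenius_op U \<rho> G = 0 \<and> G $ 0 = 1"
proof -
  \<comment> \<open>The free coefficient at the odd index \<open>N\<close> is set to 0, which keeps
    all odd coefficients zero.\<close>
  define a where "a = frobenius_coeff (fps_nth U) N (\<lambda>k. if k = 0 then 1 else 0) (\<lambda>_. 0)"
  have "a k = 0" if "odd k" for k
    using that
  proof (induction k rule: less_induct)
    case (less k)
    have "(\<Sum>j<k. U $ (k - j) * a j) = 0"
    proof (rule sum.neutral, safe)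
      fix j assume "j < k"
      show "U $ (k - j) * a j = 0"
        using less ev[of "k - j"] \<open>j < k\<close> by (cases "odd j") auto
    qed
    thus ?case unfolding a_def by (subst frobenius_coeff.simps) (use less.prems odd_pos in auto)
  qed
  hence s: "(\<Sum>j<N. U $ (N - j) * a j) = 0"
  proof (intro sum.neutral ballI)
    fix j assume *: "\<And>k. odd k \<Longrightarrow> a k = 0" "j \<in> {..<N}"
    thus "U $ (N - j) * a j = 0"
      using ev[of "N - j"] \<open>odd N\<close> by (cases "odd j") auto
  qed
  have "frobenius_op U \<rho> (Abs_fps a) = 0"
    using frobenius_op_frobenius_coeff[OF U0 \<rho>, of _ "\<lambda>_. 0", folded a_def] s
    by (intro fps_ext) (auto simp: a_def)
  moreover have "Abs_fps a $ 0 = 1"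
    by (simp add: a_def frobenius_coeff.simps)
  ultimately show ?thesis by blast
qed

section \<open>Convergence of the Frobenius series\<close>

lemma frobenius_coeff_bound:
  fixes U c e N
  assumes U: "\<And>k. norm (U k) \<le> C * K ^ k" and e: "\<And>k. norm (e k) \<le> C * K ^ k"
    and CK: "C \<ge> 0" "K > 0"
  defines "a \<equiv> frobenius_coeff U N c e"
  shows "\<exists>D M. M > 0 \<and> (\<forall>k. k > N \<longrightarrow> norm (a k) \<le> D * M ^ k)"
proof -
  \<comment> \<open>Majorant: unlike the convolution in the recursion, \<open>T\<close> satisfies a
    first order recursion. Beyond \<open>N\<close> the denominators have norm at least 1, which
    gives \<open>norm (a k) \<le> C * b k\<close>, and \<open>b\<close> grows at most by the ratio
    \<open>K * (1 + C)\<close>. Up to \<open>N\<close> the prescribed values \<open>c\<close> may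
    break such a bound.\<close>
  define T where "T = (\<lambda>k. \<Sum>j<k. K ^ (k - j) * norm (a j))"
  define b where "b = (\<lambda>k. T k + K ^ k)"
  have T_Suc: "T (Suc k) = K * (T k + norm (a k))" for k
  proof -
    have "(\<Sum>j<k. K ^ (Suc k - j) * norm (a j)) = (\<Sum>j<k. K * (K ^ (k - j) * norm (a j)))"
      by (rule sum.cong) (auto simp: Suc_diff_le)
    thus ?thesis by (simp add: T_def sum_distrib_left algebra_simps)
  qed
  have b0: "b k \<ge> 0" for k
    unfolding b_def T_def using CK by (intro add_nonneg_nonneg sum_nonneg) auto
  have ak: "norm (a k) \<le> C * b k" if "k > N" for k
  proof -
    have "norm (of_nat k * (of_nat k - of_nat N :: complex)) = real (k * (k - N))"
    proof -
      have "of_nat k * (of_nat k - of_nat N :: complex) = of_nat (k * (k - N))"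
        using that by (simp add: of_nat_diff)
      thus ?thesis by (simp only: norm_of_nat)
    qed
    also have "\<dots> \<ge> 1" using that
      by (metis Suc_leI less_nat_zero_code mult_is_0 nat_neq_iff not_gr_zero of_nat_1 of_nat_mono One_nat_def zero_less_diff)
    finally have d: "norm (of_nat k * (of_nat k - of_nat N :: complex)) \<ge> 1" .
    have "k \<noteq> 0" "k \<noteq> N" using that by auto
    hence "a k = ((\<Sum>j<k. U (k - j) * a j) + e k) / (of_nat k * (of_nat k - of_nat N))"
      unfolding a_def by (subst frobenius_coeff.simps) simp
    hence "norm (a k) = norm ((\<Sum>j<k. U (k - j) * a j) + e k) / norm (of_nat k * (of_nat k - of_nat N :: complex))"
      by (simp add: norm_divide)
    also have "\<dots> \<le> norm ((\<Sum>j<k. U (k - j) * a j) + e k) / 1"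
      by (rule divide_left_mono[OF d norm_ge_zero]) (use d in linarith)
    also have "\<dots> \<le> (\<Sum>j<k. norm (U (k - j) * a j)) + norm (e k)"
      by (simp add: norm_triangle_le norm_sum)
    also have "\<dots> \<le> (\<Sum>j<k. C * K ^ (k - j) * norm (a j)) + C * K ^ k"
      by (intro add_mono sum_mono e) (auto simp: norm_mult intro!: mult_right_mono U)
    also have "\<dots> = C * b k"
      by (simp add: b_def T_def sum_distrib_left algebra_simps)
    finally show ?thesis .
  qed
  define M where "M = K * (1 + C)"
  have M: "M > 0" using CK by (simp add: M_def)
  have step: "b (Suc k) \<le> M * b k" if "k > N" for k
  proof -
    have "b (Suc k) = K * (b k + norm (a k))"
      by (simp add: b_def T_Suc algebra_simps)
    also have "\<dots> \<le> K * (b k + C * b k)"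
      using CK ak[OF that] by (intro mult_left_mono) auto
    finally show ?thesis by (simp add: M_def algebra_simps)
  qed
  have bb: "b k \<le> b (Suc N) / M ^ Suc N * M ^ k" if "k \<ge> Suc N" for k
    using that
  proof (induction k rule: dec_induct)
    case base
    then show ?case using M by simp
  next
    case (step k)
    have "b (Suc k) \<le> M * b k" using \<open>\<And>k. k > N \<Longrightarrow> b (Suc k) \<le> M * b k\<close> step by simp
    also have "\<dots> \<le> M * (b (Suc N) / M ^ Suc N * M ^ k)"
      using step M by (intro mult_left_mono) auto
    finally show ?case by (simp add: algebra_simps)
  qed
  have "norm (a k) \<le> (C * (b (Suc N) / M ^ Suc N)) * M ^ k" if "k > N" for k
    using ak[OF that] mult_left_mono[OF bb, of k C] that CK by (simp add: algebra_simps)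
  thus ?thesis using M by blast
qed

text \<open>Positive radius is expressed by a geometric bound because that is what the recursion
  passes on from the data to the solution.\<close>

lemma fps_conv_radius_pos_iff_bound:
  fixes F :: "complex fps"
  shows "fps_conv_radius F > 0 \<longleftrightarrow> (\<exists>C K. C \<ge> 0 \<and> K > 0 \<and> (\<forall>k. norm (F $ k) \<le> C * K ^ k))"
proof
  assume "fps_conv_radius F > 0"
  then obtain r where r: "r > 0" "ereal r < fps_conv_radius F"
    by (metis ereal_dense2 ereal_less(2))
  have "summable (\<lambda>k. F $ k * of_real r ^ k)"
    by (rule summable_fps) (use r in auto)
  hence "Bseq (\<lambda>k. F $ k * of_real r ^ k)"
    by (meson summable_LIMSEQ_zero convergentI convergent_imp_Bseq)
  then obtain C where C: "C > 0" "\<And>k. norm (F $ k * of_real r ^ k) \<le> C"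
    by (auto elim: BseqE)
  have "norm (F $ k) \<le> C * (1 / r) ^ k" for k
    using C(2)[of k] r by (simp add: norm_mult norm_power field_simps)
  thus "\<exists>C K. C \<ge> 0 \<and> K > 0 \<and> (\<forall>k. norm (F $ k) \<le> C * K ^ k)"
    using C(1) r(1) by (intro exI[of _ C] exI[of _ "1 / r"]) auto
next
  assume "\<exists>C K. C \<ge> 0 \<and> K > 0 \<and> (\<forall>k. norm (F $ k) \<le> C * K ^ k)"
  then obtain C K where CK: "C \<ge> 0" "K > 0" "\<And>k. norm (F $ k) \<le> C * K ^ k" by blast
  define z :: complex where "z = of_real (1 / (2 * K))"
  have "summable (\<lambda>k. F $ k * z ^ k)"
  proof (rule summable_comparison_test)
    show "\<exists>N. \<forall>n\<ge>N. norm (F $ n * z ^ n) \<le> C * (1 / 2) ^ n"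
    proof (intro exI[of _ 0] allI impI)
      fix n
      have "norm (F $ n * z ^ n) \<le> (C * K ^ n) * (1 / (2 * K)) ^ n"
        using CK by (auto simp: norm_mult norm_power z_def norm_divide intro!: mult_mono)
      also have "\<dots> = C * (1 / 2) ^ n" using CK by (simp add: power_divide power_mult_distrib field_simps)
      finally show "norm (F $ n * z ^ n) \<le> C * (1 / 2) ^ n" .
    qed
    show "summable (\<lambda>n. C * (1 / 2) ^ n :: real)" by (intro summable_mult summable_geometric) auto
  qed
  hence "norm z \<le> fps_conv_radius F"
    unfolding fps_conv_radius_def by (rule conv_radius_geI)
  moreover have "norm z > 0" using CK by (simp add: z_def)
  ultimately show "fps_conv_radius F > 0" by (metis ereal_less(2) less_le_trans)
qed

lemma fps_conv_radius_frobenius_coeff: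
  assumes U: "fps_conv_radius U > 0" and E: "fps_conv_radius E > 0"
  shows "fps_conv_radius (Abs_fps (frobenius_coeff (fps_nth U) N c (fps_nth E))) > 0"
proof -
  obtain C1 K1 where 1: "C1 \<ge> 0" "K1 > 0" "\<And>k. norm (U $ k) \<le> C1 * K1 ^ k"
    using U by (auto simp: fps_conv_radius_pos_iff_bound)
  obtain C2 K2 where 2: "C2 \<ge> 0" "K2 > 0" "\<And>k. norm (E $ k) \<le> C2 * K2 ^ k"
    using E by (auto simp: fps_conv_radius_pos_iff_bound)
  define C where "C = max C1 C2"
  define K where "K = max K1 K2"
  have "C1 * K1 ^ k \<le> C * K ^ k" "C2 * K2 ^ k \<le> C * K ^ k" for k
    using 1 2 by (auto simp: C_def K_def intro!: mult_mono power_mono)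
  hence b: "norm (U $ k) \<le> C * K ^ k" "norm (E $ k) \<le> C * K ^ k" for k
    using 1(3) 2(3) order_trans by blast+
  have CK: "C \<ge> 0" "K > 0" using 1 2 by (auto simp: C_def K_def)
  define a where "a = frobenius_coeff (fps_nth U) N c (fps_nth E)"
  obtain D M where DM: "M > 0" "\<And>k. k > N \<Longrightarrow> norm (a k) \<le> D * M ^ k"
    using frobenius_coeff_bound[OF b CK, of N c] unfolding a_def by blast
  \<comment> \<open>The maximum absorbs the finitely many coefficients up to \<open>N\<close>; the
    entry \<open>\<bar>D\<bar>\<close> makes it nonnegative and at least \<open>D\<close>.\<close>
  define D' where "D' = Max (insert \<bar>D\<bar> ((\<lambda>k. norm (a k) / M ^ k) ` {..N}))"
  have "\<bar>D\<bar> \<le> D'" unfolding D'_def by (rule Max_ge) auto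
  have "norm (a k) \<le> D' * M ^ k" for k
  proof (cases "k > N")
    case True
    have "D * M ^ k \<le> D' * M ^ k"
      using \<open>\<bar>D\<bar> \<le> D'\<close> DM by (intro mult_right_mono) auto
    thus ?thesis using DM(2)[OF True] by linarith
  next
    case False
    hence "norm (a k) / M ^ k \<le> D'" unfolding D'_def by (intro Max_ge) auto
    thus ?thesis using DM by (simp add: field_simps)
  qed
  thus ?thesis
    unfolding fps_conv_radius_pos_iff_bound a_def[symmetric]
    using DM(1) \<open>\<bar>D\<bar> \<le> D'\<close> by (intro exI[of _ D'] exI[of _ M]) auto
qed

section \<open>Logarithmic solutions on slit discs\<close>

lemma mem_slit_disc: "z \<in> slit_disc z0 r \<longleftrightarrow> norm (z - z0) < r \<and> z - z0 \<notin> \<real>\<^sub>\<le>\<^sub>0"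
  by (auto simp: slit_disc_def dist_norm norm_minus_commute)

lemma slit_disc_shift: "z \<in> slit_disc z0 r \<longleftrightarrow> z - z0 \<in> slit_disc 0 r"
  by (simp add: mem_slit_disc)

lemma open_slit_disc: "open (slit_disc z0 r)"
proof -
  have "slit_disc z0 r = ball z0 r \<inter> (\<lambda>z. z - z0) -` (- \<real>\<^sub>\<le>\<^sub>0)"
    by (auto simp: slit_disc_def)
  moreover have "open ((\<lambda>z. z - z0) -` (- \<real>\<^sub>\<le>\<^sub>0))"
    by (intro open_vimage continuous_intros) auto
  ultimately show ?thesis by auto
qed

lemma slit_disc_nonempty: "r > 0 \<Longrightarrow> slit_disc z0 r \<noteq> {}"
proof -
  assume "r > 0"
  hence "z0 + of_real (r / 2) \<in> slit_disc z0 r"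
    by (simp add: mem_slit_disc complex_nonpos_Reals_iff)
  thus ?thesis by blast
qed

lemma holomorphic_zero_on_slit_disc:
  assumes "f holomorphic_on ball 0 r" "r > 0" "\<And>x. x \<in> slit_disc 0 r \<Longrightarrow> f x = 0" "x \<in> ball 0 r"
  shows "f x = 0"
proof (rule analytic_continuation_open[of "slit_disc 0 r" "ball 0 r" f "\<lambda>_. 0"])
  show "slit_disc 0 r \<subseteq> ball 0 r" by (auto simp: slit_disc_def)
qed (use assms in \<open>auto intro: open_slit_disc simp: slit_disc_nonempty simp del: mem_ball\<close>)

lemma holomorphic_has_fps_expansion:
  assumes "f holomorphic_on ball 0 r" "r > 0"
  shows "f has_fps_expansion fps_expansion f 0"
  using assms by (intro analytic_at_imp_has_fps_expansion_0 holomorphic_on_imp_analytic_at[of _ "ball 0 r"]) auto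

lemma has_fps_expansion_0_ball:
  assumes "f holomorphic_on ball 0 r" "r > 0" "f has_fps_expansion 0" "x \<in> ball 0 r"
  shows "f x = 0"
  using assms by (intro has_fps_expansion_0_analytic_continuation[of f "ball 0 r"]) auto

text \<open>Eliminating the logarithm between the equation and its derivative gives
  \<open>x (A / B)' = -1\<close>, but the derivative of a Laurent series has no residue.\<close>

lemma log_combination_zero:
  assumes A: "A holomorphic_on ball 0 r" and B: "B holomorphic_on ball 0 r" and r: "r > 0"
    and eq: "\<And>x. x \<in> slit_disc 0 r \<Longrightarrow> A x + B x * Ln x = 0"
    and x: "x \<in> ball 0 r"
  shows "A x = 0 \<and> B x = 0"
proof -
  define Af where "Af = fps_expansion A 0"
  define Bf where "Bf = fps_expansion B 0"
  have Af: "A has_fps_expansion Af" and Bf: "B has_fps_expansion Bf"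
    unfolding Af_def Bf_def using A B r by (auto intro: holomorphic_has_fps_expansion)
  \<comment> \<open>\<open>C\<close> no longer contains the logarithm and is holomorphic on the full
    ball, so its vanishing on the slit disc extends to the centre, where it can be expanded.\<close>
  define C where "C = (\<lambda>x. x * (B x * deriv A x - deriv B x * A x) + B x * B x)"
  have Chol: "C holomorphic_on ball 0 r"
    unfolding C_def by (intro holomorphic_intros A B) auto
  have "C x = 0" if x: "x \<in> slit_disc 0 r" for x
  proof -
    have x': "x \<in> ball 0 r" "x \<notin> \<real>\<^sub>\<le>\<^sub>0" "x \<noteq> 0" using x by (auto simp: slit_disc_def)
    have dA: "(A has_field_derivative deriv A x) (at x)" and dB: "(B has_field_derivative deriv B x) (at x)"
      using A B x' by (auto intro: holomorphic_derivI)
    have "((\<lambda>x. A x + B x * Ln x) has_field_derivative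
       (deriv A x + (deriv B x * Ln x + B x / x))) (at x)"
      by (rule derivative_eq_intros dA dB x' refl | simp add: field_simps)+
    moreover have "((\<lambda>x. A x + B x * Ln x) has_field_derivative 0) (at x)
        \<longleftrightarrow> ((\<lambda>_. 0) has_field_derivative (0::complex)) (at x)"
      by (rule DERIV_cong_ev) (use eq x open_slit_disc in \<open>auto simp: eventually_nhds\<close>)
    ultimately have d: "deriv A x + (deriv B x * Ln x + B x / x) = 0"
      using DERIV_unique by fastforce
    have "C x = x * B x * (deriv A x + (deriv B x * Ln x + B x / x)) - x * deriv B x * (A x + B x * Ln x)"
      using x' by (simp add: C_def algebra_simps)
    thus ?thesis using d eq[OF x] by simp
  qed
  hence "C x = 0" if "x \<in> ball 0 r" for x
    using holomorphic_zero_on_slit_disc[OF Chol r] that by blast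
  hence "C has_fps_expansion 0"
    using r by (subst has_fps_expansion_0_iff) (auto simp: eventually_nhds intro!: exI[of _ "ball 0 r"])
  moreover have "C has_fps_expansion (fps_X * (Bf * fps_deriv Af - fps_deriv Bf * Af) + Bf * Bf)"
    unfolding C_def by (intro fps_expansion_intros Af Bf)
  ultimately have e: "fps_X * (Bf * fps_deriv Af - fps_deriv Bf * Af) + Bf * Bf = 0"
    using fps_expansion_unique_complex by blast
  have "Bf = 0"
  proof (rule ccontr)
    assume nz: "Bf \<noteq> 0"
    define a where "a = fps_to_fls Af"
    define b where "b = fps_to_fls Bf"
    have b: "b \<noteq> 0" using nz by (simp add: b_def)
    have "fps_to_fls (fps_X * (Bf * fps_deriv Af - fps_deriv Bf * Af) + Bf * Bf) = 0"
      using e by simp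
    hence e': "fls_X * (b * fls_deriv a - fls_deriv b * a) + b * b = 0"
      by (simp add: a_def b_def fls_times_fps_to_fls fls_deriv_fps_to_fls)
    define M where "M = a / b"
    have "a = M * b" using b by (simp add: M_def)
    hence "fls_X * (b * b * fls_deriv M) + b * b = 0"
      using e' by (simp add: algebra_simps)
    hence "b * b * (fls_X * fls_deriv M + 1) = 0" by (simp add: algebra_simps)
    hence "fls_X * fls_deriv M = -1" using b by (simp add: eq_neg_iff_add_eq_0)
    hence "fls_nth (fls_X * fls_deriv M) 0 = fls_nth (- 1 :: complex fls) 0" by simp
    moreover have "fls_nth (fls_X * fls_deriv M) 0 = fls_nth (fls_deriv M) (- 1)"
      by (simp add: fls_X_times_conv_shift)
    ultimately show False using fls_deriv_residue[of M] by simp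
  qed
  hence B0: "B y = 0" if "y \<in> ball 0 r" for y
    using has_fps_expansion_0_ball[OF B r] Bf that by simp
  have "A y = 0" if "y \<in> slit_disc 0 r" for y
    using eq[OF that] B0[of y] that by (simp add: slit_disc_def)
  thus ?thesis using holomorphic_zero_on_slit_disc[OF A r] B0 x by blast
qed

definition log_form ::
  "complex \<Rightarrow> complex \<Rightarrow> (complex \<Rightarrow> complex) \<Rightarrow> (complex \<Rightarrow> complex) \<Rightarrow> complex \<Rightarrow> complex" where
  "log_form z0 a g h z = (z - z0) powr a * (g (z - z0) + h (z - z0) * Ln (z - z0))"

text \<open>Logarithmic forms are closed under differentiation, with the exponent lowered by one. A
  differential equation for them thus becomes one for the two holomorphic coefficients.\<close>

lemma log_form_has_derivative:
  assumes g: "g holomorphic_on ball 0 r" and h: "h holomorphic_on ball 0 r"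
    and z: "z \<in> slit_disc z0 r"
  shows "(log_form z0 a g h has_field_derivative
      log_form z0 (a - 1) (\<lambda>x. x * deriv g x + a * g x + h x) (\<lambda>x. x * deriv h x + a * h x) z) (at z)"
proof -
  define x where "x = z - z0"
  have x: "x \<in> ball 0 r" "x \<notin> \<real>\<^sub>\<le>\<^sub>0" "x \<noteq> 0"
    using z by (auto simp: mem_slit_disc x_def)
  have dg: "((\<lambda>z. g (z - z0)) has_field_derivative deriv g x * 1) (at z)"
    by (rule DERIV_chain2[where f = g])
       (use g x in \<open>auto simp: x_def[symmetric] intro!: derivative_eq_intros holomorphic_derivI\<close>)
  have dh: "((\<lambda>z. h (z - z0)) has_field_derivative deriv h x * 1) (at z)"
    by (rule DERIV_chain2[where f = h])
       (use h x in \<open>auto simp: x_def[symmetric] intro!: derivative_eq_intros holomorphic_derivI\<close>)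
  have dL: "((\<lambda>z. Ln (z - z0)) has_field_derivative (1 / x)) (at z)"
    using x by (auto simp: x_def field_simps intro!: derivative_eq_intros)
  have dp: "((\<lambda>z. (z - z0) powr a) has_field_derivative (a * x powr (a - 1))) (at z)"
    using x by (auto simp: x_def intro!: derivative_eq_intros)
  have p: "x powr a = x * x powr (a - 1)"
    using x powr_diff[of x a 1] by (simp add: powr_to_1)
  have "(log_form z0 a g h has_field_derivative
     (a * x powr (a - 1) * (g x + h x * Ln x) + x powr a * (deriv g x + (deriv h x * Ln x + h x / x)))) (at z)"
    unfolding log_form_def [abs_def]
    by (rule derivative_eq_intros dp dg dh dL refl)+ (simp add: x_def[symmetric] algebra_simps)
  moreover have "a * x powr (a - 1) * (g x + h x * Ln x) + x powr a * (deriv g x + (deriv h x * Ln x + h x / x))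
     = x powr (a - 1) * (x * deriv g x + a * g x + h x + (x * deriv h x + a * h x) * Ln x)"
    unfolding p using x by (simp add: field_simps)
  ultimately show ?thesis by (simp add: log_form_def x_def)
qed

lemma log_form_second_derivative:
  fixes a :: complex
  assumes g: "g holomorphic_on ball 0 r" and h: "h holomorphic_on ball 0 r"
    and z: "z \<in> slit_disc z0 r"
  defines "g1 \<equiv> \<lambda>x. x * deriv g x + a * g x + h x" and "h1 \<equiv> \<lambda>x. x * deriv h x + a * h x"
  shows "deriv (deriv (log_form z0 a g h)) z =
     log_form z0 (a - 2) (\<lambda>x. x * deriv g1 x + (a - 1) * g1 x + h1 x)
       (\<lambda>x. x * deriv h1 x + (a - 1) * h1 x) z"
proof -
  have hol: "g1 holomorphic_on ball 0 r" "h1 holomorphic_on ball 0 r"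
    unfolding g1_def h1_def by (intro holomorphic_intros g h; simp)+
  have "eventually (\<lambda>z. z \<in> slit_disc z0 r) (nhds z)"
    using z open_slit_disc eventually_nhds by blast
  hence "eventually (\<lambda>z. deriv (log_form z0 a g h) z = log_form z0 (a - 1) g1 h1 z) (nhds z)"
    by eventually_elim (use log_form_has_derivative[OF g h] in \<open>auto simp: g1_def h1_def intro: DERIV_imp_deriv\<close>)
  hence "deriv (deriv (log_form z0 a g h)) z = deriv (log_form z0 (a - 1) g1 h1) z"
    by (rule deriv_cong_ev) simp
  also have "\<dots> = log_form z0 (a - 2) (\<lambda>x. x * deriv g1 x + (a - 1) * g1 x + h1 x)
       (\<lambda>x. x * deriv h1 x + (a - 1) * h1 x) z"
    using log_form_has_derivative[OF hol z, of "a - 1"] by (simp add: DERIV_imp_deriv)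
  finally show ?thesis .
qed

text \<open>Both \<open>w''\<close> and \<open>q w\<close> carry the factor z^(a-2); cancelling it
  leaves A + B Ln = 0, and \<open>log_combination_zero\<close> separates A from B. The extra terms
  in the second equation arise where a derivative falls on the logarithm: they are the derivative of
  the indicial operator with respect to a.\<close>

lemma log_form_solution_iff:
  assumes r: "r > 0" and g: "g holomorphic_on ball 0 r" and h: "h holomorphic_on ball 0 r"
    and U: "U holomorphic_on ball 0 r"
    and q: "\<And>x. x \<in> ball 0 r - {0} \<Longrightarrow> q (z0 + x) = U x / x\<^sup>2"
    and G: "g has_fps_expansion G" and H: "h has_fps_expansion H" and W: "U has_fps_expansion W"
  shows "solution_on q (slit_disc z0 r) (log_form z0 a g h) \<longleftrightarrow>
     frobenius_op W a H = 0 \<and>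
     frobenius_op W a G + (fps_const 2 * euler H + fps_const (2 * a - 1) * H) = 0"
proof -
  define g1 where "g1 = (\<lambda>x. x * deriv g x + a * g x + h x)"
  define h1 where "h1 = (\<lambda>x. x * deriv h x + a * h x)"
  have hol: "g1 holomorphic_on ball 0 r" "h1 holomorphic_on ball 0 r"
    unfolding g1_def h1_def by (intro holomorphic_intros g h; simp)+
  have exp1: "g1 has_fps_expansion (euler G + fps_const a * G + H)"
     "h1 has_fps_expansion (euler H + fps_const a * H)"
    unfolding g1_def h1_def euler_def by (intro fps_expansion_intros G H)+
  define A where "A = (\<lambda>x. x * deriv g1 x + (a - 1) * g1 x + h1 x - U x * g x)"
  define B where "B = (\<lambda>x. x * deriv h1 x + (a - 1) * h1 x - U x * h x)"
  have AB: "A holomorphic_on ball 0 r" "B holomorphic_on ball 0 r"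
    unfolding A_def B_def by (intro holomorphic_intros hol g h U; simp)+
  have "A has_fps_expansion (euler (euler G + fps_const a * G + H) +
      fps_const (a - 1) * (euler G + fps_const a * G + H) + (euler H + fps_const a * H) - W * G)"
    unfolding A_def by (subst (1) euler_def) (intro fps_expansion_intros exp1 G W)
  also have "\<dots> = frobenius_op W a G + (fps_const 2 * euler H + fps_const (2 * a - 1) * H)"
    by (rule fps_ext) (simp add: frobenius_op_def algebra_simps)
  finally have Aexp: "A has_fps_expansion \<dots>" .
  have "B has_fps_expansion (euler (euler H + fps_const a * H) +
      fps_const (a - 1) * (euler H + fps_const a * H) - W * H)"
    unfolding B_def by (subst (1) euler_def) (intro fps_expansion_intros exp1 H W)
  also have "\<dots> = frobenius_op W a H"
    by (rule fps_ext) (simp add: frobenius_op_def algebra_simps)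
  finally have Bexp: "B has_fps_expansion \<dots>" .
  have "log_form z0 a g h holomorphic_on slit_disc z0 r"
    using log_form_has_derivative[OF g h] open_slit_disc
    by (auto simp: holomorphic_on_open)
  hence "solution_on q (slit_disc z0 r) (log_form z0 a g h) \<longleftrightarrow>
    (\<forall>z\<in>slit_disc z0 r. deriv (deriv (log_form z0 a g h)) z = q z * log_form z0 a g h z)"
    by (simp add: solution_on_def)
  also have "\<dots> \<longleftrightarrow> (\<forall>z\<in>slit_disc z0 r. A (z - z0) + B (z - z0) * Ln (z - z0) = 0)"
  proof (intro ball_cong refl)
    fix z assume z: "z \<in> slit_disc z0 r"
    define x where "x = z - z0"
    have x: "x \<in> ball 0 r" "x \<notin> \<real>\<^sub>\<le>\<^sub>0" "x \<noteq> 0"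
      using z by (auto simp: mem_slit_disc x_def)
    have "q z = U x / x\<^sup>2" using q[of x] x by (simp add: x_def)
    moreover have "x powr a = x\<^sup>2 * x powr (a - 2)"
      using x powr_diff[of x a 1] powr_diff[of x "a - 1" 1] by (simp add: powr_to_1 power2_eq_square)
    ultimately have "q z * log_form z0 a g h z = x powr (a - 2) * (U x * (g x + h x * Ln x))"
      using x by (simp add: log_form_def x_def[symmetric])
    moreover have "deriv (deriv (log_form z0 a g h)) z = x powr (a - 2) *
      (x * deriv g1 x + (a - 1) * g1 x + h1 x + (x * deriv h1 x + (a - 1) * h1 x) * Ln x)"
      using log_form_second_derivative[OF g h z, of a] 
      by (simp add: log_form_def x_def g1_def h1_def)
    ultimately have "deriv (deriv (log_form z0 a g h)) z = q z * log_form z0 a g h z \<longleftrightarrow>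
       x * deriv g1 x + (a - 1) * g1 x + h1 x + (x * deriv h1 x + (a - 1) * h1 x) * Ln x =
       U x * (g x + h x * Ln x)" using x by simp
    also have "\<dots> \<longleftrightarrow> A x + B x * Ln x = 0"
      by (simp add: A_def B_def algebra_simps)
    finally show "deriv (deriv (log_form z0 a g h)) z = q z * log_form z0 a g h z \<longleftrightarrow>
       A (z - z0) + B (z - z0) * Ln (z - z0) = 0" by (simp add: x_def)
  qed
  also have "\<dots> \<longleftrightarrow> (\<forall>x\<in>slit_disc 0 r. A x + B x * Ln x = 0)"
  proof safe
    fix x assume "\<forall>z\<in>slit_disc z0 r. A (z - z0) + B (z - z0) * Ln (z - z0) = 0" "x \<in> slit_disc 0 r"
    moreover from this have "z0 + x \<in> slit_disc z0 r" by (subst slit_disc_shift) simp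
    ultimately show "A x + B x * Ln x = 0" by force
  qed (simp add: slit_disc_shift[of _ z0])
  also have "\<dots> \<longleftrightarrow> (\<forall>x\<in>ball 0 r. A x = 0 \<and> B x = 0)"
  proof
    assume "\<forall>x\<in>slit_disc 0 r. A x + B x * Ln x = 0"
    thus "\<forall>x\<in>ball 0 r. A x = 0 \<and> B x = 0"
      using log_combination_zero[OF AB r] by blast
  qed (simp add: slit_disc_def)
  also have "\<dots> \<longleftrightarrow> A has_fps_expansion 0 \<and> B has_fps_expansion 0"
  proof safe
    show "A has_fps_expansion 0" "B has_fps_expansion 0" if "\<forall>x\<in>ball 0 r. A x = 0 \<and> B x = 0"
      using that r by (auto simp: has_fps_expansion_0_iff eventually_nhds intro!: exI[of _ "ball 0 r"])
  qed (use has_fps_expansion_0_ball AB r in blast)+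
  also have "\<dots> \<longleftrightarrow> frobenius_op W a H = 0 \<and>
     frobenius_op W a G + (fps_const 2 * euler H + fps_const (2 * a - 1) * H) = 0"
    using Aexp Bexp fps_expansion_unique_complex by metis
  finally show ?thesis .
qed

lemma solution_on_subset_cong:
  assumes "solution_on q S w" "T \<subseteq> S" "open T" "\<And>z. z \<in> T \<Longrightarrow> w z = v z"
  shows "solution_on q T v"
  unfolding solution_on_def
proof (intro conjI ballI)
  show "v holomorphic_on T"
    using assms holomorphic_on_subset holomorphic_transform unfolding solution_on_def by metis
  fix z assume z: "z \<in> T"
  hence ev: "eventually (\<lambda>z. v z = w z) (nhds z)"
    using assms by (auto simp: eventually_nhds)
  hence "deriv (deriv v) z = (deriv ^^ 2) w z"
    using higher_deriv_cong_ev[OF ev refl, of 2] by (simp add: numeral_2_eq_2)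
  also have "\<dots> = q z * w z"
    using assms z by (auto simp: solution_on_def numeral_2_eq_2)
  finally show "deriv (deriv v) z = q z * v z" using assms(4)[OF z] by simp
qed

text \<open>A logarithmic solution is expanded at \<open>z0\<close> and compared with
  \<open>G\<close> by \<open>logarithmic_part_zero\<close>. The comparison is formal:
  \<open>G\<close> enters only through its coefficients.\<close>

theorem log_free_criterion:
  assumes R: "R > 0" and U: "U holomorphic_on ball 0 R" "U has_fps_expansion W"
    and q: "\<And>x. x \<in> ball 0 R - {0} \<Longrightarrow> q (z0 + x) = U x / x\<^sup>2"
    and W0: "W $ 0 = \<rho> * (\<rho> - 1)" and \<rho>: "2 * \<rho> = 1 - of_nat N" and N: "N > 0"
    and G: "frobenius_op W \<rho> G = 0" "G $ 0 \<noteq> 0"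
  shows "log_free_at q z0"
  unfolding log_free_at_def
proof safe
  fix r w assume "r > (0::real)" and w: "solution_on q (slit_disc z0 r) w" "has_log_term z0 r w"
  then obtain a h1 h2 where h: "h1 holomorphic_on ball z0 r" "h2 holomorphic_on ball z0 r"
     "\<exists>z\<in>ball z0 r. h2 z \<noteq> 0"
     and eq: "\<And>z. z \<in> slit_disc z0 r \<Longrightarrow> w z = (z - z0) powr a * (h1 z + h2 z * Ln (z - z0))"
    unfolding has_log_term_def by blast
  \<comment> \<open>The logarithmic solution brings its own radius \<open>r\<close>, which may
    exceed the radius where \<open>U\<close> describes \<open>q\<close>. The vanishing of
    \<open>h2\<close> is shown on the smaller ball and continued to the larger one at the
    end.\<close>
  define r' where "r' = min r R"
  have r': "r' > 0" "r' \<le> r" "r' \<le> R" using R \<open>r > 0\<close> by (auto simp: r'_def)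
  define f where "f = (\<lambda>x. h1 (z0 + x))"
  define g where "g = (\<lambda>x. h2 (z0 + x))"
  have hol: "f holomorphic_on ball 0 r'" "g holomorphic_on ball 0 r'"
    unfolding f_def g_def using r'
    by (auto intro!: holomorphic_on_compose_gen[OF _ h(1), unfolded o_def] 
          holomorphic_on_compose_gen[OF _ h(2), unfolded o_def] holomorphic_intros simp: dist_norm)
  have sub: "slit_disc z0 r' \<subseteq> slit_disc z0 r" using r' by (auto simp: mem_slit_disc)
  have "solution_on q (slit_disc z0 r') (log_form z0 a f g)"
    by (rule solution_on_subset_cong[OF w(1) sub open_slit_disc])
       (use sub in \<open>auto simp: eq log_form_def f_def g_def\<close>)
  moreover have U': "U holomorphic_on ball 0 r'" using U r' by (auto intro: holomorphic_on_subset)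
  moreover have "q (z0 + x) = U x / x\<^sup>2" if "x \<in> ball 0 r' - {0}" for x
    using q[of x] that r' by simp
  ultimately have
    "frobenius_op W a (fps_expansion g 0) = 0 \<and> frobenius_op W a (fps_expansion f 0) +
      (fps_const 2 * euler (fps_expansion g 0) + fps_const (2 * a - 1) * fps_expansion g 0) = 0"
    using log_form_solution_iff[OF r'(1) hol U' _
        holomorphic_has_fps_expansion[OF hol(1) r'(1)] holomorphic_has_fps_expansion[OF hol(2) r'(1)] U(2),
        of q z0 a] by blast
  hence "fps_expansion g 0 = 0"
    using logarithmic_part_zero[OF W0 \<rho> N G] by blast
  hence "g x = 0" if "x \<in> ball 0 r'" for x
    using has_fps_expansion_0_ball[OF hol(2) r'(1)] holomorphic_has_fps_expansion[OF hol(2) r'(1)] that by simp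
  hence *: "h2 z = 0" if "z \<in> ball z0 r'" for z
    using \<open>\<And>x. x \<in> ball 0 r' \<Longrightarrow> g x = 0\<close>[of "z - z0"] that
    by (simp add: g_def dist_norm norm_minus_commute)
  have "h2 z = 0" if "z \<in> ball z0 r" for z
    by (rule analytic_continuation_open[of "ball z0 r'" "ball z0 r" h2 "\<lambda>_. 0"])
       (use * h r' that in auto)
  thus False using h(3) by blast
qed

text \<open>For N = 2 the obstruction is explicit: a_0 = 1 forces a_1 = - U_1, and what remains at
  index 2 is U_1^2 - U_2. If it is nonzero, a solution with a logarithm is constructed whose
  logarithmic part \<open>H\<close> starts at the upper exponent 3/2.\<close>

theorem log_free_half_integer:
  assumes R: "R > 0" and U: "U holomorphic_on ball 0 R" "U has_fps_expansion W"
    and q: "\<And>x. x \<in> ball 0 R - {0} \<Longrightarrow> q (z0 + x) = U x / x\<^sup>2"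
    and W0: "W $ 0 = 3 / 4"
  shows "log_free_at q z0 \<longleftrightarrow> W $ 2 = (W $ 1)\<^sup>2"
proof -
  define \<rho> :: complex where "\<rho> = - 1 / 2"
  have W0': "W $ 0 = \<rho> * (\<rho> - 1)" and \<rho>: "2 * \<rho> = 1 - of_nat 2" by (simp_all add: W0 \<rho>_def)
  \<comment> \<open>Chosen so that the logarithm pays for the obstruction: at index 2 the terms 2
    euler H + (2 \<rho> - 1) H contribute 4 \<kappa> - 2 \<kappa> = 2 \<kappa>, which has to equal
    U_2 - U_1^2.\<close>
  define \<kappa> where "\<kappa> = (W $ 2 - (W $ 1)\<^sup>2) / 2"
  define h where "h = frobenius_coeff (fps_nth W) 2 (\<lambda>k. if k = 2 then \<kappa> else 0) (fps_nth 0)"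
  define H where "H = Abs_fps h"
  define E where "E = - (fps_const 2 * euler H + fps_const (2 * \<rho> - 1) * H)"
  define g where "g = frobenius_coeff (fps_nth W) 2 (\<lambda>k. if k = 0 then 1 else 0) (fps_nth E)"
  define G where "G = Abs_fps g"
  have h0: "h 0 = 0" unfolding h_def by (subst frobenius_coeff.simps) simp
  have h2: "h 2 = \<kappa>" unfolding h_def by (subst frobenius_coeff.simps) simp
  have h1: "h 1 = 0" unfolding h_def by (subst frobenius_coeff.simps) (simp add: frobenius_coeff.simps)
  have E: "E $ 0 = 0" "E $ 1 = 0" "E $ 2 = - 2 * \<kappa>"
    using h0 h1 h2 by (simp_all add: E_def H_def \<rho>_def)
  have g0: "g 0 = 1" unfolding g_def by (subst frobenius_coeff.simps) simp
  have "g 1 = (W $ 1 * g 0 + E $ 1) / (- 1)" 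
    unfolding g_def by (subst frobenius_coeff.simps) simp
  hence g1: "g 1 = - W $ 1" using g0 E by simp
  have two: "{..<2::nat} = {0, 1}" by auto
  have HE: "frobenius_op W \<rho> H = 0"
    unfolding H_def h_def
    by (rule fps_ext, subst frobenius_op_frobenius_coeff[OF W0' \<rho>])
       (auto simp: h_def[symmetric] two h0 h1[simplified])
  have GE: "frobenius_op W \<rho> G = E"
    unfolding G_def g_def
    by (rule fps_ext, subst frobenius_op_frobenius_coeff[OF W0' \<rho>])
       (auto simp: g_def[symmetric] two g0 g1[simplified] E \<kappa>_def power2_eq_square algebra_simps)
  show ?thesis
  proof
    assume "W $ 2 = (W $ 1)\<^sup>2"
    hence "\<kappa> = 0" by (simp add: \<kappa>_def)
    have "h k = 0" for k
    proof (induction k rule: less_induct)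
      case (less k)
      show ?case unfolding h_def
        by (subst frobenius_coeff.simps) (use less in \<open>auto simp: h_def[symmetric] \<open>\<kappa> = 0\<close>\<close>)
    qed
    hence "H = 0" by (simp add: H_def fps_eq_iff)
    hence "E = 0" by (simp add: E_def euler_def)
    thus "log_free_at q z0"
      using log_free_criterion[OF R U q W0' \<rho>, of G] GE g0 by (simp add: G_def)
  next
    assume lf: "log_free_at q z0"
    show "W $ 2 = (W $ 1)\<^sup>2"
    proof (rule ccontr)
      assume "W $ 2 \<noteq> (W $ 1)\<^sup>2"
      hence nz: "\<kappa> \<noteq> 0" by (simp add: \<kappa>_def)
      have rW: "fps_conv_radius W > 0"
        using U by (auto simp: has_fps_expansion_def)
      have rH: "fps_conv_radius H > 0"
        unfolding H_def h_def by (rule fps_conv_radius_frobenius_coeff[OF rW]) simp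
      have expH: "eval_fps H has_fps_expansion H"
        using rH by (rule eval_fps_has_fps_expansion)
      \<comment> \<open>The radius of \<open>E\<close> is read off from an explicit function that
        has \<open>E\<close> as its expansion.\<close>
      have "(\<lambda>x. - (2 * (x * deriv (eval_fps H) x) + (2 * \<rho> - 1) * eval_fps H x)) has_fps_expansion
          - (fps_const 2 * (fps_X * fps_deriv H) + fps_const (2 * \<rho> - 1) * H)"
        by (intro fps_expansion_intros expH)
      hence "fps_conv_radius E > 0"
        by (simp add: E_def euler_def has_fps_expansion_def)
      hence rG: "fps_conv_radius G > 0"
        unfolding G_def g_def by (rule fps_conv_radius_frobenius_coeff[OF rW])
      obtain s where s: "s > 0" "ereal s \<le> fps_conv_radius H" "ereal s \<le> fps_conv_radius G" "s \<le> R"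
      proof -
        have "ereal 0 < min (min (fps_conv_radius H) (fps_conv_radius G)) (ereal R)"
          using rH rG R by (simp add: zero_ereal_def)
        then obtain s where "ereal 0 < ereal s" "ereal s < min (min (fps_conv_radius H) (fps_conv_radius G)) (ereal R)"
          using ereal_dense2 by blast
        thus ?thesis using that[of s] by (simp add: less_imp_le)
      qed
      have hol: "eval_fps G holomorphic_on ball 0 s" "eval_fps H holomorphic_on ball 0 s"
      proof -
        have "ereal (norm x) < fps_conv_radius G \<and> ereal (norm x) < fps_conv_radius H"
          if "norm x < s" for x :: complex
          using s(2,3) that by (meson ereal_less_eq(3) less_ereal.simps(1) less_le_trans)
        thus "eval_fps G holomorphic_on ball 0 s" "eval_fps H holomorphic_on ball 0 s"
          by (auto intro!: holomorphic_intros simp: in_eball_iff)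
      qed
      have exp: "eval_fps G has_fps_expansion G" "eval_fps H has_fps_expansion H"
        using rG rH by (auto intro: eval_fps_has_fps_expansion)
      have "solution_on q (slit_disc z0 s) (log_form z0 \<rho> (eval_fps G) (eval_fps H))"
        by (subst log_form_solution_iff[OF s(1) hol _ _ exp U(2)])
           (use U q s HE GE in \<open>auto simp: E_def intro: holomorphic_on_subset\<close>)
      moreover have "has_log_term z0 s (log_form z0 \<rho> (eval_fps G) (eval_fps H))"
        unfolding has_log_term_def
      proof (rule exI[of _ \<rho>], intro exI conjI ballI)
        show "(\<lambda>z. eval_fps G (z - z0)) holomorphic_on ball z0 s"
          by (rule holomorphic_on_compose_gen[OF _ hol(1), unfolded o_def])
             (auto intro!: holomorphic_intros simp: dist_norm norm_minus_commute)
        show "(\<lambda>z. eval_fps H (z - z0)) holomorphic_on ball z0 s"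
          by (rule holomorphic_on_compose_gen[OF _ hol(2), unfolded o_def])
             (auto intro!: holomorphic_intros simp: dist_norm norm_minus_commute)
        show "\<exists>z\<in>ball z0 s. eval_fps H (z - z0) \<noteq> 0"
        proof (rule ccontr)
          assume *: "\<not> (\<exists>z\<in>ball z0 s. eval_fps H (z - z0) \<noteq> 0)"
          have "eval_fps H x = 0" if "x \<in> ball 0 s" for x
            using * that by (auto simp: dist_norm dest!: bspec[of _ _ "z0 + x"])
          hence "eval_fps H has_fps_expansion 0"
            using s by (auto simp: has_fps_expansion_0_iff eventually_nhds intro!: exI[of _ "ball 0 s"])
          hence "H = 0" using exp fps_expansion_unique_complex by blast
          hence "H $ 2 = 0" by simp
          thus False using nz h2 by (simp add: H_def)
        qed
      qed (simp add: log_form_def)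
      ultimately show False using lf s unfolding log_free_at_def by blast
    qed
  qed
qed

section \<open>Weierstrass functions\<close>

text \<open>Why 3/2: for \<omega> = a + b \<tau> the quantity |\<omega>|^(-3) is at most a multiple
  of ((1 + |a|) (1 + |b|))^(-3/2), and the sum over the lattice is then dominated by a product of
  two convergent one-dimensional sums.\<close>

lemma summable_on_int_powr:
  "(\<lambda>a::int. (1 + real_of_int \<bar>a\<bar>) powr (- 3 / 2)) summable_on UNIV"
proof -
  have s: "summable (\<lambda>n. (1 + real n) powr (- 3 / 2))"
    using summable_Suc_iff[of "\<lambda>n. real n powr (- 3 / 2)"] summable_real_powr_iff[of "- 3 / 2"]
    by (simp add: add.commute)
  hence s': "(\<lambda>n. (1 + real n) powr (- 3 / 2)) summable_on UNIV"
    by (intro norm_summable_imp_summable_on) simp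
  have "(\<lambda>a::int. (1 + real_of_int \<bar>a\<bar>) powr (- 3 / 2)) summable_on (range int)"
    by (subst summable_on_reindex) (use s' in \<open>auto simp: o_def\<close>)
  moreover have "(\<lambda>a::int. (1 + real_of_int \<bar>a\<bar>) powr (- 3 / 2)) summable_on (range (\<lambda>n. - int n))"
    by (subst summable_on_reindex) (use s' in \<open>auto simp: o_def inj_on_def\<close>)
  moreover have "UNIV = range int \<union> range (\<lambda>n. - int n)"
    by (auto simp: image_iff) (metis int_cases2)
  ultimately show ?thesis by (metis summable_on_union)
qed

lemma summable_on_int_prod_powr:
  "(\<lambda>(a::int, b::int). ((1 + real_of_int \<bar>a\<bar>) * (1 + real_of_int \<bar>b\<bar>)) powr (- 3 / 2)) summable_on UNIV"
proof -
  let ?f = "\<lambda>a::int. (1 + real_of_int \<bar>a\<bar>) powr (- 3 / 2)"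
  have "(\<lambda>z. ?f (fst z) * ?f (snd z)) summable_on (UNIV \<times> UNIV)"
  proof (rule summable_on_SigmaI)
    show "((\<lambda>y. ?f (fst (x, y)) * ?f (snd (x, y))) has_sum ?f x * infsum ?f UNIV) UNIV" for x
      using has_sum_cmult_right[OF has_sum_infsum[OF summable_on_int_powr], of "?f x"] by simp
    show "(\<lambda>x. ?f x * infsum ?f UNIV) summable_on UNIV"
      by (rule summable_on_cmult_left[OF summable_on_int_powr])
  qed auto
  thus ?thesis by (simp add: powr_mult case_prod_unfold)
qed

section \<open>The period lattice\<close>

locale weierstrass =
  fixes \<tau> :: complex
  assumes Im_pos: "Im \<tau> > 0"
begin

abbreviation \<Lambda> :: "complex set" where "\<Lambda> \<equiv> period_lattice \<tau>"
abbreviation \<Lambda>' :: "complex set" where "\<Lambda>' \<equiv> \<Lambda> - {0}"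
abbreviation wp :: "complex \<Rightarrow> complex" where "wp \<equiv> weierstrass_p \<tau>"
abbreviation \<zeta> :: "complex \<Rightarrow> complex" where "\<zeta> \<equiv> weierstrass_zeta \<tau>"

lemma lattice_0 [simp]: "0 \<in> \<Lambda>"
  unfolding period_lattice_def by (auto intro!: exI[of _ 0])

lemma lattice_1 [simp]: "1 \<in> \<Lambda>"
proof -
  have "1 = of_int 1 + of_int 0 * \<tau>" by simp
  thus ?thesis unfolding period_lattice_def by blast
qed

lemma lattice_\<tau> [simp]: "\<tau> \<in> \<Lambda>"
proof -
  have "\<tau> = of_int 0 + of_int 1 * \<tau>" by simp
  thus ?thesis unfolding period_lattice_def by blast
qed

lemma lattice_add: "x \<in> \<Lambda> \<Longrightarrow> y \<in> \<Lambda> \<Longrightarrow> x + y \<in> \<Lambda>"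
  unfolding period_lattice_def
proof safe
  fix a b c d :: int
  show "\<exists>e f. of_int a + of_int b * \<tau> + (of_int c + of_int d * \<tau>) = of_int e + of_int f * \<tau> \<and> True"
    by (intro exI[of _ "a + c"] exI[of _ "b + d"]) (simp add: algebra_simps)
qed

lemma lattice_minus: "x \<in> \<Lambda> \<Longrightarrow> - x \<in> \<Lambda>"
  unfolding period_lattice_def
proof safe
  fix a b :: int
  show "\<exists>e f. - (of_int a + of_int b * \<tau>) = of_int e + of_int f * \<tau> \<and> True"
    by (intro exI[of _ "- a"] exI[of _ "- b"]) (simp add: algebra_simps)
qed

lemma lattice_diff: "x \<in> \<Lambda> \<Longrightarrow> y \<in> \<Lambda> \<Longrightarrow> x - y \<in> \<Lambda>"
  using lattice_add[of x "- y"] lattice_minus[of y] by simp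

lemma lattice_minus_iff [simp]: "- x \<in> \<Lambda> \<longleftrightarrow> x \<in> \<Lambda>"
  using lattice_minus[of x] lattice_minus[of "- x"] by auto

lemma lattice_add_iff: "w \<in> \<Lambda> \<Longrightarrow> z + w \<in> \<Lambda> \<longleftrightarrow> z \<in> \<Lambda>"
  using lattice_add[of z w] lattice_diff[of "z + w" w] by auto

lemma half_periods_not_in_lattice: "1 / 2 \<notin> \<Lambda>" "\<tau> / 2 \<notin> \<Lambda>"
proof -
  have *: "real_of_int (2 * a) \<noteq> 1" for a :: int
  proof
    assume "real_of_int (2 * a) = 1"
    hence "2 * a = 1" by (metis of_int_eq_1_iff)
    thus False by presburger
  qed
  have **: "real_of_int b * Im \<tau> = Im \<tau> / 2 \<Longrightarrow> False" for b
    using *[of b] Im_pos by (auto simp: field_simps)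
  show "1 / 2 \<notin> \<Lambda>"
  proof
    assume "1 / 2 \<in> \<Lambda>"
    then obtain a b :: int where ab: "1 / 2 = of_int a + of_int b * \<tau>"
      by (auto simp: period_lattice_def)
    from arg_cong[OF ab, of Im] have "b = 0" using Im_pos by simp
    with arg_cong[OF ab, of Re] have "real_of_int (2 * a) = 1" by simp
    thus False using * by blast
  qed
  show "\<tau> / 2 \<notin> \<Lambda>"
  proof
    assume "\<tau> / 2 \<in> \<Lambda>"
    then obtain a b :: int where ab: "\<tau> / 2 = of_int a + of_int b * \<tau>"
      by (auto simp: period_lattice_def)
    from arg_cong[OF ab, of Im] have "real_of_int b * Im \<tau> = Im \<tau> / 2" by simp
    thus False using ** by blast
  qed
qed

lemma inj_lattice: "inj (\<lambda>(a, b). of_int a + of_int b * \<tau>)"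
proof (rule injI, clarify)
  fix a b c d :: int
  assume eq: "of_int a + of_int b * \<tau> = of_int c + of_int d * \<tau>"
  from arg_cong[OF eq, of Im] have "b = d" using Im_pos by simp
  with eq show "a = c \<and> b = d" by simp
qed

lemma lattice_eq_image: "\<Lambda> = range (\<lambda>(a, b). of_int a + of_int b * \<tau>)"
  by (auto simp: period_lattice_def)

lemma lattice_coefficient_bound:
  obtains C where "C > 0" "\<And>a b. real_of_int \<bar>a\<bar> \<le> C * norm (of_int a + of_int b * \<tau>)"
    "\<And>a b. real_of_int \<bar>b\<bar> \<le> C * norm (of_int a + of_int b * \<tau>)"
    "\<And>a b :: int. (a, b) \<noteq> (0, 0) \<Longrightarrow> 1 \<le> C * norm (of_int a + of_int b * \<tau>)"
proof -
  define C where "C = max (1 / Im \<tau>) (1 + norm \<tau> / Im \<tau>)"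
  have C: "C > 0" unfolding C_def using Im_pos by (intro less_max_iff_disj[THEN iffD2]) auto
  have bnd: "real_of_int \<bar>a\<bar> \<le> C * norm (of_int a + of_int b * \<tau>)"
       "real_of_int \<bar>b\<bar> \<le> C * norm (of_int a + of_int b * \<tau>)" for a b :: int
  proof -
    let ?w = "of_int a + of_int b * \<tau> :: complex"
    have "\<bar>Im ?w\<bar> \<le> norm ?w" by (rule abs_Im_le_cmod)
    hence "real_of_int \<bar>b\<bar> * Im \<tau> \<le> norm ?w" using Im_pos by (simp add: abs_mult)
    hence b: "real_of_int \<bar>b\<bar> \<le> norm ?w / Im \<tau>" using Im_pos by (simp add: field_simps)
    also have "\<dots> = 1 / Im \<tau> * norm ?w" by simp
    also have "\<dots> \<le> C * norm ?w" by (intro mult_right_mono) (auto simp: C_def)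
    finally show "real_of_int \<bar>b\<bar> \<le> C * norm ?w" .
    have "real_of_int \<bar>a\<bar> = norm (?w - of_int b * \<tau>)" by simp
    also have "\<dots> \<le> norm ?w + norm (of_int b * \<tau>)" by (rule norm_triangle_ineq4)
    also have "\<dots> = norm ?w + real_of_int \<bar>b\<bar> * norm \<tau>" by (simp add: norm_mult)
    also have "\<dots> \<le> norm ?w + norm ?w / Im \<tau> * norm \<tau>"
      by (intro add_left_mono mult_right_mono b) auto
    also have "\<dots> = (1 + norm \<tau> / Im \<tau>) * norm ?w" by (simp add: field_simps)
    also have "\<dots> \<le> C * norm ?w" by (intro mult_right_mono) (auto simp: C_def)
    finally show "real_of_int \<bar>a\<bar> \<le> C * norm ?w" .
  qed
  have "1 \<le> C * norm (of_int a + of_int b * \<tau>)" if "(a, b) \<noteq> (0, 0)" for a b :: int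
  proof -
    have "\<bar>a\<bar> \<ge> 1 \<or> \<bar>b\<bar> \<ge> 1" using that by auto
    hence "real_of_int \<bar>a\<bar> \<ge> 1 \<or> real_of_int \<bar>b\<bar> \<ge> 1" by linarith
    thus ?thesis using bnd(1)[of a b] bnd(2)[of b a] by linarith
  qed
  thus ?thesis using that C bnd by blast
qed

lemma lattice_gap:
  obtains \<delta> where "\<delta> > 0" "\<And>\<omega>. \<omega> \<in> \<Lambda>' \<Longrightarrow> \<delta> \<le> norm \<omega>"
proof -
  obtain C where C: "C > 0" "\<And>a b :: int. (a, b) \<noteq> (0, 0) \<Longrightarrow> 1 \<le> C * norm (of_int a + of_int b * \<tau>)"
    by (metis lattice_coefficient_bound)
  show ?thesis
  proof (rule that[of "1 / C"])
    fix \<omega> assume "\<omega> \<in> \<Lambda>'"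
    then obtain a b :: int where ab: "\<omega> = of_int a + of_int b * \<tau>"
      by (auto simp: period_lattice_def)
    moreover have "(a, b) \<noteq> (0, 0)" using ab \<open>\<omega> \<in> \<Lambda>'\<close> by auto
    ultimately have "\<omega> = of_int a + of_int b * \<tau>" "(a, b) \<noteq> (0, 0)" by blast+
    thus "1 / C \<le> norm \<omega>" using C(1) C(2)[of a b] by (simp add: field_simps)
  qed (use C in auto)
qed

text \<open>The lattice is uniformly discrete. All subsets are covered because the lattice is used
  whole, without 0, and without a given point.\<close>

lemma closed_subset_lattice:
  assumes "S \<subseteq> \<Lambda>" shows "closed S"
proof -
  obtain \<delta> where \<delta>: "\<delta> > 0" "\<And>\<omega>. \<omega> \<in> \<Lambda>' \<Longrightarrow> \<delta> \<le> norm \<omega>"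
    using lattice_gap by blast
  have "y = x" if "x \<in> S" "y \<in> S" "dist y x < \<delta>" for x y
    using \<delta>(2)[of "y - x"] that assms lattice_diff[of y x] by (force simp: dist_norm)
  thus ?thesis using \<delta>(1) by (intro discrete_imp_closed[of \<delta>]) auto
qed

lemma eventually_not_in_lattice: "eventually (\<lambda>z. z \<notin> \<Lambda>) (at z0)"
proof -
  have "open (- (\<Lambda> - {z0}))" by (rule open_Compl) (rule closed_subset_lattice; blast)
  hence "eventually (\<lambda>z. z \<in> - (\<Lambda> - {z0})) (nhds z0)" by (auto simp: eventually_nhds)
  thus ?thesis by (auto simp: eventually_at_filter elim: eventually_mono)
qed

lemma countable_lattice: "countable \<Lambda>"
  unfolding lattice_eq_image by (intro countable_image) auto

lemma connected_compl_lattice: "connected (- \<Lambda>)"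
proof -
  have "connected (UNIV - \<Lambda>)"
    by (rule connected_open_diff_countable) (use countable_lattice in auto)
  thus ?thesis by (simp add: Compl_eq_Diff_UNIV)
qed

lemma summable_on_lattice: "(\<lambda>\<omega>. 1 / norm \<omega> ^ 3) summable_on \<Lambda>'"
proof -
  obtain C where C: "C > 0" and bnd: "\<And>a b. real_of_int \<bar>a\<bar> \<le> C * norm (of_int a + of_int b * \<tau>)"
    "\<And>a b. real_of_int \<bar>b\<bar> \<le> C * norm (of_int a + of_int b * \<tau>)"
    and bnd1: "\<And>a b :: int. (a, b) \<noteq> (0, 0) \<Longrightarrow> 1 \<le> C * norm (of_int a + of_int b * \<tau>)"
    using lattice_coefficient_bound by blast
  \<comment> \<open>Both 1 and |a| are at most C |\<omega>|, so 1 + |a| is at most 2 C |\<omega>|,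
    and likewise 1 + |b|. The power 3/2 of the product is then at most K |\<omega>|^3.\<close>
  define K where "K = ((2 * C) * (2 * C)) powr (3 / 2)"
  let ?S = "UNIV - {(0, 0)} :: (int \<times> int) set"
  have sum: "(\<lambda>(a, b). K * ((1 + real_of_int \<bar>a\<bar>) * (1 + real_of_int \<bar>b\<bar>)) powr (- 3 / 2)) summable_on ?S"
    using summable_on_cmult_right[OF summable_on_subset_banach[OF summable_on_int_prod_powr, of ?S], of K]
    by (simp add: case_prod_unfold)
  have key: "1 / norm (of_int a + of_int b * \<tau>) ^ 3 \<le>
      K * ((1 + real_of_int \<bar>a\<bar>) * (1 + real_of_int \<bar>b\<bar>)) powr (- 3 / 2)"
    if ab: "(a, b) \<noteq> (0, 0)" for a b :: int
  proof -
    let ?w = "of_int a + of_int b * \<tau> :: complex"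
    have one: "1 \<le> C * norm ?w" using bnd1[OF ab] .
    have w: "norm ?w > 0"
    proof (rule ccontr)
      assume "\<not> norm ?w > 0"
      hence "norm ?w = 0" by simp
      thus False using one by simp
    qed
    let ?P = "(1 + real_of_int \<bar>a\<bar>) * (1 + real_of_int \<bar>b\<bar>)"
    have P: "?P > 0" by (intro mult_pos_pos) auto
    have "?P \<le> (2 * C * norm ?w) * (2 * C * norm ?w)"
      using one bnd(1)[of a b] bnd(2)[of b a] by (intro mult_mono) auto
    hence "?P powr (3 / 2) \<le> ((2 * C * norm ?w) * (2 * C * norm ?w)) powr (3 / 2)"
      using P by (intro powr_mono2) auto
    also have "(2 * C * norm ?w) * (2 * C * norm ?w) = ((2 * C) * (2 * C)) * (norm ?w * norm ?w)" by simp
    also have "\<dots> powr (3 / 2) = K * (norm ?w * norm ?w) powr (3 / 2)"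
      using C by (subst powr_mult) (auto simp: K_def)
    also have "norm ?w * norm ?w = norm ?w powr 2"
      using w by (simp add: powr_numeral power2_eq_square)
    also have "(norm ?w powr 2) powr (3 / 2) = norm ?w ^ 3"
      using w by (subst powr_powr) (simp add: powr_numeral)
    finally have "?P powr (3 / 2) \<le> K * norm ?w ^ 3" .
    thus ?thesis
      using w P by (simp add: powr_minus field_simps)
  qed
  have "(\<lambda>(a, b). 1 / norm (of_int a + of_int b * \<tau>) ^ 3) summable_on ?S"
    by (rule summable_on_comparison_test[OF sum]) (use key in auto)
  moreover have "(\<lambda>(a, b). of_int a + of_int b * \<tau>) ` ?S = \<Lambda>'"
  proof -
    have "(\<lambda>(a, b). of_int a + of_int b * \<tau>) ` ?S =
      (\<lambda>(a, b). of_int a + of_int b * \<tau>) ` UNIV - (\<lambda>(a, b). of_int a + of_int b * \<tau>) ` {(0, 0)}"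
      by (rule image_set_diff[OF inj_lattice])
    thus ?thesis by (simp add: lattice_eq_image)
  qed
  ultimately show ?thesis
    using summable_on_reindex[of "\<lambda>(a, b). of_int a + of_int b * \<tau>" ?S "\<lambda>\<omega>. 1 / norm \<omega> ^ 3"]
      inj_on_subset[OF inj_lattice, of ?S] by (simp add: o_def case_prod_unfold)
qed

section \<open>The series of \<zeta> and its derivatives\<close>

definition zeta_term :: "complex \<Rightarrow> complex \<Rightarrow> complex" where
  "zeta_term \<omega> z = 1 / (z - \<omega>) + 1 / \<omega> + z / \<omega>\<^sup>2"

text \<open>This is \<zeta> with its pole at 0 removed. It is holomorphic at 0 and carries all local
  expansions there, where the values of \<zeta> and \<wp> themselves are meaningless.\<close>

definition zeta_reg :: "complex \<Rightarrow> complex" where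
  "zeta_reg z = (\<Sum>\<^sub>\<infinity>\<omega>\<in>\<Lambda>'. zeta_term \<omega> z)"

lemma zeta_eq: "\<zeta> z = 1 / z + zeta_reg z"
  by (simp add: weierstrass_zeta_def zeta_reg_def zeta_term_def)

lemma zeta_term_deriv: "z \<noteq> \<omega> \<Longrightarrow> (zeta_term \<omega> has_field_derivative (1 / \<omega>\<^sup>2 - 1 / (z - \<omega>)\<^sup>2)) (at z)"
  unfolding zeta_term_def [abs_def]
  by (cases "\<omega> = 0") (auto intro!: derivative_eq_intros simp: power2_eq_square)

lemma zeta_term_deriv2:
  assumes "z \<noteq> \<omega>"
  shows "((\<lambda>z. 1 / \<omega>\<^sup>2 - 1 / (z - \<omega>)\<^sup>2) has_field_derivative 2 / (z - \<omega>) ^ 3) (at z)"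
  by (rule derivative_eq_intros refl | use assms in \<open>simp; fail\<close>)+
     (use assms in \<open>simp add: divide_simps power2_eq_square power3_eq_cube\<close>)

lemma open_compl_lattice': "open (- \<Lambda>')"
  by (rule open_Compl) (rule closed_subset_lattice; blast)

lemma open_compl_lattice: "open (- \<Lambda>)"
  by (rule open_Compl) (rule closed_subset_lattice; blast)

text \<open>The term equals z^2 / (\<omega>^2 (z - \<omega>)). Once |z - \<omega>| is bounded below
  by a multiple of |\<omega>|, it is of order |\<omega>|^(-3) and the Weierstrass M-test
  applies.\<close>

lemma zeta_term_uniform_limit:
  assumes "z0 \<notin> \<Lambda>'"
  shows "\<exists>\<epsilon>>0. ball z0 \<epsilon> \<subseteq> - \<Lambda>' \<and>
     uniform_limit (ball z0 \<epsilon>) (\<lambda>X z. \<Sum>\<omega>\<in>X. zeta_term \<omega> z) zeta_reg (finite_subsets_at_top \<Lambda>')"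
proof -
  obtain e where e: "e > 0" "ball z0 e \<subseteq> - \<Lambda>'"
    using open_compl_lattice' assms by (meson ComplI open_contains_ball)
  define \<epsilon> where "\<epsilon> = e / 2"
  define R where "R = norm z0 + \<epsilon>"
  \<comment> \<open>The value 1/2 serves the lattice points with |\<omega>| at least 2 R; the other
    value serves the remaining ones, from which z keeps the distance \<epsilon>.\<close>
  define c where "c = min (1 / 2) (\<epsilon> / (2 * R))"
  have pos: "\<epsilon> > 0" "R > 0" "c > 0"
    using e by (auto simp: \<epsilon>_def R_def c_def add_nonneg_pos)
  have low: "c * norm \<omega> \<le> norm (z - \<omega>)" if "\<omega> \<in> \<Lambda>'" "z \<in> ball z0 \<epsilon>" for \<omega> z
  proof (cases "norm \<omega> \<ge> 2 * R")
    case True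
    have "norm z \<le> R" using that norm_triangle_ineq2[of z z0]
      by (simp add: R_def dist_norm norm_minus_commute)
    moreover have "norm \<omega> - norm z \<le> norm (z - \<omega>)"
      by (metis norm_minus_commute norm_triangle_ineq2)
    moreover have "c * norm \<omega> \<le> 1 / 2 * norm \<omega>" by (intro mult_right_mono) (auto simp: c_def)
    ultimately show ?thesis using True by linarith
  next
    case False
    have "dist z0 \<omega> \<ge> e" using e that by force
    moreover have "dist z0 z < \<epsilon>" using that by simp
    moreover have "dist z0 \<omega> \<le> dist z0 z + dist z \<omega>" by (rule dist_triangle)
    ultimately have "norm (z - \<omega>) \<ge> \<epsilon>" by (simp add: \<epsilon>_def dist_norm)
    moreover have "c * norm \<omega> \<le> (\<epsilon> / (2 * R)) * (2 * R)"
      using False pos by (intro mult_mono) (auto simp: c_def)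
    ultimately show ?thesis using pos by simp
  qed
  have "uniform_limit (ball z0 \<epsilon>) (\<lambda>X z. \<Sum>\<omega>\<in>X. zeta_term \<omega> z)
      (\<lambda>z. \<Sum>\<^sub>\<infinity>\<omega>\<in>\<Lambda>'. zeta_term \<omega> z) (finite_subsets_at_top \<Lambda>')"
  proof (rule Weierstrass_m_test_general)
    show "(\<lambda>\<omega>. R\<^sup>2 / c * (1 / norm \<omega> ^ 3)) summable_on \<Lambda>'"
      by (rule summable_on_cmult_right[OF summable_on_lattice])
    fix \<omega> z assume \<omega>: "\<omega> \<in> \<Lambda>'" and z: "z \<in> ball z0 \<epsilon>"
    have nz: "\<omega> \<noteq> 0" using \<omega> by auto
    have lo: "c * norm \<omega> \<le> norm (z - \<omega>)" using low \<omega> z by blast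
    moreover have "c * norm \<omega> > 0" using pos nz by simp
    ultimately have nz': "z - \<omega> \<noteq> 0" by auto
    have "zeta_term \<omega> z = z\<^sup>2 / (\<omega>\<^sup>2 * (z - \<omega>))"
      using nz nz' by (simp add: zeta_term_def divide_simps) (simp add: algebra_simps power2_eq_square power3_eq_cube)
    hence "norm (zeta_term \<omega> z) = norm z ^ 2 / (norm \<omega> ^ 2 * norm (z - \<omega>))"
      by (simp add: norm_divide norm_mult norm_power)
    also have "\<dots> \<le> R ^ 2 / (norm \<omega> ^ 2 * (c * norm \<omega>))"
    proof (rule frac_le)
      show "norm z ^ 2 \<le> R ^ 2" using z norm_triangle_ineq2[of z z0]
        by (intro power_mono) (auto simp: R_def dist_norm norm_minus_commute)
      show "norm \<omega> ^ 2 * (c * norm \<omega>) \<le> norm \<omega> ^ 2 * norm (z - \<omega>)"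
        by (intro mult_left_mono lo) auto
    qed (use pos nz in auto)
    also have "\<dots> = R\<^sup>2 / c * (1 / norm \<omega> ^ 3)" by (simp add: power2_eq_square power3_eq_cube)
    finally show "norm (zeta_term \<omega> z) \<le> R\<^sup>2 / c * (1 / norm \<omega> ^ 3)" .
  qed
  moreover have "ball z0 \<epsilon> \<subseteq> - \<Lambda>'" using e by (force simp: \<epsilon>_def)
  ultimately show ?thesis using pos by (auto simp: zeta_reg_def[abs_def])
qed

text \<open>Derivatives of locally uniform limits of holomorphic functions converge as well, so the
  one estimate for \<zeta> also yields the series for \<wp> and \<wp>'.\<close>

lemma
  assumes z: "z \<notin> \<Lambda>'"
  shows zeta_reg_analytic: "zeta_reg analytic_on {z}"
    and deriv_zeta_reg: "((\<lambda>\<omega>. 1 / \<omega>\<^sup>2 - 1 / (z - \<omega>)\<^sup>2) has_sum deriv zeta_reg z) \<Lambda>'"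
    and deriv2_zeta_reg: "((\<lambda>\<omega>. 2 / (z - \<omega>) ^ 3) has_sum deriv (deriv zeta_reg) z) \<Lambda>'"
proof -
  define F where "F = finite_subsets_at_top \<Lambda>'"
  define S where "S = (\<lambda>X z. \<Sum>\<omega>\<in>X. zeta_term \<omega> z)"
  obtain \<epsilon> where \<epsilon>: "\<epsilon> > 0" "ball z \<epsilon> \<subseteq> - \<Lambda>'" "uniform_limit (ball z \<epsilon>) S zeta_reg F"
    using zeta_term_uniform_limit[OF z] unfolding F_def S_def by blast
  have F: "F \<noteq> bot" by (simp add: F_def)
  have ev: "eventually (\<lambda>X. finite X \<and> X \<subseteq> \<Lambda>') F"
    unfolding F_def by (rule eventually_finite_subsets_at_top_weakI) auto
  have d1: "(S X has_field_derivative (\<Sum>\<omega>\<in>X. 1 / \<omega>\<^sup>2 - 1 / (w - \<omega>)\<^sup>2)) (at w)"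
    if "X \<subseteq> \<Lambda>'" "w \<in> ball z \<epsilon>" for X w
    unfolding S_def using that \<epsilon>(2) by (intro DERIV_sum zeta_term_deriv) auto
  have d2: "((\<lambda>w. \<Sum>\<omega>\<in>X. 1 / \<omega>\<^sup>2 - 1 / (w - \<omega>)\<^sup>2) has_field_derivative (\<Sum>\<omega>\<in>X. 2 / (w - \<omega>) ^ 3)) (at w)"
    if "X \<subseteq> \<Lambda>'" "w \<in> ball z \<epsilon>" for X w
    using that \<epsilon>(2) by (intro DERIV_sum zeta_term_deriv2) auto
  have hol: "S X holomorphic_on ball z \<epsilon>" if "X \<subseteq> \<Lambda>'" for X
    unfolding holomorphic_on_open[OF open_ball] using d1[OF that] by blast
  have ulim: "eventually (\<lambda>X. S X holomorphic_on ball z \<epsilon>) F"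
    using ev by eventually_elim (use hol in auto)
  have lim: "((\<lambda>X. (deriv ^^ m) (S X) z) \<longlongrightarrow> (deriv ^^ m) zeta_reg z) F" for m
    by (rule higher_deriv_complex_uniform_limit[OF \<epsilon>(3) ulim F]) (use \<epsilon>(1) in auto)
  have "eventually (\<lambda>X. continuous_on (cball z (\<epsilon>/2)) (S X) \<and> S X holomorphic_on ball z (\<epsilon>/2)) F"
    using ev
  proof eventually_elim
    case (elim X)
    have "cball z (\<epsilon>/2) \<subseteq> ball z \<epsilon>" "ball z (\<epsilon>/2) \<subseteq> ball z \<epsilon>" using \<epsilon>(1) by auto
    thus ?case using hol[of X] elim
      by (meson holomorphic_on_imp_continuous_on holomorphic_on_subset)
  qed
  moreover have "uniform_limit (cball z (\<epsilon>/2)) S zeta_reg F"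
    by (rule uniform_limit_on_subset[OF \<epsilon>(3)]) (use \<epsilon>(1) in auto)
  ultimately have "zeta_reg holomorphic_on ball z (\<epsilon>/2)"
    using holomorphic_uniform_limit F by blast
  thus "zeta_reg analytic_on {z}"
    using \<epsilon>(1) by (intro holomorphic_on_imp_analytic_at[of _ "ball z (\<epsilon>/2)"]) auto
  have e1: "deriv (S X) w = (\<Sum>\<omega>\<in>X. 1 / \<omega>\<^sup>2 - 1 / (w - \<omega>)\<^sup>2)" if "X \<subseteq> \<Lambda>'" "w \<in> ball z \<epsilon>" for X w
    using d1[OF that] by (rule DERIV_imp_deriv)
  have e2: "deriv (deriv (S X)) z = (\<Sum>\<omega>\<in>X. 2 / (z - \<omega>) ^ 3)" if "X \<subseteq> \<Lambda>'" for X
  proof -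
    have "eventually (\<lambda>w. w \<in> ball z \<epsilon>) (nhds z)" using \<epsilon>(1) by (intro eventually_nhds_in_open) auto
    hence "eventually (\<lambda>w. deriv (S X) w = (\<Sum>\<omega>\<in>X. 1 / \<omega>\<^sup>2 - 1 / (w - \<omega>)\<^sup>2)) (nhds z)"
      by eventually_elim (use e1 that in auto)
    hence "deriv (deriv (S X)) z = deriv (\<lambda>w. \<Sum>\<omega>\<in>X. 1 / \<omega>\<^sup>2 - 1 / (w - \<omega>)\<^sup>2) z"
      by (rule deriv_cong_ev) simp
    thus ?thesis using DERIV_imp_deriv[OF d2[OF that]] \<epsilon>(1) by simp
  qed
  have ev1: "eventually (\<lambda>X. deriv (S X) z = (\<Sum>\<omega>\<in>X. 1 / \<omega>\<^sup>2 - 1 / (z - \<omega>)\<^sup>2)) F"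
    using ev by eventually_elim (use e1 \<epsilon>(1) in auto)
  show "((\<lambda>\<omega>. 1 / \<omega>\<^sup>2 - 1 / (z - \<omega>)\<^sup>2) has_sum deriv zeta_reg z) \<Lambda>'"
    using lim[of 1] tendsto_cong[OF ev1] by (simp add: has_sum_def F_def)
  have ev2: "eventually (\<lambda>X. deriv (deriv (S X)) z = (\<Sum>\<omega>\<in>X. 2 / (z - \<omega>) ^ 3)) F"
    using ev by eventually_elim (use e2 in auto)
  show "((\<lambda>\<omega>. 2 / (z - \<omega>) ^ 3) has_sum deriv (deriv zeta_reg) z) \<Lambda>'"
    using lim[of 2] tendsto_cong[OF ev2] by (simp add: has_sum_def F_def numeral_2_eq_2)
qed

lemma zeta_reg_holomorphic: "zeta_reg holomorphic_on - \<Lambda>'"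
  by (meson ComplD analytic_imp_holomorphic analytic_on_analytic_at zeta_reg_analytic)

lemma wp_eq: "z \<notin> \<Lambda>' \<Longrightarrow> wp z = 1 / z\<^sup>2 - deriv zeta_reg z"
proof -
  assume z: "z \<notin> \<Lambda>'"
  have "((\<lambda>\<omega>. - (1 / \<omega>\<^sup>2 - 1 / (z - \<omega>)\<^sup>2)) has_sum - deriv zeta_reg z) \<Lambda>'"
    using deriv_zeta_reg[OF z] by (simp only: has_sum_uminus minus_minus)
  hence "(\<Sum>\<^sub>\<infinity>\<omega>\<in>\<Lambda>'. 1 / (z - \<omega>)\<^sup>2 - 1 / \<omega>\<^sup>2) = - deriv zeta_reg z"
    by (intro infsumI) simp
  thus ?thesis by (simp add: weierstrass_p_def)
qed

lemma zeta_reg_odd: "zeta_reg (- z) = - zeta_reg z"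
proof -
  have "zeta_reg (- z) = (\<Sum>\<^sub>\<infinity>\<omega>\<in>\<Lambda>'. - zeta_term \<omega> z)"
    unfolding zeta_reg_def
    by (rule infsum_reindex_bij_witness[of _ uminus uminus])
       (auto simp: zeta_term_def divide_simps, auto simp: algebra_simps add_eq_0_iff)
  thus ?thesis by (simp add: zeta_reg_def infsum_uminus)
qed

lemma zeta_odd: "\<zeta> (- z) = - \<zeta> z"
  by (simp add: zeta_eq zeta_reg_odd)

lemma wp_even: "wp (- z) = wp z"
proof -
  have "(\<Sum>\<^sub>\<infinity>\<omega>\<in>\<Lambda>'. 1 / (- z - \<omega>)\<^sup>2 - 1 / \<omega>\<^sup>2) = (\<Sum>\<^sub>\<infinity>\<omega>\<in>\<Lambda>'. 1 / (z - \<omega>)\<^sup>2 - 1 / \<omega>\<^sup>2)"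
    by (rule infsum_reindex_bij_witness[of _ uminus uminus])
       (auto simp: power2_eq_square algebra_simps)
  thus ?thesis by (simp add: weierstrass_p_def)
qed

lemma zeta_deriv: "z \<notin> \<Lambda> \<Longrightarrow> (\<zeta> has_field_derivative - wp z) (at z)"
proof -
  assume z: "z \<notin> \<Lambda>"
  hence nz: "z \<noteq> 0" by auto
  have "(zeta_reg has_field_derivative deriv zeta_reg z) (at z)"
    using z zeta_reg_holomorphic open_compl_lattice' by (intro holomorphic_derivI[of _ "- \<Lambda>'"]) auto
  hence "((\<lambda>z. 1 / z + zeta_reg z) has_field_derivative (- (1 / z\<^sup>2) + deriv zeta_reg z)) (at z)"
    using nz by (auto intro!: derivative_eq_intros simp: power2_eq_square)
  moreover have "- (1 / z\<^sup>2) + deriv zeta_reg z = - wp z" using z by (subst wp_eq) auto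
  moreover have "\<zeta> = (\<lambda>z. 1 / z + zeta_reg z)" using zeta_eq by blast
  ultimately show ?thesis by simp
qed

lemma wp_deriv: "z \<notin> \<Lambda> \<Longrightarrow> (wp has_field_derivative (- 2 / z ^ 3 - deriv (deriv zeta_reg) z)) (at z)"
proof -
  assume z: "z \<notin> \<Lambda>"
  hence nz: "z \<noteq> 0" by auto
  have "deriv zeta_reg holomorphic_on - \<Lambda>'"
    using zeta_reg_holomorphic open_compl_lattice' by (rule holomorphic_deriv)
  hence "(deriv zeta_reg has_field_derivative deriv (deriv zeta_reg) z) (at z)"
    using z open_compl_lattice' by (intro holomorphic_derivI[of _ "- \<Lambda>'"]) auto
  hence "((\<lambda>z. 1 / z\<^sup>2 - deriv zeta_reg z) has_field_derivative (- 2 / z ^ 3 - deriv (deriv zeta_reg) z)) (at z)"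
    using nz by (auto intro!: derivative_eq_intros simp: power2_eq_square power3_eq_cube field_simps)
  moreover have "eventually (\<lambda>z. wp z = 1 / z\<^sup>2 - deriv zeta_reg z) (nhds z)"
    using eventually_nhds_in_open[OF open_compl_lattice, of z] z
    by (auto elim!: eventually_mono intro: wp_eq)
  ultimately show ?thesis by (subst DERIV_cong_ev[OF refl _ refl])
qed

lemma wp_holomorphic: "wp holomorphic_on - \<Lambda>"
  using wp_deriv open_compl_lattice by (auto simp: holomorphic_on_open)

lemma zeta_holomorphic: "\<zeta> holomorphic_on - \<Lambda>"
  using zeta_deriv open_compl_lattice by (auto simp: holomorphic_on_open)

section \<open>Periodicity and Liouville's principle\<close>

lemma deriv_wp_has_sum: 
  assumes "z \<notin> \<Lambda>"
  shows "((\<lambda>\<omega>. - 2 / (z - \<omega>) ^ 3) has_sum deriv wp z) \<Lambda>"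
proof -
  have "((\<lambda>\<omega>. - (2 / (z - \<omega>) ^ 3)) has_sum - deriv (deriv zeta_reg) z) \<Lambda>'"
    using deriv2_zeta_reg[of z] assms by (simp only: has_sum_uminus minus_minus) auto
  hence "((\<lambda>\<omega>. - (2 / (z - \<omega>) ^ 3)) has_sum (- (2 / (z - 0) ^ 3) + - deriv (deriv zeta_reg) z)) (insert 0 \<Lambda>')"
    by (intro has_sum_insert) auto
  moreover have "insert 0 \<Lambda>' = \<Lambda>" by auto
  ultimately show ?thesis using DERIV_imp_deriv[OF wp_deriv[OF assms]] by simp
qed

text \<open>The series of \<wp>' has no correction terms and runs over the whole lattice, so a
  translation merely permutes it. The behaviour of \<wp> and then of \<zeta> follows by
  integration.\<close>

lemma deriv_wp_periodic:
  assumes "z \<notin> \<Lambda>" "w \<in> \<Lambda>"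
  shows "deriv wp (z + w) = deriv wp z"
proof -
  have "((\<lambda>\<omega>. - 2 / (z + w - \<omega>) ^ 3) has_sum deriv wp (z + w)) \<Lambda>"
    using assms by (intro deriv_wp_has_sum) (auto simp: lattice_add_iff)
  moreover have "((\<lambda>\<omega>. - 2 / (z + w - \<omega>) ^ 3) has_sum deriv wp (z + w)) \<Lambda> \<longleftrightarrow>
     ((\<lambda>\<omega>. - 2 / (z - \<omega>) ^ 3) has_sum deriv wp (z + w)) \<Lambda>"
    by (rule has_sum_reindex_bij_witness[of _ "\<lambda>x. x + w" "\<lambda>x. x - w"])
       (use assms in \<open>auto simp: lattice_add lattice_diff algebra_simps\<close>)
  ultimately show ?thesis using deriv_wp_has_sum[OF assms(1)] infsumI by metis
qed

lemma constant_off_lattice: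
  assumes "\<And>z. z \<notin> \<Lambda> \<Longrightarrow> (f has_field_derivative 0) (at z)"
  shows "\<exists>c. \<forall>z. z \<notin> \<Lambda> \<longrightarrow> f z = c"
proof -
  have "continuous_on (- \<Lambda>) f"
    using assms by (intro continuous_at_imp_continuous_on ballI DERIV_isCont) auto
  then obtain c where "\<And>z. z \<in> - \<Lambda> \<Longrightarrow> f z = c"
    using DERIV_zero_connected_constant[OF connected_compl_lattice open_compl_lattice, of "{}" f] assms
    by auto
  thus ?thesis by auto
qed

lemma periodic_if:
  assumes D: "\<And>z w. z \<in> D \<Longrightarrow> w \<in> \<Lambda> \<Longrightarrow> z + w \<in> D"
    and "\<And>z. z \<in> D \<Longrightarrow> f (z + 1) = f z" "\<And>z. z \<in> D \<Longrightarrow> f (z + \<tau>) = f z"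
    and z: "z \<in> D" and w: "w \<in> \<Lambda>"
  shows "f (z + w) = f z"
proof -
  have lat: "of_int a \<in> \<Lambda>" "of_int b * \<tau> \<in> \<Lambda>" for a b
    unfolding period_lattice_def by (intro CollectI exI[of _ a] exI[of _ 0], simp,
      intro CollectI exI[of _ 0] exI[of _ b], simp)
  have 1: "f (z + of_int a) = f z" if "z \<in> D" for a z
  proof (induction a rule: int_induct[of _ 0])
    case (step1 i)
    thus ?case using assms(2)[of "z + of_int i"] D[OF that lat(1)[of i]] by (simp add: algebra_simps)
  next
    case (step2 i)
    thus ?case using assms(2)[of "z + of_int (i - 1)"] D[OF that lat(1)[of "i - 1"]] by (simp add: algebra_simps)
  qed simp
  have 2: "f (z + of_int a * \<tau>) = f z" if "z \<in> D" for a z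
  proof (induction a rule: int_induct[of _ 0])
    case (step1 i)
    thus ?case using assms(3)[of "z + of_int i * \<tau>"] D[OF that lat(2)[of i]] by (simp add: algebra_simps)
  next
    case (step2 i)
    thus ?case using assms(3)[of "z + of_int (i - 1) * \<tau>"] D[OF that lat(2)[of "i - 1"]] by (simp add: algebra_simps)
  qed simp
  obtain a b where "w = of_int a + of_int b * \<tau>" using w by (auto simp: period_lattice_def)
  thus ?thesis using 1[OF z, of a] 2[OF D[OF z lat(1)[of a]], of b] by (simp add: add.assoc)
qed

text \<open>\<wp>(z + w) - \<wp>(z) is constant, and evenness makes it vanish at z = -w/2. This
  needs w/2 outside the lattice, which holds for 1 and \<tau>; \<open>periodic_if\<close> passes
  from these generators to all periods.\<close>

lemma wp_periodic:
  assumes "z \<notin> \<Lambda>" "w \<in> \<Lambda>"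
  shows "wp (z + w) = wp z"
proof -
  have *: "wp (z + w) = wp z" if w: "w \<in> \<Lambda>" "w / 2 \<notin> \<Lambda>" and z: "z \<in> - \<Lambda>" for w z
  proof -
    have "((\<lambda>z. wp (z + w) - wp z) has_field_derivative 0) (at z)" if z: "z \<notin> \<Lambda>" for z
    proof -
      have d: "(wp has_field_derivative deriv wp z) (at z)" if "z \<notin> \<Lambda>" for z
        using wp_deriv[OF that] DERIV_imp_deriv by fastforce
      have "((\<lambda>z. wp (z + w)) has_field_derivative deriv wp (z + w)) (at z)"
        using d[of "z + w"] z w by (simp add: DERIV_shift lattice_add_iff)
      hence "((\<lambda>z. wp (z + w) - wp z) has_field_derivative (deriv wp (z + w) - deriv wp z)) (at z)"
        by (intro DERIV_diff d z)
      thus ?thesis using deriv_wp_periodic[OF z w(1)] by simp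
    qed
    then obtain c where c: "\<And>z. z \<notin> \<Lambda> \<Longrightarrow> wp (z + w) - wp z = c"
      using constant_off_lattice[of "\<lambda>z. wp (z + w) - wp z"] by blast
    have "- w / 2 \<notin> \<Lambda>" using w(2) lattice_minus_iff[of "w / 2"] by simp
    from c[OF this] have "c = 0" using wp_even[of "w / 2"] by (simp add: field_simps)
    thus ?thesis using c[of z] z by simp
  qed
  show ?thesis
    by (rule periodic_if[of "- \<Lambda>" wp z w])
       (use assms half_periods_not_in_lattice in \<open>auto intro: * simp: lattice_add_iff\<close>)
qed

lemma zeta_quasiperiodic:
  assumes "w \<in> \<Lambda>"
  obtains \<eta> where "\<And>z. z \<notin> \<Lambda> \<Longrightarrow> \<zeta> (z + w) = \<zeta> z + \<eta>"
proof -
  have "((\<lambda>z. \<zeta> (z + w) - \<zeta> z) has_field_derivative 0) (at z)" if z: "z \<notin> \<Lambda>" for z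
  proof -
    have "((\<lambda>z. \<zeta> (z + w)) has_field_derivative - wp (z + w)) (at z)"
      using zeta_deriv[of "z + w"] z assms by (simp add: DERIV_shift lattice_add_iff)
    hence "((\<lambda>z. \<zeta> (z + w) - \<zeta> z) has_field_derivative (- wp (z + w) - - wp z)) (at z)"
      by (intro DERIV_diff zeta_deriv z)
    thus ?thesis using wp_periodic[OF z assms] by simp
  qed
  then obtain c where "\<And>z. z \<notin> \<Lambda> \<Longrightarrow> \<zeta> (z + w) - \<zeta> z = c"
    using constant_off_lattice[of "\<lambda>z. \<zeta> (z + w) - \<zeta> z"] by blast
  thus ?thesis using that[of c] by (metis add.commute diff_add_cancel)
qed

text \<open>The function becomes entire once its singularities are removed, and bounded through a
  fundamental parallelogram. Asking for a limit at only one translate of each singular point reduces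
  the applications to finitely many local expansions.\<close>

lemma elliptic_bounded_constant:
  assumes S: "\<And>z w. z \<notin> S \<Longrightarrow> w \<in> \<Lambda> \<Longrightarrow> z + w \<notin> S"
    and hol: "h holomorphic_on - S" "open (- S)"
    and sing: "\<And>z0. eventually (\<lambda>z. z \<notin> S) (at z0)"
    and per: "\<And>z w. z \<notin> S \<Longrightarrow> w \<in> \<Lambda> \<Longrightarrow> h (z + w) = h z"
    and lim: "\<And>z0. z0 \<in> S \<Longrightarrow> \<exists>c w. w \<in> \<Lambda> \<and> (h \<longlongrightarrow> c) (at (z0 + w))"
  shows "\<exists>c. \<forall>z. z \<notin> S \<longrightarrow> h z = c"
proof -
  define g where "g = remove_sings h"
  have an: "h analytic_on {z}" if "z \<notin> S" for z
    using hol that by (auto simp: analytic_at)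
  have lim': "\<exists>c. (h \<longlongrightarrow> c) (at z0)" for z0
  proof (cases "z0 \<in> S")
    case False
    thus ?thesis using an[of z0] analytic_at_imp_isCont isContD by blast
  next
    case True
    then obtain c w where w: "w \<in> \<Lambda>" "(h \<longlongrightarrow> c) (at (z0 + w))" using lim by blast
    have "((\<lambda>z. h (z + w)) \<longlongrightarrow> c) (at z0)"
      using LIM_offset[OF w(2), of w] by simp
    moreover have "eventually (\<lambda>z. h (z + w) = h z) (at z0)"
      using sing[of z0] by eventually_elim (use per w in auto)
    ultimately have "(h \<longlongrightarrow> c) (at z0)" by (rule Lim_transform_eventually)
    thus ?thesis by blast
  qed
  have iso: "isolated_singularity_at h z0" for z0
  proof -
    obtain r where r: "r > 0" "\<And>z. z \<noteq> z0 \<Longrightarrow> dist z z0 < r \<Longrightarrow> z \<notin> S"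
      using sing[of z0] by (auto simp: eventually_at)
    hence "h analytic_on ball z0 r - {z0}"
      using an analytic_on_analytic_at by (metis DiffD1 DiffD2 dist_commute insertI1 mem_ball)
    thus ?thesis using r(1) by (auto simp: isolated_singularity_at_def)
  qed
  have "g analytic_on {z}" for z
    unfolding g_def using remove_sings_analytic_at iso lim' by blast
  hence g: "g holomorphic_on UNIV"
    by (meson analytic_imp_holomorphic analytic_on_analytic_at)
  have gh: "g z = h z" if "z \<notin> S" for z
    using an[OF that] by (simp add: g_def)
  define K where "K = (\<lambda>(x, y). complex_of_real x + complex_of_real y * \<tau>) ` ({0..1} \<times> {0..1})"
  have "compact K"
    unfolding K_def by (intro compact_continuous_image compact_Times continuous_intros)
       (auto simp: case_prod_unfold intro!: continuous_intros)
  hence "bounded (g ` K)"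
    using g by (intro compact_imp_bounded compact_continuous_image)
      (auto intro: holomorphic_on_imp_continuous_on holomorphic_on_subset)
  then obtain B where B: "\<And>z. z \<in> K \<Longrightarrow> norm (g z) \<le> B" by (auto simp: bounded_iff)
  have bS: "norm (g z) \<le> B" if "z \<notin> S" for z
  proof -
    define y where "y = Im z / Im \<tau>"
    define x where "x = Re z - y * Re \<tau>"
    have z: "z = of_real x + of_real y * \<tau>"
      using Im_pos by (auto simp: complex_eq_iff x_def y_def)
    define w where "w = - (of_int \<lfloor>x\<rfloor> + of_int \<lfloor>y\<rfloor> * \<tau>)"
    have w: "w \<in> \<Lambda>" unfolding w_def lattice_minus_iff by (auto simp: period_lattice_def)
    have "z + w = of_real (frac x) + of_real (frac y) * \<tau>"
      by (simp add: z w_def frac_def algebra_simps)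
    hence "z + w \<in> K"
      by (auto simp: K_def intro!: image_eqI[of _ _ "(frac x, frac y)"] simp: less_imp_le[OF frac_lt_1])
    hence "norm (g (z + w)) \<le> B" by (rule B)
    thus ?thesis using gh[OF that] gh[OF S[OF that w]] per[OF that w] by simp
  qed
  \<comment> \<open>Periodicity of \<open>h\<close> is available off \<open>S\<close> only; by
    continuity the bound extends to the singular points.\<close>
  have "norm (g z0) \<le> B" for z0
  proof -
    have "(g \<longlongrightarrow> g z0) (at z0)"
      using holomorphic_on_imp_continuous_on[OF g] by (simp add: continuous_on_def)
    hence "((\<lambda>z. norm (g z)) \<longlongrightarrow> norm (g z0)) (at z0)" by (rule tendsto_norm)
    moreover have "eventually (\<lambda>z. norm (g z) \<le> B) (at z0)"
      using sing[of z0] by eventually_elim (rule bS)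
    ultimately show ?thesis using tendsto_upperbound trivial_limit_at by blast
  qed
  hence "bounded (range g)" by (auto simp: bounded_iff)
  hence "g constant_on UNIV" using Liouville_theorem[OF g] by simp
  thus ?thesis using gh by (metis UNIV_I constant_on_def)
qed

end

section \<open>Two elliptic function identities\<close>

lemma tendsto_eventually_eq:
  "(f \<longlongrightarrow> l) F \<Longrightarrow> eventually (\<lambda>x. g x = f x) F \<Longrightarrow> (g \<longlongrightarrow> l) F"
  by (rule Lim_transform_eventually) (auto elim: eventually_mono)

lemma tendsto_div_square:
  fixes u :: "complex \<Rightarrow> complex"
  assumes "u analytic_on {0}" "u 0 = 0" "(u has_field_derivative 0) (at 0)"
  shows "\<exists>c. ((\<lambda>x. u x / x\<^sup>2) \<longlongrightarrow> c) (at 0)"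
proof -
  define U where "U = fps_expansion u 0"
  have U: "u has_fps_expansion U"
    unfolding U_def by (rule analytic_at_imp_has_fps_expansion_0[OF assms(1)])
  have nth: "U $ 0 = 0" "U $ 1 = 0"
    using fps_nth_fps_expansion[OF U, of 0] fps_nth_fps_expansion[OF U, of 1] assms(2) DERIV_imp_deriv[OF assms(3)]
    by simp_all
  show ?thesis
  proof (cases "U = 0")
    case True
    hence "eventually (\<lambda>x. u x = 0) (at 0)"
      using U by (auto simp: has_fps_expansion_0_iff eventually_at_filter elim: eventually_mono)
    hence "eventually (\<lambda>x. 0 = u x / x\<^sup>2) (at 0)" by eventually_elim simp
    hence "((\<lambda>x. u x / x\<^sup>2) \<longlongrightarrow> 0) (at 0)"
      by (rule Lim_transform_eventually[OF tendsto_const])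
    thus ?thesis by blast
  next
    case False
    define v where "v = (\<lambda>x. if x = 0 then U $ 2 else u x / x ^ 2)"
    have "2 \<le> subdegree U"
      using nth False by (metis less_2_cases_iff nth_subdegree_nonzero not_less One_nat_def)
    hence "v has_fps_expansion fps_shift 2 U"
      unfolding v_def by (rule has_fps_expansion_shift[OF U]) simp
    hence "isCont v 0"
      using has_fps_expansion_imp_continuous by blast
    hence "(v \<longlongrightarrow> v 0) (at 0)" by (simp add: isCont_def)
    moreover have "eventually (\<lambda>x. v x = u x / x\<^sup>2) (at 0)"
      by (auto simp: eventually_at_filter v_def)
    ultimately have "((\<lambda>x. u x / x\<^sup>2) \<longlongrightarrow> v 0) (at 0)" by (rule Lim_transform_eventually)
    thus ?thesis by blast
  qed
qed

locale weierstrass_point = weierstrass +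
  fixes p :: complex
  assumes p: "2 * p \<notin> \<Lambda>"
begin

definition S :: "complex set" where "S = {z. z \<in> \<Lambda> \<or> z + p \<in> \<Lambda> \<or> z - p \<in> \<Lambda>}"
text \<open>This turns out to be the logarithmic derivative of \<wp> - \<wp>(p), see
  \<open>addition_log_derivative\<close>: residue 1 at the zeros p and -p, residue -2 at the double
  pole 0.\<close>

definition F :: "complex \<Rightarrow> complex" where "F z = \<zeta> (z + p) + \<zeta> (z - p) - 2 * \<zeta> z"
text \<open>The constant term of \<open>F\<close> at p, see \<open>F_near_p\<close> and
  \<open>phi_0\<close>.\<close>

definition c :: complex where "c = \<zeta> (2 * p) - 2 * \<zeta> p"

lemma p_notin [simp]: "p \<notin> \<Lambda>"
  using p lattice_add[of p p] by (metis mult_2)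

lemma near_0: "eventually (\<lambda>x. x \<notin> \<Lambda>' \<and> x + p \<notin> \<Lambda> \<and> x - p \<notin> \<Lambda> \<and> x + 2 * p \<notin> \<Lambda>) (nhds 0)"
proof -
  have *: "eventually (\<lambda>x. x + a \<notin> \<Lambda>) (nhds 0)" if "a \<notin> \<Lambda>" for a
  proof -
    have "open ((\<lambda>x. x + a) -` (- \<Lambda>))"
      by (intro open_vimage open_compl_lattice continuous_intros)
    hence "eventually (\<lambda>x. x \<in> (\<lambda>x. x + a) -` (- \<Lambda>)) (nhds 0)"
      using that by (intro eventually_nhds_in_open) auto
    thus ?thesis by simp
  qed
  have "eventually (\<lambda>x. x \<in> - \<Lambda>') (nhds 0)"
    by (rule eventually_nhds_in_open[OF open_compl_lattice']) simp
  moreover have "eventually (\<lambda>x. x + p \<notin> \<Lambda>) (nhds 0)" "eventually (\<lambda>x. x - p \<notin> \<Lambda>) (nhds 0)"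
      "eventually (\<lambda>x. x + 2 * p \<notin> \<Lambda>) (nhds 0)"
    using *[of p] *[of "- p"] *[of "2 * p"] p by simp_all
  ultimately show ?thesis by eventually_elim auto
qed

lemma near_0_at:
  "eventually (\<lambda>x. x \<noteq> 0 \<and> x \<notin> \<Lambda> \<and> x + p \<notin> \<Lambda> \<and> x - p \<notin> \<Lambda> \<and> x + 2 * p \<notin> \<Lambda>) (at 0)"
  using near_0 unfolding eventually_at_filter by eventually_elim auto

lemma open_compl_S: "open (- S)"
proof -
  have "- S = - \<Lambda> \<inter> (\<lambda>z. z + p) -` (- \<Lambda>) \<inter> (\<lambda>z. z - p) -` (- \<Lambda>)"
    by (auto simp: S_def)
  moreover have "open \<dots>"
    by (intro open_Int open_vimage open_compl_lattice continuous_intros)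
  ultimately show ?thesis by simp
qed

lemma eventually_notin_S: "eventually (\<lambda>z. z \<notin> S) (at z0)"
proof -
  have "eventually (\<lambda>z. z + a \<notin> \<Lambda>) (at z0)" for a
  proof -
    have "eventually (\<lambda>z. z \<notin> \<Lambda>) (filtermap (\<lambda>z. z + a) (at z0))"
      using eventually_not_in_lattice[of "z0 + a"] filtermap_at_shift[of "- a" z0] by simp
    thus ?thesis by (simp add: eventually_filtermap)
  qed
  from this[of 0] this[of p] this[of "- p"] show ?thesis
    by eventually_elim (auto simp: S_def)
qed

lemma minus_mem_S_iff [simp]: "- z \<in> S \<longleftrightarrow> z \<in> S"
  using lattice_minus_iff[of "z + p"] lattice_minus_iff[of "z - p"] by (auto simp: S_def)

lemma add_mem_S_iff: "w \<in> \<Lambda> \<Longrightarrow> z + w \<in> S \<longleftrightarrow> z \<in> S"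
  using lattice_add_iff[of w z] lattice_add_iff[of w "z + p"] lattice_add_iff[of w "z - p"]
  by (auto simp: S_def algebra_simps)

text \<open>The symmetry carries the limit at p over to -p, so expansions at 0 and p suffice. In the
  applications \<sigma> is 1 or -1.\<close>

lemma elliptic_even_odd_constant:
  assumes hol: "h holomorphic_on - S"
    and per: "\<And>z w. z \<notin> S \<Longrightarrow> w \<in> \<Lambda> \<Longrightarrow> h (z + w) = h z"
    and sym: "\<And>z. h (- z) = \<sigma> * h z"
    and lim: "(h \<longlongrightarrow> l0) (at 0)" "(h \<longlongrightarrow> lp) (at p)"
  shows "\<exists>C. \<forall>z. z \<notin> S \<longrightarrow> h z = C"
proof (rule elliptic_bounded_constant[of S h])
  fix z0 assume "z0 \<in> S"
  then consider "z0 \<in> \<Lambda>" | "z0 + p \<in> \<Lambda>" | "z0 - p \<in> \<Lambda>" by (auto simp: S_def)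
  thus "\<exists>l w. w \<in> \<Lambda> \<and> (h \<longlongrightarrow> l) (at (z0 + w))"
  proof cases
    case 1
    thus ?thesis using lim(1) by (intro exI[of _ l0] exI[of _ "- z0"]) auto
  next
    case 2
    have "((\<lambda>z. h (- z)) \<longlongrightarrow> \<sigma> * lp) (at p)"
      unfolding sym by (intro tendsto_intros lim)
    hence "(h \<longlongrightarrow> \<sigma> * lp) (at (- p))"
      by (simp add: filterlim_filtermap flip: filtermap_at_minus)
    thus ?thesis using lattice_minus[OF 2] by (intro exI[of _ "\<sigma> * lp"] exI[of _ "- (z0 + p)"]) auto
  next
    case 3
    thus ?thesis using lim(2) lattice_minus[OF 3]
      by (intro exI[of _ lp] exI[of _ "- (z0 - p)"]) auto
  qed
qed (use assms eventually_notin_S open_compl_S in \<open>auto simp: add_mem_S_iff\<close>)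

lemma deriv_wp: "z \<notin> \<Lambda> \<Longrightarrow> (wp has_field_derivative deriv wp z) (at z)"
  using wp_deriv DERIV_imp_deriv by fastforce

lemma deriv_wp_odd: 
  assumes "z \<notin> \<Lambda>" shows "deriv wp (- z) = - deriv wp z"
proof -
  have "((\<lambda>z. wp (- z)) has_field_derivative (deriv wp (- z) * - 1)) (at z)"
    by (rule DERIV_chain2[OF deriv_wp]) (use assms in \<open>auto intro!: derivative_eq_intros\<close>)
  hence "(wp has_field_derivative (- deriv wp (- z))) (at z)" by (simp add: wp_even)
  thus ?thesis using DERIV_imp_deriv by fastforce
qed

lemma F_odd: "F (- z) = - F z"
  using zeta_odd[of "z + p"] zeta_odd[of "z - p"] zeta_odd[of z] by (simp add: F_def)

lemma F_holomorphic: "F holomorphic_on - S"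
  unfolding F_def [abs_def]
  by (intro holomorphic_intros holomorphic_on_compose_gen[OF _ zeta_holomorphic, unfolded o_def]
        holomorphic_on_subset[OF zeta_holomorphic]) (auto simp: S_def)

lemma F_periodic:
  assumes "z \<notin> S" "w \<in> \<Lambda>" shows "F (z + w) = F z"
proof -
  obtain \<eta> where \<eta>: "\<And>z. z \<notin> \<Lambda> \<Longrightarrow> \<zeta> (z + w) = \<zeta> z + \<eta>"
    using zeta_quasiperiodic[OF assms(2)] by blast
  show ?thesis using \<eta>[of z] \<eta>[of "z + p"] \<eta>[of "z - p"] assms(1)
    by (simp add: F_def S_def algebra_simps)
qed

lemma F_deriv:
  assumes "z \<notin> S"
  shows "(F has_field_derivative (2 * wp z - wp (z + p) - wp (z - p))) (at z)"
proof -
  have *: "((\<lambda>z. \<zeta> (z + a)) has_field_derivative - wp (z + a)) (at z)" if "z + a \<notin> \<Lambda>" for a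
    using zeta_deriv[OF that] by (simp add: DERIV_shift)
  show ?thesis unfolding F_def[abs_def]
    by (rule derivative_eq_intros refl *[of p] *[of "- p", simplified] zeta_deriv | use assms in \<open>simp add: S_def; fail\<close>)+
qed

lemma zeta_reg_0 [simp]: "zeta_reg 0 = 0"
  using zeta_reg_odd[of 0] by simp

lemma zeta_reg_deriv: "z \<notin> \<Lambda>' \<Longrightarrow> (zeta_reg has_field_derivative deriv zeta_reg z) (at z)"
  using zeta_reg_holomorphic open_compl_lattice' by (intro holomorphic_derivI[of _ "- \<Lambda>'"]) auto

lemma zeta_shift_analytic: "a \<notin> \<Lambda> \<Longrightarrow> (\<lambda>x. \<zeta> (x + a)) analytic_on {0}"
  and wp_shift_analytic: "a \<notin> \<Lambda> \<Longrightarrow> (\<lambda>x. wp (x + a)) analytic_on {0}"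
proof -
  have *: "(\<lambda>x. g (x + a)) analytic_on {0}" if "g holomorphic_on - \<Lambda>" "a \<notin> \<Lambda>" for g :: "complex \<Rightarrow> complex"
  proof -
    have "g analytic_on {a}"
      using that open_compl_lattice by (auto simp: analytic_at)
    thus ?thesis
      by (intro analytic_on_compose[of "\<lambda>x. x + a" "{0}" g, unfolded o_def]) (auto intro!: analytic_intros)
  qed
  show "a \<notin> \<Lambda> \<Longrightarrow> (\<lambda>x. \<zeta> (x + a)) analytic_on {0}" "a \<notin> \<Lambda> \<Longrightarrow> (\<lambda>x. wp (x + a)) analytic_on {0}"
    using * zeta_holomorphic wp_holomorphic by blast+
qed

lemma zeta_reg_analytic_0: "zeta_reg analytic_on {0}"
  by (rule zeta_reg_analytic) simp

lemma deriv_zeta_reg_analytic_0: "deriv zeta_reg analytic_on {0}"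
  using zeta_reg_analytic_0 by (rule analytic_deriv)

text \<open>The regular part of \<open>F\<close> at \<open>p\<close>.\<close>

definition \<phi> :: "complex \<Rightarrow> complex" where "\<phi> x = \<zeta> (x + 2 * p) + zeta_reg x - 2 * \<zeta> (x + p)"

lemma phi_0: "\<phi> 0 = c"
  by (simp add: \<phi>_def c_def)

lemma phi_analytic: "\<phi> analytic_on {0}"
  unfolding \<phi>_def[abs_def] using p
  by (intro analytic_intros zeta_shift_analytic zeta_reg_analytic_0) auto

lemma phi_deriv: "(\<phi> has_field_derivative (2 * wp p - wp (2 * p) + deriv zeta_reg 0)) (at 0)"
proof -
  have *: "((\<lambda>z. \<zeta> (z + a)) has_field_derivative - wp a) (at 0)" if "a \<notin> \<Lambda>" for a
    using zeta_deriv[OF that] by (simp add: DERIV_shift[of _ _ 0 a, simplified])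
  show ?thesis unfolding \<phi>_def[abs_def]
    by (rule derivative_eq_intros refl * zeta_reg_deriv | use p in \<open>simp; fail\<close>)+
qed

lemma F_near_p: "F (x + p) = 1 / x + \<phi> x"
  by (simp add: F_def \<phi>_def zeta_eq[of x] algebra_simps)

lemma F_near_0: "F x = - 2 / x + (\<zeta> (x + p) + \<zeta> (x - p) - 2 * zeta_reg x)"
  by (simp add: F_def zeta_eq[of x])

lemma deriv_wp_near_0: "x \<notin> \<Lambda> \<Longrightarrow> deriv wp x = - 2 / x ^ 3 - deriv (deriv zeta_reg) x"
  using wp_deriv by (rule DERIV_imp_deriv)

lemma analytic_tendsto: "f analytic_on {0} \<Longrightarrow> (f \<longlongrightarrow> f 0) (at (0::complex))"
  using analytic_at_imp_isCont isContD by blast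

text \<open>The difference of the two sides is elliptic and its poles at 0, p and -p cancel, so it
  is constant; being odd, it is 0.\<close>

lemma addition_log_derivative:
  assumes "z \<notin> S"
  shows "F z * (wp z - wp p) = deriv wp z"
proof -
  \<comment> \<open>The value 0 on \<open>S\<close> makes \<open>h\<close> odd at every point, as
    \<open>elliptic_even_odd_constant\<close> demands; \<open>deriv wp\<close> is known to be odd
    only off the lattice.\<close>
  define h where "h = (\<lambda>z. if z \<in> S then 0 else F z * (wp z - wp p) - deriv wp z)"
  have hol: "h holomorphic_on - S"
  proof -
    have "(\<lambda>z. F z * (wp z - wp p) - deriv wp z) holomorphic_on - S"
      by (intro holomorphic_intros F_holomorphic holomorphic_on_subset[OF wp_holomorphic]
          holomorphic_on_subset[OF holomorphic_deriv[OF wp_holomorphic open_compl_lattice]])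
         (auto simp: S_def)
    thus ?thesis by (rule holomorphic_transform) (auto simp: h_def)
  qed
  have odd: "h (- z) = - 1 * h z" for z
  proof (cases "z \<in> S")
    case False
    hence "z \<notin> \<Lambda>" by (simp add: S_def)
    thus ?thesis using False by (simp add: h_def F_odd wp_even deriv_wp_odd)
  qed (simp add: h_def)
  have per: "h (z + w) = h z" if "z \<notin> S" "w \<in> \<Lambda>" for z w
  proof -
    have "z \<notin> \<Lambda>" using that by (simp add: S_def)
    thus ?thesis using that by (simp add: h_def F_periodic wp_periodic deriv_wp_periodic add_mem_S_iff)
  qed
  have ev: "eventually (\<lambda>x. x \<notin> S) (at 0)" by (rule eventually_notin_S)
  define a where "a = (\<lambda>x. \<zeta> (x + p) + \<zeta> (x - p))"
  have a_an: "a analytic_on {0}"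
    unfolding a_def using zeta_shift_analytic[of p] zeta_shift_analytic[of "- p"] by (auto intro!: analytic_intros)
  \<comment> \<open>When the terms of order x^(-3) have cancelled, \<open>u x / x\<^sup>2\<close> is
    all of \<open>h\<close> that could still be singular at 0. It has a limit because u vanishes to
    second order.\<close>
  define u where "u = (\<lambda>x. a x - 2 * zeta_reg x + 2 * x * deriv zeta_reg x + 2 * x * wp p)"
  have "\<exists>l. ((\<lambda>x. u x / x\<^sup>2) \<longlongrightarrow> l) (at 0)"
  proof (rule tendsto_div_square)
    show "u analytic_on {0}"
      unfolding u_def by (intro analytic_intros a_an zeta_reg_analytic_0 deriv_zeta_reg_analytic_0)
    show "u 0 = 0" using zeta_odd[of p] by (simp add: u_def a_def)
    have 1: "(a has_field_derivative - wp p - wp p) (at 0)"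
    proof -
      have *: "((\<lambda>z. \<zeta> (z + b)) has_field_derivative - wp b) (at 0)" if "b \<notin> \<Lambda>" for b
        using zeta_deriv[OF that] by (simp add: DERIV_shift[of _ _ 0 b, simplified])
      show ?thesis unfolding a_def
        using DERIV_add[OF *[of p] *[of "- p"]] by (simp add: wp_even)
    qed
    have 2: "(zeta_reg has_field_derivative deriv zeta_reg 0) (at 0)" by (rule zeta_reg_deriv) simp
    have 3: "(deriv zeta_reg has_field_derivative deriv (deriv zeta_reg) 0) (at 0)"
      using deriv_zeta_reg_analytic_0 analytic_on_imp_differentiable_at
        DERIV_deriv_iff_field_differentiable by blast
    show "(u has_field_derivative 0) (at 0)"
      unfolding u_def by (rule derivative_eq_intros refl 1 2 3)+ simp
  qed
  then obtain l where l: "((\<lambda>x. u x / x\<^sup>2) \<longlongrightarrow> l) (at 0)" by blast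
  have "((\<lambda>x. u x / x\<^sup>2 - (a x - 2 * zeta_reg x) * (deriv zeta_reg x + wp p) + deriv (deriv zeta_reg) x) \<longlongrightarrow>
     l - (a 0 - 2 * zeta_reg 0) * (deriv zeta_reg 0 + wp p) + deriv (deriv zeta_reg) 0) (at 0)"
    by (intro tendsto_intros l analytic_tendsto a_an zeta_reg_analytic_0 deriv_zeta_reg_analytic_0 analytic_deriv)
  moreover have "eventually (\<lambda>x. h x = u x / x\<^sup>2 - (a x - 2 * zeta_reg x) * (deriv zeta_reg x + wp p) + deriv (deriv zeta_reg) x) (at 0)"
    using ev near_0_at
  proof eventually_elim
    case (elim x)
    have "h x = (- 2 / x + (a x - 2 * zeta_reg x)) * (1 / x\<^sup>2 - deriv zeta_reg x - wp p) + 2 / x ^ 3 + deriv (deriv zeta_reg) x"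
      using elim by (simp add: h_def F_near_0 a_def wp_eq deriv_wp_near_0)
    moreover have "(- 2 / x + B) * (1 / x\<^sup>2 - D - P) + 2 / x ^ 3 + E =
        (B + 2 * x * D + 2 * x * P) / x\<^sup>2 - B * (D + P) + E" for B D P E
      using elim by (simp add: field_simps power2_eq_square power3_eq_cube)
    ultimately show ?case by (simp only: u_def)
  qed
  ultimately have lim0: "(h \<longlongrightarrow> l - (a 0 - 2 * zeta_reg 0) * (deriv zeta_reg 0 + wp p) + deriv (deriv zeta_reg) 0) (at 0)"
    by (rule tendsto_eventually_eq)
  have ev': "eventually (\<lambda>x. x + p \<notin> S) (at 0)"
  proof -
    have "eventually (\<lambda>z. z \<notin> S) (filtermap (\<lambda>z. z + p) (at 0))"
      using eventually_notin_S[of p] filtermap_at_shift[of "- p" 0] by simp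
    thus ?thesis by (simp add: eventually_filtermap)
  qed
  have "((\<lambda>x. wp (x + p)) has_field_derivative deriv wp p) (at 0)"
    using deriv_wp[OF p_notin] by (simp add: DERIV_shift[of _ _ 0 p, simplified])
  hence d: "((\<lambda>x. (wp (x + p) - wp p) / x) \<longlongrightarrow> deriv wp p) (at 0)"
    by (simp add: has_field_derivative_iff)
  have dwp: "(\<lambda>x. deriv wp (x + p)) analytic_on {0}"
  proof -
    have "deriv wp analytic_on {0 + p}"
      using holomorphic_deriv[OF wp_holomorphic open_compl_lattice] open_compl_lattice by (auto simp: analytic_at)
    thus ?thesis
      by (intro analytic_on_compose[of "\<lambda>x. x + p" "{0}" "deriv wp", unfolded o_def]) (auto intro!: analytic_intros)
  qed
  have "((\<lambda>x. (wp (x + p) - wp p) / x + \<phi> x * (wp (x + p) - wp p) - deriv wp (x + p)) \<longlongrightarrow>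
     deriv wp p + \<phi> 0 * (wp (0 + p) - wp p) - deriv wp (0 + p)) (at 0)"
    by (intro tendsto_intros d analytic_tendsto phi_analytic dwp analytic_tendsto[OF wp_shift_analytic]) auto
  moreover have "eventually (\<lambda>x. h (x + p) = (wp (x + p) - wp p) / x + \<phi> x * (wp (x + p) - wp p) - deriv wp (x + p)) (at 0)"
    using ev' by eventually_elim (simp add: h_def F_near_p algebra_simps add_divide_distrib diff_divide_distrib)
  ultimately have "((\<lambda>x. h (x + p)) \<longlongrightarrow> deriv wp p + \<phi> 0 * (wp (0 + p) - wp p) - deriv wp (0 + p)) (at 0)"
    by (rule tendsto_eventually_eq)
  hence limp: "(h \<longlongrightarrow> deriv wp p + \<phi> 0 * (wp (0 + p) - wp p) - deriv wp (0 + p)) (at p)"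
    using LIM_offset[of "\<lambda>x. h (x + p)" _ 0 "- p"] by simp
  obtain C where C: "\<And>z. z \<notin> S \<Longrightarrow> h z = C"
    using elliptic_even_odd_constant[OF hol per odd lim0 limp] by blast
  have "h (- z) = C" "h z = C" using C assms by auto
  hence "C = 0" using odd[of z] by simp
  thus ?thesis using C[OF assms] assms by (simp add: h_def)
qed

text \<open>\<wp>(z + p), \<wp>(z - p) and 4 \<wp>(z) absorb the double poles of F^2, and the
  difference of \<zeta> values absorbs its residues 2c at p and -2c at -p. That difference is
  periodic because the quasi-periods cancel. What remains is a constant.\<close>

lemma F_square:
  assumes "z \<notin> S"
  shows "(F z)\<^sup>2 = wp (z + p) + wp (z - p) + 4 * wp z + 2 * c * (\<zeta> (z - p) - \<zeta> (z + p))
    + (c\<^sup>2 + 2 * c * \<zeta> (2 * p) - 3 * wp (2 * p) + 3 * deriv zeta_reg 0)"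
proof -
  define h where "h = (\<lambda>z. (F z)\<^sup>2 - (wp (z + p) + wp (z - p) + 4 * wp z + 2 * c * (\<zeta> (z - p) - \<zeta> (z + p))))"
  have hol: "h holomorphic_on - S"
    unfolding h_def
    by (intro holomorphic_intros F_holomorphic holomorphic_on_subset[OF wp_holomorphic]
        holomorphic_on_compose_gen[OF _ zeta_holomorphic, unfolded o_def]
        holomorphic_on_compose_gen[OF _ wp_holomorphic, unfolded o_def])
       (auto simp: S_def)
  have even: "h (- z) = 1 * h z" for z
  proof -
    have e: "- z + p = - (z - p)" "- z - p = - (z + p)" by simp_all
    show ?thesis unfolding h_def e F_odd wp_even zeta_odd by (simp add: algebra_simps)
  qed
  have per: "h (z + w) = h z" if "z \<notin> S" "w \<in> \<Lambda>" for z w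
  proof -
    have w: "w \<in> \<Lambda>" by (rule that(2))
    obtain \<eta> where \<eta>: "\<And>z. z \<notin> \<Lambda> \<Longrightarrow> \<zeta> (z + w) = \<zeta> z + \<eta>"
      by (rule zeta_quasiperiodic[OF w]) blast
    have e: "z + w + p = (z + p) + w" "z + w - p = (z - p) + w" by simp_all
    have S: "z \<notin> \<Lambda>" "z + p \<notin> \<Lambda>" "z - p \<notin> \<Lambda>" using that(1) by (auto simp: S_def)
    show ?thesis
      unfolding h_def e F_periodic[OF that] wp_periodic[OF S(1) w] wp_periodic[OF S(2) w]
        wp_periodic[OF S(3) w] \<eta>[OF S(2)] \<eta>[OF S(3)] by simp
  qed
  define b where "b = (\<lambda>x. \<zeta> (x + p) + \<zeta> (x - p) - 2 * zeta_reg x)"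
  have sh: "(\<lambda>x. \<zeta> (x + p)) analytic_on {0}" "(\<lambda>x. \<zeta> (x - p)) analytic_on {0}"
     "(\<lambda>x. wp (x + p)) analytic_on {0}" "(\<lambda>x. wp (x - p)) analytic_on {0}"
     "(\<lambda>x. wp (x + 2 * p)) analytic_on {0}" "(\<lambda>x. \<zeta> (x + 2 * p)) analytic_on {0}"
    using zeta_shift_analytic[of p] zeta_shift_analytic[of "- p"] wp_shift_analytic[of p] wp_shift_analytic[of "- p"]
      wp_shift_analytic[of "2 * p"] zeta_shift_analytic[of "2 * p"] p by auto
  have b_an: "b analytic_on {0}"
    unfolding b_def by (intro analytic_intros sh zeta_reg_analytic_0)
  have "b 0 = 0" using zeta_odd[of p] by (simp add: b_def)
  moreover have "(b has_field_derivative deriv b 0) (at 0)"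
    using b_an analytic_on_imp_differentiable_at DERIV_deriv_iff_field_differentiable by blast
  ultimately have db: "((\<lambda>x. b x / x) \<longlongrightarrow> deriv b 0) (at 0)"
    by (simp add: has_field_derivative_iff)
  have "((\<lambda>x. - 4 * (b x / x) + (b x)\<^sup>2 + 4 * deriv zeta_reg x - wp (x + p) - wp (x - p) - 2 * c * (\<zeta> (x - p) - \<zeta> (x + p))) \<longlongrightarrow>
     - 4 * deriv b 0 + (b 0)\<^sup>2 + 4 * deriv zeta_reg 0 - wp (0 + p) - wp (0 - p) - 2 * c * (\<zeta> (0 - p) - \<zeta> (0 + p))) (at 0)"
    (is "(_ \<longlongrightarrow> ?l0) _")
    by (intro tendsto_intros db analytic_tendsto[OF sh(1)] analytic_tendsto[OF sh(2)] analytic_tendsto[OF sh(3)]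
          analytic_tendsto[OF sh(4)] analytic_tendsto b_an deriv_zeta_reg_analytic_0)
  moreover have "eventually (\<lambda>x. h x = - 4 * (b x / x) + (b x)\<^sup>2 + 4 * deriv zeta_reg x - wp (x + p) - wp (x - p)
      - 2 * c * (\<zeta> (x - p) - \<zeta> (x + p))) (at 0)"
    using near_0_at
  proof eventually_elim
    case (elim x)
    have 1: "h x = (- 2 / x + b x)\<^sup>2 - (wp (x + p) + wp (x - p) + 4 * (1 / x\<^sup>2 - deriv zeta_reg x) + 2 * c * (\<zeta> (x - p) - \<zeta> (x + p)))"
      using elim by (simp add: h_def F_near_0 b_def wp_eq)
    have 2: "(- 2 / x + b x)\<^sup>2 = 4 * (1 / x\<^sup>2) - 4 * (b x / x) + (b x)\<^sup>2"
      using elim by (simp add: power2_eq_square field_simps)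
    from 1[unfolded 2] show ?case by (simp add: algebra_simps)
  qed
  ultimately have lim0: "(h \<longlongrightarrow> ?l0) (at 0)"
    by (rule tendsto_eventually_eq)
  have dphi: "((\<lambda>x. (\<phi> x - c) / x) \<longlongrightarrow> 2 * wp p - wp (2 * p) + deriv zeta_reg 0) (at 0)"
    using phi_deriv by (simp add: has_field_derivative_iff phi_0)
  have "((\<lambda>x. 2 * ((\<phi> x - c) / x) + (\<phi> x)\<^sup>2 + deriv zeta_reg x - wp (x + 2 * p) - 4 * wp (x + p)
       - 2 * c * (zeta_reg x - \<zeta> (x + 2 * p))) \<longlongrightarrow>
     2 * (2 * wp p - wp (2 * p) + deriv zeta_reg 0) + (\<phi> 0)\<^sup>2 + deriv zeta_reg 0 - wp (0 + 2 * p) - 4 * wp (0 + p)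
       - 2 * c * (zeta_reg 0 - \<zeta> (0 + 2 * p))) (at 0)"
    (is "(_ \<longlongrightarrow> ?lp) _")
    by (intro tendsto_intros dphi analytic_tendsto[OF sh(3)] analytic_tendsto[OF sh(5)] analytic_tendsto[OF sh(6)]
          analytic_tendsto phi_analytic zeta_reg_analytic_0 deriv_zeta_reg_analytic_0)
  moreover have "eventually (\<lambda>x. h (x + p) = 2 * ((\<phi> x - c) / x) + (\<phi> x)\<^sup>2 + deriv zeta_reg x - wp (x + 2 * p) - 4 * wp (x + p)
       - 2 * c * (zeta_reg x - \<zeta> (x + 2 * p))) (at 0)"
    using near_0_at
  proof eventually_elim
    case (elim x)
    have 1: "h (x + p) = (1 / x + \<phi> x)\<^sup>2 - (wp (x + 2 * p) + (1 / x\<^sup>2 - deriv zeta_reg x) + 4 * wp (x + p)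
        + 2 * c * (1 / x + zeta_reg x - \<zeta> (x + 2 * p)))"
    proof -
      have "x + p + p = x + 2 * p" by simp
      moreover have "\<zeta> x = 1 / x + zeta_reg x" by (rule zeta_eq)
      moreover have "wp x = 1 / x\<^sup>2 - deriv zeta_reg x" using elim by (intro wp_eq) auto
      ultimately show ?thesis by (simp only: h_def F_near_p add_diff_cancel_right')
    qed
    have 2: "(1 / x + \<phi> x)\<^sup>2 = 1 / x\<^sup>2 + 2 * ((\<phi> x - c) / x) + 2 * c * (1 / x) + (\<phi> x)\<^sup>2"
      using elim by (simp add: power2_eq_square field_simps)
    from 1[unfolded 2] show ?case by (simp add: algebra_simps)
  qed
  ultimately have "((\<lambda>x. h (x + p)) \<longlongrightarrow> ?lp) (at 0)"
    by (rule tendsto_eventually_eq)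
  hence limp: "(h \<longlongrightarrow> ?lp) (at p)"
    using LIM_offset[of "\<lambda>x. h (x + p)" _ 0 "- p"] by simp
  obtain C where C: "\<And>z. z \<notin> S \<Longrightarrow> h z = C"
    using elliptic_even_odd_constant[OF hol per even lim0 limp] by blast
  \<comment> \<open>The constant is identified as the limit at p, which the expansion there has just
    provided.\<close>
  have "eventually (\<lambda>z. h z = C) (at p)"
    using eventually_notin_S[of p] by eventually_elim (rule C)
  hence "((\<lambda>_. C) \<longlongrightarrow> ?lp) (at p)" by (rule Lim_transform_eventually[OF limp])
  hence "C = ?lp" using tendsto_const_iff[of "at p" C ?lp] trivial_limit_at by blast
  hence C_eq: "C = c\<^sup>2 + 2 * c * \<zeta> (2 * p) - 3 * wp (2 * p) + 3 * deriv zeta_reg 0"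
    by (simp add: phi_0)
  have "(F z)\<^sup>2 = wp (z + p) + wp (z - p) + 4 * wp z + 2 * c * (\<zeta> (z - p) - \<zeta> (z + p)) + C"
    using C[OF assms] by (simp add: h_def algebra_simps)
  thus ?thesis by (simp only: C_eq)
qed

lemma wp_not_constant: 
  assumes "open A" "A \<subseteq> - \<Lambda>" "A \<noteq> {}" "\<And>z. z \<in> A \<Longrightarrow> wp z = C"
  shows False
proof -
  have *: "wp z = C" if "z \<notin> \<Lambda>" for z
    by (rule analytic_continuation_open[of A "- \<Lambda>" wp "\<lambda>_. C"])
       (use assms that open_compl_lattice connected_compl_lattice wp_holomorphic in auto)
  have "((\<lambda>x. 1 - x\<^sup>2 * (deriv zeta_reg x + C)) \<longlongrightarrow> 1 - 0\<^sup>2 * (deriv zeta_reg 0 + C)) (at 0)"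
    by (intro tendsto_intros analytic_tendsto deriv_zeta_reg_analytic_0)
  moreover have "eventually (\<lambda>x. 1 - x\<^sup>2 * (deriv zeta_reg x + C) = 0) (at 0)"
    using near_0_at
  proof eventually_elim
    case (elim x)
    hence "C = 1 / x\<^sup>2 - deriv zeta_reg x" using *[of x] wp_eq[of x] by auto
    thus ?case using elim by (simp add: field_simps)
  qed
  ultimately have "((\<lambda>_::complex. 0) \<longlongrightarrow> 1 - 0\<^sup>2 * (deriv zeta_reg 0 + C)) (at 0)"
    by (rule Lim_transform_eventually)
  hence "((\<lambda>_::complex. 0) \<longlongrightarrow> (1::complex)) (at 0)" by simp
  thus False using tendsto_const_iff[of "at (0::complex)" 0 "1::complex"] by simp
qed

text \<open>Put f(x) = \<wp>(x + p) - \<wp>(p). The identity (1/x + \<phi>) f = f' becomes x \<phi>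
  f = x f' - f, a recursion for the coefficients of f. At k = 1 it reads A_2 = c A_1.\<close>

lemma c_eq: "c = deriv (deriv wp) p / (2 * deriv wp p)"
proof -
  define f where "f = (\<lambda>x. wp (x + p) - wp p)"
  have f: "f analytic_on {0}" unfolding f_def
    by (intro analytic_intros wp_shift_analytic) simp
  define A where "A = fps_expansion f 0"
  have A: "f has_fps_expansion A" unfolding A_def by (rule analytic_at_imp_has_fps_expansion_0[OF f])
  define P where "P = fps_expansion \<phi> 0"
  have P: "\<phi> has_fps_expansion P" unfolding P_def by (rule analytic_at_imp_has_fps_expansion_0[OF phi_analytic])
  have df: "deriv f x = deriv wp (x + p)" if "x + p \<notin> \<Lambda>" for x
    using DERIV_diff[OF deriv_wp[OF that, unfolded DERIV_shift] DERIV_const[of "wp p"]]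
    unfolding f_def by (intro DERIV_imp_deriv) simp
  have A0: "A $ 0 = 0" using fps_nth_fps_expansion[OF A, of 0] by (simp add: f_def)
  have A1: "A $ 1 = deriv wp p" using fps_nth_fps_expansion[OF A, of 1] df[of 0] by simp
  have A2: "A $ 2 = deriv (deriv wp) p / 2"
  proof -
    have "eventually (\<lambda>x. deriv f x = deriv wp (x + p)) (nhds 0)"
      using near_0 by eventually_elim (use df in auto)
    hence "deriv (deriv f) 0 = deriv (\<lambda>x. deriv wp (x + p)) 0" by (rule deriv_cong_ev) simp
    also have "\<dots> = deriv (deriv wp) p"
      using deriv_shift_0[of "deriv wp" p] by (simp add: o_def add.commute)
    finally show ?thesis using fps_nth_fps_expansion[OF A, of 2] by (simp add: numeral_2_eq_2)
  qed
  have "eventually (\<lambda>x. x * \<phi> x * f x - (x * deriv f x - f x) = 0) (at 0)"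
  proof -
    have "eventually (\<lambda>z. z \<notin> S) (filtermap (\<lambda>z. z + p) (at 0))"
      using eventually_notin_S[of p] filtermap_at_shift[of "- p" 0] by simp
    hence "eventually (\<lambda>x. x + p \<notin> S) (at 0)" by (simp add: eventually_filtermap)
    thus ?thesis using near_0_at
    proof eventually_elim
      case (elim x)
      have "(1 / x + \<phi> x) * f x = deriv wp (x + p)"
        using addition_log_derivative[OF elim(1)] by (simp add: F_near_p f_def)
      thus ?case using elim df[of x] by (simp add: field_simps)
    qed
  qed
  moreover have "0 * \<phi> 0 * f 0 - (0 * deriv f 0 - f 0) = 0" by (simp add: f_def)
  ultimately have "eventually (\<lambda>x. x * \<phi> x * f x - (x * deriv f x - f x) = 0) (nhds 0)"
    by (auto simp: eventually_at_filter f_def elim!: eventually_mono)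
  hence "(\<lambda>x. x * \<phi> x * f x - (x * deriv f x - f x)) has_fps_expansion 0"
    by (simp add: has_fps_expansion_0_iff)
  moreover have "(\<lambda>x. x * \<phi> x * f x - (x * deriv f x - f x)) has_fps_expansion fps_X * P * A - (fps_X * fps_deriv A - A)"
    by (intro fps_expansion_intros A P)
  ultimately have "fps_X * P * A - (fps_X * fps_deriv A - A) = 0"
    using fps_expansion_unique_complex by blast
  hence eq: "fps_X * (P * A) = fps_X * fps_deriv A - A" by (simp add: mult.assoc)
  have rec: "(of_nat k + 1 - 1) * A $ (k + 1) = (\<Sum>i=0..k. P $ i * A $ (k - i))" for k
  proof -
    have "(P * A) $ k = of_nat (k + 1) * A $ (k + 1) - A $ (k + 1)"
      using arg_cong[OF eq, of "\<lambda>F. F $ (k + 1)"] by (simp add: mult.assoc)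
    moreover have "(P * A) $ k = (\<Sum>i=0..k. P $ i * A $ (k - i))" by (rule fps_mult_nth)
    ultimately show ?thesis by (simp add: distrib_right)
  qed
  \<comment> \<open>The same recursion shows that \<wp>' has no zero at p: with A_0 = A_1 = 0 it
    would make all coefficients vanish and \<wp> constant.\<close>
  have nz: "deriv wp p \<noteq> 0"
  proof
    assume "deriv wp p = 0"
    have "A $ k = 0" for k
    proof (induction k rule: less_induct)
      case (less k)
      consider "k = 0" | "k = 1" | j where "k = j + 1" "j > 0" by (cases k) (auto simp: neq0_conv)
      thus ?case
      proof cases
        case 3
        have "(\<Sum>i=0..j. P $ i * A $ (j - i)) = 0"
          by (rule sum.neutral) (use less 3 in auto)
        thus ?thesis using rec[of j] 3 by simp
      qed (use A0 A1 \<open>deriv wp p = 0\<close> in auto)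
    qed
    hence "A = 0" by (simp add: fps_eq_iff)
    hence "eventually (\<lambda>x. f x = 0) (nhds 0)" using A by (simp add: has_fps_expansion_0_iff)
    hence "eventually (\<lambda>x. f x = 0 \<and> x + p \<notin> \<Lambda>) (nhds 0)"
      using near_0 by eventually_elim auto
    then obtain O' where O': "open O'" "0 \<in> O'" "\<And>x. x \<in> O' \<Longrightarrow> f x = 0 \<and> x + p \<notin> \<Lambda>"
      unfolding eventually_nhds by blast
    show False
    proof (rule wp_not_constant[of "(\<lambda>x. x + p) ` O'" "wp p"])
      show "open ((\<lambda>x. x + p) ` O')" using O'(1) open_translation[of O' p] by (simp add: add.commute)
    qed (use O' in \<open>auto simp: f_def\<close>)
  qed
  have "P $ 0 = c" using fps_nth_fps_expansion[OF P, of 0] by (simp add: phi_0)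
  hence "c * deriv wp p = deriv (deriv wp) p / 2"
    using rec[of 1] A0 A1 A2 by (simp add: numeral_2_eq_2)
  thus "c = deriv (deriv wp) p / (2 * deriv wp p)" using nz by (simp add: field_simps)
qed

end

section \<open>The log-free conditions\<close>

lemma fps_even:
  fixes f :: "complex \<Rightarrow> complex"
  assumes f: "f has_fps_expansion W" and even: "eventually (\<lambda>x. f (- x) = f x) (nhds 0)" and "odd k"
  shows "fps_nth W k = 0"
proof -
  have "(f \<circ> (\<lambda>x. - x)) has_fps_expansion (W oo (- fps_X))"
    by (rule has_fps_expansion_compose[OF f]) (auto intro!: fps_expansion_intros)
  moreover have "(f \<circ> (\<lambda>x. - x)) has_fps_expansion W"
    by (rule has_fps_expansion_cong[THEN iffD2, OF _ refl f]) (use even in \<open>simp add: o_def\<close>)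
  ultimately have "W oo (- fps_X) = W" using fps_expansion_unique_complex by blast
  hence "fps_nth (W oo (- fps_X)) k = fps_nth W k" by simp
  thus ?thesis using \<open>odd k\<close> by (simp add: fps_compose_uminus')
qed

lemma analytic_radius:
  assumes "U analytic_on {0 :: complex}" "eventually P (at 0)"
  obtains R where "R > 0" "U holomorphic_on ball 0 R" "\<And>x. x \<in> ball 0 R - {0} \<Longrightarrow> P x"
proof -
  obtain r where r: "r > 0" "U holomorphic_on ball 0 r"
    using assms(1) by (auto simp: analytic_on_def)
  obtain s where s: "s > 0" "\<And>x. x \<noteq> 0 \<Longrightarrow> dist x 0 < s \<Longrightarrow> P x"
    using assms(2) by (auto simp: eventually_at)
  show ?thesis
  proof (rule that[of "min r s"])
    show "U holomorphic_on ball 0 (min r s)"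
      by (rule holomorphic_on_subset[OF r(2)]) auto
  qed (use r s in \<open>auto simp: dist_commute\<close>)
qed

text \<open>The equation solved for its highest term, with constants that are polynomials in
  \<open>fps_const a\<close>. This is the shape in which \<open>darboux_frobenius\<close>
  calculates.\<close>

lemma frobenius_op_minus_iff:
  "frobenius_op U (- a) G = 0 \<longleftrightarrow>
     euler (euler G) = (2 * fps_const a + 1) * euler G - fps_const a * (fps_const a + 1) * G + U * G"
proof -
  have 1: "fps_const (2 * (- a) - 1) = - (2 * fps_const a + 1)"
    by (simp add: numeral_fps_const flip: fps_const_1_eq_1)
  have 2: "fps_const (- a * (- a - 1)) = fps_const a * (fps_const a + 1)"
    by (simp add: algebra_simps flip: fps_const_1_eq_1)
  show ?thesis unfolding frobenius_op_def 1 2 by (simp add: algebra_simps)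
qed

text \<open>The Darboux transform in terms of \<open>K = z\<^sup>2 f\<close>, \<open>\<Phi> = z f' / f\<close>, \<open>\<kappa> = z\<^bsup>-1\<^esup> f\<^bsup>-1/2\<^esup>\<close>, \<open>\<nu> = n\<close> and
  \<open>\<sigma> = s / 2\<close>. The factor \<open>4\<close> avoids fractions.\<close>

lemma darboux_frobenius:
  fixes K \<Phi> G \<kappa> \<nu> \<sigma> :: "complex fps"
  assumes const: "euler \<nu> = 0" "euler \<sigma> = 0"
    and \<kappa>: "\<kappa> * \<kappa> * K = 1"
    and K: "euler K = K * (\<Phi> + 2)"
    and G: "euler (euler G) = (2 * \<nu> + 1) * euler G - \<nu> * (\<nu> + 1) * G
               + (\<nu> * (\<nu> + 1) * K + \<sigma> * \<sigma> * (fps_X * fps_X)) * G"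
    and U: "4 * U = 4 * \<nu> * (\<nu> + 1) * K + 4 * \<sigma> * \<sigma> * (fps_X * fps_X) + 4 * \<sigma> * fps_X * \<Phi>
               + \<Phi> * \<Phi> - 2 * euler \<Phi> + 2 * \<Phi>"
  defines "H \<equiv> \<kappa> * (euler G - \<nu> * G - \<sigma> * fps_X * G)"
  shows "euler (euler H) = (2 * \<nu> + 1) * euler H - \<nu> * (\<nu> + 1) * H + U * H"
proof -
  have nz: "\<kappa> \<noteq> 0" "K \<noteq> 0" using \<kappa> by auto
  have e1: "euler 1 = 0" using euler_const[of 1] by simp
  have e2: "euler 2 = 0" using euler_const[of 2] by (simp add: numeral_fps_const)
  have "2 * \<kappa> * euler \<kappa> * K + \<kappa> * \<kappa> * euler K = euler (\<kappa> * \<kappa> * K)"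
    by (simp add: euler_mult algebra_simps)
  also have "\<dots> = 0" by (simp only: \<kappa> e1)
  finally have "\<kappa> * K * (2 * euler \<kappa> + \<kappa> * (\<Phi> + 2)) = 0"
    by (simp add: K algebra_simps)
  hence d\<kappa>: "2 * euler \<kappa> = - \<kappa> * (\<Phi> + 2)" using nz by (simp add: eq_neg_iff_add_eq_0)
  \<comment> \<open>The primed names below are Euler derivatives from which
    \<open>euler (euler G)\<close> has been eliminated. They are polynomials in A, G, K, \<Phi>, X,
    \<nu> and \<sigma>, so that \<open>key\<close> is a ring identity in which
    \<open>euler \<Phi>\<close> cancels.\<close>
  define A where "A = euler G"
  define X where "X = (fps_X :: complex fps)"
  define UL where "UL = \<nu> * (\<nu> + 1) * K + \<sigma> * \<sigma> * (X * X)"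
  define P where "P = A - \<nu> * G - \<sigma> * X * G"
  define A' where "A' = (2 * \<nu> + 1) * A - \<nu> * (\<nu> + 1) * G + UL * G"
  define UL' where "UL' = \<nu> * (\<nu> + 1) * (K * (\<Phi> + 2)) + 2 * \<sigma> * \<sigma> * (X * X)"
  define A'' where "A'' = (2 * \<nu> + 1) * A' - \<nu> * (\<nu> + 1) * A + UL' * G + UL * A"
  define P' where "P' = A' - \<nu> * A - \<sigma> * X * G - \<sigma> * X * A"
  define P'' where "P'' = A'' - \<nu> * A' - \<sigma> * X * G - 2 * (\<sigma> * X * A) - \<sigma> * X * A'"
  define Q where "Q = 2 * P' - (\<Phi> + 2) * P"
  have eX: "euler X = X" by (simp add: X_def euler_X)
  have eA: "euler A = A'" using G by (simp add: A_def A'_def UL_def X_def)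
  have eUL: "euler UL = UL'"
    by (simp only: UL_def euler_add euler_mult const K e1 eX) (simp add: UL'_def algebra_simps)
  have eA': "euler A' = A''"
    by (simp only: A'_def euler_add euler_diff euler_mult const e1 e2 eUL A_def[symmetric] eA)
       (simp add: A'_def A''_def algebra_simps)
  have eP: "euler P = P'"
    by (simp only: P_def euler_diff euler_mult const eX eA A_def[symmetric])
       (simp add: P'_def algebra_simps)
  have eP': "euler P' = P''"
    by (simp only: P'_def euler_diff euler_mult const eA eA' eX A_def[symmetric])
       (simp add: P''_def algebra_simps)
  have eQ: "euler Q = 2 * P'' - euler \<Phi> * P - (\<Phi> + 2) * P'"
    by (simp only: Q_def euler_diff euler_add euler_mult eP eP' e2) (simp add: algebra_simps)
  have H: "H = \<kappa> * P" by (simp add: H_def P_def A_def X_def)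
  have "2 * euler H = (2 * euler \<kappa>) * P + \<kappa> * (2 * P')"
    by (simp only: H euler_mult eP) (simp add: algebra_simps)
  hence H1: "2 * euler H = \<kappa> * Q" unfolding d\<kappa> Q_def by (simp add: algebra_simps)
  have "4 * euler (euler H) = 2 * euler (2 * euler H)" by (simp add: euler_mult e2)
  also have "\<dots> = (2 * euler \<kappa>) * Q + \<kappa> * (2 * euler Q)"
    unfolding H1 euler_mult by (simp add: algebra_simps)
  finally have H2: "4 * euler (euler H) = \<kappa> * (2 * euler Q - (\<Phi> + 2) * Q)"
    unfolding d\<kappa> by (simp add: algebra_simps)
  have key: "2 * euler Q - (\<Phi> + 2) * Q - 2 * (2 * \<nu> + 1) * Q + 4 * \<nu> * (\<nu> + 1) * P - 4 * U * P = 0"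
    unfolding eQ U[folded X_def]
    unfolding Q_def P''_def P'_def A''_def A'_def UL'_def UL_def P_def
    by (simp add: algebra_simps)
  have "4 * (euler (euler H) - (2 * \<nu> + 1) * euler H + \<nu> * (\<nu> + 1) * H - U * H) =
      4 * euler (euler H) - 2 * (2 * \<nu> + 1) * (2 * euler H) + 4 * \<nu> * (\<nu> + 1) * H - 4 * U * H"
    by (simp add: algebra_simps)
  also have "\<dots> = \<kappa> * (2 * euler Q - (\<Phi> + 2) * Q - 2 * (2 * \<nu> + 1) * Q + 4 * \<nu> * (\<nu> + 1) * P - 4 * U * P)"
    unfolding H2 H1 by (simp add: H algebra_simps)
  also have "\<dots> = 0" by (simp only: key mult_zero_right)
  finally have "4 * (euler (euler H) - (2 * \<nu> + 1) * euler H + \<nu> * (\<nu> + 1) * H - U * H) = 0" .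
  moreover have "(4 :: complex fps) \<noteq> 0" by (simp add: numeral_fps_const)
  ultimately have "euler (euler H) - (2 * \<nu> + 1) * euler H + \<nu> * (\<nu> + 1) * H - U * H = 0"
    by (simp only: mult_eq_0_iff) simp
  thus ?thesis by (simp add: algebra_simps)
qed

lemma fps_inverse_sqrt:
  fixes K :: "complex fps"
  assumes "fps_nth K 0 = 1"
  obtains \<kappa> where "\<kappa> * \<kappa> * K = 1"
proof -
  define R where "R = fps_radical (\<lambda>_ _. 1) 2 K"
  have "R ^ Suc 1 = K"
    unfolding R_def using power_radical[of K "\<lambda>_ _. 1" 1] assms by (simp add: numeral_2_eq_2)
  hence R: "R * R = K" by simp
  have "fps_nth R 0 * fps_nth R 0 = 1" using R assms by (metis fps_mult_nth_0)
  hence "fps_nth R 0 \<noteq> 0" by auto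
  hence "inverse R * R = 1" by (rule inverse_mult_eq_1)
  hence "inverse R * inverse R * K = 1"
    by (simp add: R[symmetric]) (metis mult.assoc mult.commute mult_1)
  thus ?thesis by (rule that)
qed

section \<open>The singular points p and -p\<close>

context weierstrass_point
begin

text \<open>In x = z - p one has x^2 q = 3/4 + T2 x + x^2 g(x) with g analytic at 0. The criterion
  becomes g(0) = T2^2, and the left-hand side is g(0) written out.\<close>

lemma log_free_at_p_iff:
  "log_free_at (potential n \<tau> p T1 T2 B) p \<longleftrightarrow>
     of_nat (n * (n + 1)) * wp p + 3 / 4 * (wp (2 * p) - deriv zeta_reg 0)
     + T1 * (\<zeta> (2 * p) - \<zeta> p) - T2 * \<zeta> p + B = T2\<^sup>2"
proof -
  define g where "g = (\<lambda>x. of_nat (n * (n + 1)) * wp (x + p) + 3 / 4 * (wp (x + 2 * p) - deriv zeta_reg x)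
     + T1 * (\<zeta> (x + 2 * p) - \<zeta> (x + p)) + T2 * (zeta_reg x - \<zeta> (x + p)) + B)"
  define U where "U = (\<lambda>x. 3 / 4 + T2 * x + x\<^sup>2 * g x)"
  have g: "g analytic_on {0}"
    unfolding g_def using p
    by (intro analytic_intros zeta_shift_analytic wp_shift_analytic zeta_reg_analytic_0 deriv_zeta_reg_analytic_0) auto
  hence U: "U analytic_on {0}" unfolding U_def by (intro analytic_intros)
  have "eventually (\<lambda>x. potential n \<tau> p T1 T2 B (p + x) = U x / x\<^sup>2) (at 0)"
    using near_0_at
  proof eventually_elim
    case (elim x)
    have e: "p + x = x + p" "x + p + p = x + 2 * p" "x + p - p = x" by simp_all
    have w: "wp x = 1 / x\<^sup>2 - deriv zeta_reg x" using elim by (intro wp_eq) auto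
    have "potential n \<tau> p T1 T2 B (p + x) = 3 / 4 * (1 / x\<^sup>2) + T2 * (1 / x) + g x"
      unfolding potential_def g_def e w zeta_eq[of x] by (simp add: algebra_simps)
    also have "\<dots> = U x / x\<^sup>2" using elim by (simp add: U_def field_simps power2_eq_square)
    finally show ?case .
  qed
  then obtain R where R: "R > 0" "U holomorphic_on ball 0 R"
     "\<And>x. x \<in> ball 0 R - {0} \<Longrightarrow> potential n \<tau> p T1 T2 B (p + x) = U x / x\<^sup>2"
    by (rule analytic_radius[OF U]) blast
  define Gf where "Gf = fps_expansion g 0"
  have Gf: "g has_fps_expansion Gf" unfolding Gf_def by (rule analytic_at_imp_has_fps_expansion_0[OF g])
  have W: "U has_fps_expansion (fps_const (3 / 4) + fps_const T2 * fps_X + fps_X ^ 2 * Gf)" (is "_ has_fps_expansion ?W")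
    unfolding U_def by (intro fps_expansion_intros Gf)
  have nth: "?W $ 0 = 3 / 4" "?W $ 1 = T2" "?W $ 2 = g 0"
    using fps_nth_fps_expansion[OF Gf, of 0] by (simp_all add: fps_X_power_mult_nth)
  have "log_free_at (potential n \<tau> p T1 T2 B) p \<longleftrightarrow> ?W $ 2 = (?W $ 1)\<^sup>2"
    by (rule log_free_half_integer[OF R(1,2) W R(3) nth(1)])
  thus ?thesis unfolding nth by (simp add: g_def algebra_simps)
qed

text \<open>Replacing p by -p and exchanging \<open>T1\<close> with \<open>T2\<close> leaves the
  potential unchanged, so the condition is that at p in other letters.\<close>

lemma log_free_at_minus_p_iff:
  "log_free_at (potential n \<tau> p T1 T2 B) (- p) \<longleftrightarrow>
     of_nat (n * (n + 1)) * wp p + 3 / 4 * (wp (2 * p) - deriv zeta_reg 0)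
     - T2 * (\<zeta> (2 * p) - \<zeta> p) + T1 * \<zeta> p + B = T1\<^sup>2"
proof -
  interpret m: weierstrass_point \<tau> "- p"
    by unfold_locales (use p lattice_minus_iff[of "2 * p"] in auto)
  have "potential n \<tau> (- p) T2 T1 B = potential n \<tau> p T1 T2 B"
    by (rule ext) (simp add: potential_def)
  moreover have "\<zeta> (2 * - p) = - \<zeta> (2 * p)" "wp (2 * - p) = wp (2 * p)"
    using zeta_odd[of "2 * p"] wp_even[of "2 * p"] by simp_all
  ultimately show ?thesis
    using m.log_free_at_p_iff[of n T2 T1 B] by (simp add: zeta_odd wp_even algebra_simps)
qed

lemma log_free_imp_lines:
  assumes "log_free_equation n \<tau> p T1 T2 B"
  shows "T1 + T2 = 0 \<or> T1 - T2 + c = 0"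
proof -
  define M where "M = of_nat (n * (n + 1)) * wp p + 3 / 4 * (wp (2 * p) - deriv zeta_reg 0)"
  have 1: "M + T1 * (\<zeta> (2 * p) - \<zeta> p) - T2 * \<zeta> p + B = T2\<^sup>2"
    and 2: "M - T2 * (\<zeta> (2 * p) - \<zeta> p) + T1 * \<zeta> p + B = T1\<^sup>2"
    using assms log_free_at_p_iff[of n T1 T2 B] log_free_at_minus_p_iff[of n T1 T2 B]
    by (auto simp: log_free_equation_def M_def)
  have "T2\<^sup>2 - T1\<^sup>2 = (T1 + T2) * c"
    unfolding 1[symmetric] 2[symmetric] by (simp add: c_def algebra_simps)
  hence "(T1 + T2) * (T1 - T2 + c) = 0" by (simp add: power2_eq_square algebra_simps)
  thus ?thesis by simp
qed

text \<open>The analytic continuation of \<open>z\<^sup>2 q\<close> to \<open>0\<close>. Likewise, \<open>\<Phi>\<close> and \<open>wp_z2\<close> below continue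
  \<open>z F\<close> and \<open>z\<^sup>2 (\<wp> - \<wp>(p))\<close>.\<close>

definition potential_z2 :: "nat \<Rightarrow> complex \<Rightarrow> complex \<Rightarrow> complex \<Rightarrow> complex \<Rightarrow> complex" where
  "potential_z2 n T1 T2 B x = of_nat (n * (n + 1)) * (1 - x\<^sup>2 * deriv zeta_reg x)
     + x\<^sup>2 * (3 / 4 * (wp (x + p) + wp (x - p)) + T1 * \<zeta> (x + p) + T2 * \<zeta> (x - p) + B)
     - (T1 + T2) * (x + x\<^sup>2 * zeta_reg x)"

section \<open>The singular point 0 and the even line\<close>

lemma shift_minus_analytic: "(\<lambda>x. \<zeta> (x - p)) analytic_on {0}" "(\<lambda>x. wp (x - p)) analytic_on {0}"
  using zeta_shift_analytic[of "- p"] wp_shift_analytic[of "- p"] by auto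

lemma potential_z2_analytic: "potential_z2 n T1 T2 B analytic_on {0}"
  unfolding potential_z2_def[abs_def]
  by (intro analytic_intros zeta_shift_analytic wp_shift_analytic shift_minus_analytic
      zeta_reg_analytic_0 deriv_zeta_reg_analytic_0) auto

lemma potential_near_0:
  "eventually (\<lambda>x. potential n \<tau> p T1 T2 B x = potential_z2 n T1 T2 B x / x\<^sup>2) (at 0)"
  using near_0_at
proof eventually_elim
  case (elim x)
  have w: "wp x = 1 / x\<^sup>2 - deriv zeta_reg x" using elim by (intro wp_eq) auto
  show ?case unfolding potential_def potential_z2_def w zeta_eq[of x]
    using elim by (simp add: field_simps power2_eq_square)
qed

lemma log_free_at_0:
  assumes W: "potential_z2 n T1 T2 B has_fps_expansion W"
    and G: "frobenius_op W (- of_nat n) G = 0" "G $ 0 \<noteq> 0"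
  shows "log_free_at (potential n \<tau> p T1 T2 B) 0"
proof -
  have ev: "eventually (\<lambda>x. potential n \<tau> p T1 T2 B (0 + x) = potential_z2 n T1 T2 B x / x\<^sup>2) (at 0)"
    using potential_near_0 by simp
  obtain R where R: "R > 0" "potential_z2 n T1 T2 B holomorphic_on ball 0 R"
     "\<And>x. x \<in> ball 0 R - {0} \<Longrightarrow> potential n \<tau> p T1 T2 B (0 + x) = potential_z2 n T1 T2 B x / x\<^sup>2"
    by (rule analytic_radius[OF potential_z2_analytic ev]) blast
  have "W $ 0 = potential_z2 n T1 T2 B 0" using fps_nth_fps_expansion[OF W, of 0] by simp
  hence W0: "W $ 0 = (- of_nat n) * (- of_nat n - 1)" by (simp add: potential_z2_def algebra_simps)
  have \<rho>: "2 * (- of_nat n) = (1 - of_nat (2 * n + 1) :: complex)" by simp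
  show ?thesis
    by (rule log_free_criterion[OF R(1,2) W R(3) W0 \<rho> _ G]) simp_all
qed

lemma deriv_zeta_reg_even:
  assumes "x \<notin> \<Lambda>'"
  shows "deriv zeta_reg (- x) = deriv zeta_reg x"
proof -
  have "(zeta_reg has_field_derivative deriv zeta_reg (- x)) (at (- x))"
    using assms lattice_minus_iff[of x] by (intro zeta_reg_deriv) auto
  hence "((\<lambda>x. zeta_reg (- x)) has_field_derivative (deriv zeta_reg (- x) * - 1)) (at x)"
    by (rule DERIV_chain2) (auto intro!: derivative_eq_intros)
  hence "((\<lambda>x. - zeta_reg x) has_field_derivative (deriv zeta_reg (- x) * - 1)) (at x)"
    by (simp add: zeta_reg_odd)
  moreover have "((\<lambda>x. - zeta_reg x) has_field_derivative - deriv zeta_reg x) (at x)"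
    by (intro derivative_intros zeta_reg_deriv assms)
  ultimately show ?thesis using DERIV_unique by fastforce
qed

lemma log_free_at_0_if_even:
  assumes s: "T1 + T2 = 0"
  shows "log_free_at (potential n \<tau> p T1 T2 B) 0"
proof -
  define W where "W = fps_expansion (potential_z2 n T1 T2 B) 0"
  have W: "potential_z2 n T1 T2 B has_fps_expansion W"
    unfolding W_def by (rule analytic_at_imp_has_fps_expansion_0[OF potential_z2_analytic])
  have T2: "T2 = - T1" using s by (simp add: eq_neg_iff_add_eq_0 add.commute)
  have ev: "eventually (\<lambda>x. potential_z2 n T1 T2 B (- x) = potential_z2 n T1 T2 B x) (nhds 0)"
    using near_0
  proof eventually_elim
    case (elim x)
    have e: "- x + p = - (x - p)" "- x - p = - (x + p)" by simp_all
    have d: "deriv zeta_reg (- x) = deriv zeta_reg x" using elim by (intro deriv_zeta_reg_even) auto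
    show ?case unfolding potential_z2_def e zeta_odd wp_even d T2 by (simp add: algebra_simps)
  qed
  have "W $ 0 = potential_z2 n T1 T2 B 0" using fps_nth_fps_expansion[OF W, of 0] by simp
  hence W0: "W $ 0 = (- of_nat n) * (- of_nat n - 1)" by (simp add: potential_z2_def algebra_simps)
  have \<rho>: "2 * (- of_nat n) = (1 - of_nat (2 * n + 1) :: complex)" by simp
  obtain G where "frobenius_op W (- of_nat n) G = 0" "G $ 0 = 1"
    using even_frobenius_solution[OF W0 \<rho> _ fps_even[OF W ev]] by auto
  thus ?thesis using log_free_at_0[OF W, of G] by simp
qed

lemma even_line_log_free:
  assumes s: "T1 + T2 = 0"
  shows "\<exists>B. log_free_equation n \<tau> p T1 T2 B"
proof -
  \<comment> \<open>This solves the condition at p for \<open>B\<close>. With T2 = - T1 the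
    condition at -p coincides with it, and the one at 0 holds for every \<open>B\<close>.\<close>
  define B where "B = T2\<^sup>2 - (of_nat (n * (n + 1)) * wp p + 3 / 4 * (wp (2 * p) - deriv zeta_reg 0)
     + T1 * (\<zeta> (2 * p) - \<zeta> p) - T2 * \<zeta> p)"
  have T2: "T2 = - T1" using s by (simp add: eq_neg_iff_add_eq_0 add.commute)
  have "log_free_at (potential n \<tau> p T1 T2 B) p"
    unfolding log_free_at_p_iff by (simp add: B_def)
  moreover have "log_free_at (potential n \<tau> p T1 T2 B) (- p)"
    unfolding log_free_at_minus_p_iff by (simp add: B_def T2 algebra_simps)
  ultimately show ?thesis using log_free_at_0_if_even[OF s]
    by (auto simp: log_free_equation_def)
qed

section \<open>The Darboux transform and the second line\<close>

lemma potential_darboux: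
  assumes "T1 - T2 + c = 0" "z \<notin> S"
  shows "potential n \<tau> p T1 T2 B z = of_nat (n * (n + 1)) * wp z
     - (2 * wp z - wp (z + p) - wp (z - p)) / 2 + (T1 + T2) / 2 * F z + (F z)\<^sup>2 / 4
     + (B - (c\<^sup>2 + 2 * c * \<zeta> (2 * p) - 3 * wp (2 * p) + 3 * deriv zeta_reg 0) / 4)"
proof -
  \<comment> \<open>The double poles on both sides agree by \<open>F_square\<close>; this relation
    is the equality of the residues at p and -p.\<close>
  have T1: "T1 = T2 - c" using assms(1) by (simp add: algebra_simps eq_neg_iff_add_eq_0)
  show ?thesis
    unfolding F_square[OF assms(2)] potential_def T1 by (simp add: F_def field_simps)
qed

definition \<Phi> :: "complex \<Rightarrow> complex" where
  "\<Phi> x = x * (\<zeta> (x + p) + \<zeta> (x - p)) - 2 - 2 * x * zeta_reg x"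

definition wp_z2 :: "complex \<Rightarrow> complex" where
  "wp_z2 x = 1 - x\<^sup>2 * (deriv zeta_reg x + wp p)"

lemma Phi_analytic: "\<Phi> analytic_on {0}"
  unfolding \<Phi>_def[abs_def]
  by (intro analytic_intros zeta_shift_analytic shift_minus_analytic zeta_reg_analytic_0) auto

lemma wp_z2_analytic: "wp_z2 analytic_on {0}"
  unfolding wp_z2_def[abs_def] by (intro analytic_intros deriv_zeta_reg_analytic_0)

lemma Phi_eq: "x \<noteq> 0 \<Longrightarrow> \<Phi> x = x * F x"
  by (simp add: \<Phi>_def F_near_0 algebra_simps)

lemma wp_z2_eq:
  assumes "x \<notin> \<Lambda>"
  shows "wp_z2 x = x\<^sup>2 * (wp x - wp p)"
proof -
  have "x \<noteq> 0" "wp x = 1 / x\<^sup>2 - deriv zeta_reg x" using assms wp_eq[of x] by auto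
  thus ?thesis unfolding wp_z2_def by (simp add: right_diff_distrib distrib_left)
qed

lemma near_0_notin_S: "eventually (\<lambda>x. x \<noteq> 0 \<and> x \<notin> S) (at 0)"
  using near_0_at by eventually_elim (auto simp: S_def)

lemma deriv_Phi:
  assumes "x \<notin> S"
  shows "deriv \<Phi> x = F x + x * (2 * wp x - wp (x + p) - wp (x - p))"
proof -
  have nz: "x \<noteq> 0" using assms by (auto simp: S_def)
  have "eventually (\<lambda>y. y \<in> - {0}) (nhds x)" using nz by (intro eventually_nhds_in_open) auto
  hence "eventually (\<lambda>y. \<Phi> y = y * F y) (nhds x)" by eventually_elim (simp add: Phi_eq)
  hence "deriv \<Phi> x = deriv (\<lambda>y. y * F y) x" by (rule deriv_cong_ev) simp
  also have "((\<lambda>y. y * F y) has_field_derivative F x + x * (2 * wp x - wp (x + p) - wp (x - p))) (at x)"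
    by (rule derivative_eq_intros refl F_deriv[OF assms])+ simp
  hence "deriv (\<lambda>y. y * F y) x = F x + x * (2 * wp x - wp (x + p) - wp (x - p))" by (rule DERIV_imp_deriv)
  finally show ?thesis .
qed

lemma deriv_wp_z2:
  assumes "x \<notin> \<Lambda>"
  shows "deriv wp_z2 x = 2 * x * (wp x - wp p) + x\<^sup>2 * deriv wp x"
proof -
  have "eventually (\<lambda>y. y \<in> - \<Lambda>) (nhds x)" using assms open_compl_lattice by (intro eventually_nhds_in_open) auto
  hence "eventually (\<lambda>y. wp_z2 y = y\<^sup>2 * (wp y - wp p)) (nhds x)" by eventually_elim (simp add: wp_z2_eq)
  hence "deriv wp_z2 x = deriv (\<lambda>y. y\<^sup>2 * (wp y - wp p)) x" by (rule deriv_cong_ev) simp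
  also have "((\<lambda>y. y\<^sup>2 * (wp y - wp p)) has_field_derivative 2 * x * (wp x - wp p) + x\<^sup>2 * deriv wp x) (at x)"
    by (rule derivative_eq_intros refl deriv_wp[OF assms])+ simp
  hence "deriv (\<lambda>y. y\<^sup>2 * (wp y - wp p)) x = 2 * x * (wp x - wp p) + x\<^sup>2 * deriv wp x" by (rule DERIV_imp_deriv)
  finally show ?thesis .
qed

lemma eventually_at_0_nhds:
  assumes "eventually P (at (0::complex))" "P 0"
  shows "eventually P (nhds 0)"
  using assms(1) unfolding eventually_at_filter by eventually_elim (use assms(2) in auto)

text \<open>This is \<open>addition_log_derivative\<close> multiplied by x^3. It is extended to 0
  itself because power series are compared on a full neighbourhood.\<close>

lemma wp_z2_Phi: "eventually (\<lambda>x. wp_z2 x * \<Phi> x = x * deriv wp_z2 x - 2 * wp_z2 x) (nhds 0)"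
proof (rule eventually_at_0_nhds)
  show "eventually (\<lambda>x. wp_z2 x * \<Phi> x = x * deriv wp_z2 x - 2 * wp_z2 x) (at 0)"
    using near_0_notin_S
  proof eventually_elim
    case (elim x)
    hence x: "x \<notin> \<Lambda>" by (auto simp: S_def)
    have "wp_z2 x * \<Phi> x = x ^ 3 * (F x * (wp x - wp p))"
      using elim by (simp add: wp_z2_eq[OF x] Phi_eq power2_eq_square power3_eq_cube)
    also have "F x * (wp x - wp p) = deriv wp x" using elim by (intro addition_log_derivative) auto
    finally show ?case
      by (simp add: wp_z2_eq[OF x] deriv_wp_z2[OF x] power2_eq_square power3_eq_cube algebra_simps)
  qed
qed (simp add: wp_z2_def \<Phi>_def)

text \<open>The value of \<open>B\<close> for which the constants in
  \<open>potential_darboux\<close> turn n(n+1) \<wp> into n(n+1) (\<wp> - \<wp>(p)) + s^2/4 with s =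
  T1 + T2.\<close>

definition darboux_B :: "nat \<Rightarrow> complex \<Rightarrow> complex \<Rightarrow> complex" where
  "darboux_B n T1 T2 = (T1 + T2)\<^sup>2 / 4 - of_nat (n * (n + 1)) * wp p +
     (c\<^sup>2 + 2 * c * \<zeta> (2 * p) - 3 * wp (2 * p) + 3 * deriv zeta_reg 0) / 4"

text \<open>The analytic source of the hypothesis on \<open>U\<close> in
  \<open>darboux_frobenius\<close>; the derivative of \<open>F\<close> enters through x^2 F' = x
  \<Phi>' - \<Phi>.\<close>

lemma potential_z2_darboux:
  assumes "T1 - T2 + c = 0"
  shows "eventually (\<lambda>x. 4 * potential_z2 n T1 T2 (darboux_B n T1 T2) x =
     4 * (of_nat n * (of_nat n + 1)) * wp_z2 x + (T1 + T2)\<^sup>2 * x ^ 2 + 2 * (T1 + T2) * (x * \<Phi> x) + \<Phi> x * \<Phi> x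
      - 2 * (x * deriv \<Phi> x) + 2 * \<Phi> x) (nhds 0)"
proof (rule eventually_at_0_nhds)
  show "eventually (\<lambda>x. 4 * potential_z2 n T1 T2 (darboux_B n T1 T2) x =
     4 * (of_nat n * (of_nat n + 1)) * wp_z2 x + (T1 + T2)\<^sup>2 * x ^ 2 + 2 * (T1 + T2) * (x * \<Phi> x) + \<Phi> x * \<Phi> x
      - 2 * (x * deriv \<Phi> x) + 2 * \<Phi> x) (at 0)"
    using near_0_notin_S potential_near_0[of n T1 T2 "darboux_B n T1 T2"]
  proof eventually_elim
    case (elim x)
    define N :: complex where "N = of_nat n * (of_nat n + 1)"
    define D where "D = 2 * wp x - wp (x + p) - wp (x - p)"
    have N: "of_nat (n * (n + 1)) = N" by (simp add: N_def algebra_simps)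
    have x: "x \<notin> \<Lambda>" "x \<notin> S" "x \<noteq> 0" using elim by (auto simp: S_def)
    have "potential_z2 n T1 T2 (darboux_B n T1 T2) x = x\<^sup>2 * potential n \<tau> p T1 T2 (darboux_B n T1 T2) x"
      using elim by (simp add: field_simps)
    also have "potential n \<tau> p T1 T2 (darboux_B n T1 T2) x =
        N * wp x - D / 2 + (T1 + T2) / 2 * F x + (F x)\<^sup>2 / 4 + ((T1 + T2)\<^sup>2 / 4 - N * wp p)"
      unfolding potential_darboux[OF assms x(2)] darboux_B_def N D_def by simp
    finally have U: "potential_z2 n T1 T2 (darboux_B n T1 T2) x = x\<^sup>2 * (N * wp x - D / 2 + (T1 + T2) / 2 * F x
        + (F x)\<^sup>2 / 4 + ((T1 + T2)\<^sup>2 / 4 - N * wp p))" .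
    show ?case
      unfolding U wp_z2_eq[OF x(1)] Phi_eq[OF x(3)] deriv_Phi[OF x(2)] N_def[symmetric] D_def[symmetric]
      by (simp add: power2_eq_square field_simps)
  qed
qed (simp add: potential_z2_def wp_z2_def \<Phi>_def algebra_simps)

lemma noneven_line_log_free:
  assumes T: "T1 - T2 + c = 0" and n: "n > 0"
  shows "\<exists>B. log_free_equation n \<tau> p T1 T2 B"
proof -
  define s where "s = T1 + T2"
  define B where "B = darboux_B n T1 T2"
  define \<nu> :: "complex fps" where "\<nu> = fps_const (of_nat n)"
  define \<sigma> :: "complex fps" where "\<sigma> = fps_const (s / 2)"
  define W where "W = fps_expansion (potential_z2 n T1 T2 B) 0"
  define K where "K = fps_expansion wp_z2 0"
  define Q where "Q = fps_expansion \<Phi> 0"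
  have W: "potential_z2 n T1 T2 B has_fps_expansion W"
    unfolding W_def by (rule analytic_at_imp_has_fps_expansion_0[OF potential_z2_analytic])
  have K: "wp_z2 has_fps_expansion K"
    unfolding K_def by (rule analytic_at_imp_has_fps_expansion_0[OF wp_z2_analytic])
  have Q: "\<Phi> has_fps_expansion Q"
    unfolding Q_def by (rule analytic_at_imp_has_fps_expansion_0[OF Phi_analytic])
  have K0: "K $ 0 = 1" using fps_nth_fps_expansion[OF K, of 0] by (simp add: wp_z2_def)
  have "K * Q = fps_X * fps_deriv K - fps_const 2 * K"
  proof -
    have "(\<lambda>x. wp_z2 x * \<Phi> x) has_fps_expansion K * Q" by (intro fps_expansion_intros K Q)
    moreover have "(\<lambda>x. x * deriv wp_z2 x - 2 * wp_z2 x) has_fps_expansion fps_X * fps_deriv K - fps_const 2 * K"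
      by (intro fps_expansion_intros K)
    ultimately show ?thesis
      using has_fps_expansion_cong[OF wp_z2_Phi refl] fps_expansion_unique_complex by blast
  qed
  hence eK: "euler K = K * (Q + 2)"
    by (simp add: euler_def numeral_fps_const algebra_simps)
  have "fps_const 4 * W = fps_const (4 * (of_nat n * (of_nat n + 1))) * K + fps_const (s\<^sup>2) * fps_X ^ 2
      + fps_const (2 * s) * (fps_X * Q) + Q * Q - fps_const 2 * (fps_X * fps_deriv Q) + fps_const 2 * Q"
  proof -
    have "(\<lambda>x. 4 * (of_nat n * (of_nat n + 1)) * wp_z2 x + s\<^sup>2 * x ^ 2 + 2 * s * (x * \<Phi> x) + \<Phi> x * \<Phi> x
      - 2 * (x * deriv \<Phi> x) + 2 * \<Phi> x) has_fps_expansion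
      fps_const (4 * (of_nat n * (of_nat n + 1))) * K + fps_const (s\<^sup>2) * fps_X ^ 2
      + fps_const (2 * s) * (fps_X * Q) + Q * Q - fps_const 2 * (fps_X * fps_deriv Q) + fps_const 2 * Q"
      by (intro fps_expansion_intros K Q)
    moreover have "(\<lambda>x. 4 * potential_z2 n T1 T2 B x) has_fps_expansion fps_const 4 * W"
      by (intro fps_expansion_intros W)
    ultimately show ?thesis
      using has_fps_expansion_cong[OF potential_z2_darboux[OF T, of n, folded B_def s_def] refl]
        fps_expansion_unique_complex by blast
  qed
  moreover have "fps_const (4 * (of_nat n * (of_nat n + 1))) = 4 * \<nu> * (\<nu> + 1)"
    by (simp add: \<nu>_def numeral_fps_const algebra_simps flip: fps_const_1_eq_1)
  moreover have "fps_const (s\<^sup>2) = 4 * \<sigma> * \<sigma>" "fps_const (2 * s) = 4 * \<sigma>"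
    by (simp_all add: \<sigma>_def numeral_fps_const power2_eq_square)
  ultimately have U: "4 * W = 4 * \<nu> * (\<nu> + 1) * K + 4 * \<sigma> * \<sigma> * (fps_X * fps_X) + 4 * \<sigma> * fps_X * Q
               + Q * Q - 2 * euler Q + 2 * Q"
    by (simp add: euler_def numeral_fps_const power2_eq_square mult.assoc)
  obtain \<kappa> where \<kappa>: "\<kappa> * \<kappa> * K = 1" using fps_inverse_sqrt[OF K0] by blast
  \<comment> \<open>x^2 times the Lame potential n(n+1) (\<wp> - \<wp>(p)) + s^2/4. Its expansion is
    even, so \<open>even_frobenius_solution\<close> supplies \<open>G\<close>.\<close>
  define L where "L = \<nu> * (\<nu> + 1) * K + \<sigma> * \<sigma> * (fps_X * fps_X)"
  have L: "L = fps_const (of_nat n * (of_nat n + 1)) * K + fps_const (s / 2 * (s / 2)) * fps_X ^ 2"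
    by (simp add: L_def \<nu>_def \<sigma>_def power2_eq_square algebra_simps flip: fps_const_1_eq_1)
  have ev: "eventually (\<lambda>x. wp_z2 (- x) = wp_z2 x) (nhds 0)"
    using near_0 by eventually_elim (simp add: wp_z2_def deriv_zeta_reg_even)
  have L0: "L $ 0 = (- of_nat n) * (- of_nat n - 1)"
    using K0 by (simp add: L algebra_simps)
  have \<rho>: "2 * (- of_nat n) = (1 - of_nat (2 * n + 1) :: complex)" by simp
  have "L $ k = 0" if "odd k" for k
    using fps_even[OF K ev that] that by (auto simp: L fps_X_power_nth)
  then obtain G where G: "frobenius_op L (- of_nat n) G = 0" "G $ 0 = 1"
    using even_frobenius_solution[OF L0 \<rho>] by auto
  define H where "H = \<kappa> * (euler G - \<nu> * G - \<sigma> * fps_X * G)"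
  have "euler (euler H) = (2 * \<nu> + 1) * euler H - \<nu> * (\<nu> + 1) * H + W * H"
    unfolding H_def
  proof (rule darboux_frobenius[OF _ _ \<kappa> eK _ U])
    show "euler \<nu> = 0" "euler \<sigma> = 0" by (simp_all add: \<nu>_def \<sigma>_def euler_const)
    show "euler (euler G) = (2 * \<nu> + 1) * euler G - \<nu> * (\<nu> + 1) * G
               + (\<nu> * (\<nu> + 1) * K + \<sigma> * \<sigma> * (fps_X * fps_X)) * G"
      using G(1) unfolding frobenius_op_minus_iff L_def \<nu>_def .
  qed
  hence H: "frobenius_op W (- of_nat n) H = 0"
    unfolding frobenius_op_minus_iff \<nu>_def .
  have "\<kappa> $ 0 \<noteq> 0" using \<kappa> by (metis fps_mult_nth_0 fps_one_nth mult_zero_left zero_neq_one)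
  \<comment> \<open>The lowest coefficient of \<open>H\<close> is - n times that of
    \<kappa>.\<close>
  hence "H $ 0 \<noteq> 0" using n G(2) by (simp add: H_def \<nu>_def)
  hence "log_free_at (potential n \<tau> p T1 T2 B) 0"
    by (rule log_free_at_0[OF W H])
  \<comment> \<open>At p and -p the constant \<open>darboux_B\<close> is compared with the two
    conditions by algebra: the terms with n and with \<wp>(2p) cancel, and \<zeta>(2p) is eliminated
    in favour of c and \<zeta>(p).\<close>
  moreover have z2: "\<zeta> (2 * p) = c + 2 * \<zeta> p" and T1: "T1 = T2 - c"
    using T by (simp_all add: c_def algebra_simps eq_neg_iff_add_eq_0)
  have "log_free_at (potential n \<tau> p T1 T2 B) p" "log_free_at (potential n \<tau> p T1 T2 B) (- p)"
    unfolding log_free_at_p_iff log_free_at_minus_p_iff B_def darboux_B_def z2 T1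
    by (simp_all add: field_simps power2_eq_square)
  ultimately show ?thesis by (auto simp: log_free_equation_def)
qed

section \<open>Parity of the potential\<close>

lemma potential_minus:
  "potential n \<tau> p T1 T2 B z - potential n \<tau> p T1 T2 B (- z) = (T1 + T2) * F z"
proof -
  have e: "- z + p = - (z - p)" "- z - p = - (z + p)" by simp_all
  show ?thesis unfolding potential_def e zeta_odd wp_even by (simp add: F_def algebra_simps)
qed

text \<open>The odd part of the potential is (T1 + T2) F / 2, and F is not identically zero: its
  pole at 0 shows in \<open>\<Phi> 0 = - 2\<close>.\<close>

lemma even_potential_iff: "even_potential n \<tau> p T1 T2 B \<longleftrightarrow> T1 + T2 = 0"
proof
  assume "T1 + T2 = 0"
  thus "even_potential n \<tau> p T1 T2 B"
    using potential_minus[of n T1 T2 B] by (simp add: even_potential_def)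
next
  assume ev: "even_potential n \<tau> p T1 T2 B"
  show "T1 + T2 = 0"
  proof (rule ccontr)
    assume nz: "T1 + T2 \<noteq> 0"
    have "F z = 0" if "z \<notin> S" for z
      using potential_minus[of n T1 T2 B z] ev that nz by (auto simp: even_potential_def S_def)
    hence "eventually (\<lambda>x. \<Phi> x = 0) (at 0)"
      using near_0_notin_S by (auto elim!: eventually_mono simp: Phi_eq)
    hence "((\<lambda>_::complex. 0) \<longlongrightarrow> \<Phi> 0) (at 0)"
      by (rule Lim_transform_eventually[OF analytic_tendsto[OF Phi_analytic]])
    hence "\<Phi> 0 = 0" using tendsto_const_iff[of "at (0::complex)" 0 "\<Phi> 0"] by simp
    thus False by (simp add: \<Phi>_def)
  qed
qed

lemma log_free_variety_eq:
  assumes "n > 0"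
  shows "log_free_variety n \<tau> p = {(T1, T2). T1 + T2 = 0 \<or> T1 - T2 + c = 0}"
  using log_free_imp_lines even_line_log_free noneven_line_log_free[OF _ assms]
  unfolding log_free_variety_def by blast

end

section \<open>Irreducible components\<close>

lemma poly_poly_graph: "poly (poly f [:poly l x:]) x = poly (poly f l) (x :: complex)"
  by (induction f) (simp_all)

text \<open>A closed set that misses a point of the graph gives a nonzero polynomial f(x, l(x))
  vanishing wherever the graph meets the set. Two such sets cannot cover the graph, since the
  product of their polynomials would vanish everywhere.\<close>

lemma irreducible_set_graph: "irreducible_set {(x, y). y = poly l x}"
proof -
  let ?L = "{(x, y). y = poly l x}"
  have *: "\<exists>g. g \<noteq> 0 \<and> (\<forall>x. (x, poly l x) \<in> A \<longrightarrow> poly g x = 0)" if alg: "algebraic_set A" and nsub: "\<not> ?L \<subseteq> A" for A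
  proof -
    obtain X :: "complex poly poly set" where X: "A = {(x, y). \<forall>f\<in>X. poly (poly f [:y:]) x = 0}"
      using alg unfolding algebraic_set_def by blast
    obtain x where "(x, poly l x) \<notin> A" using nsub by auto
    then obtain f where f: "f \<in> X" "poly (poly f l) x \<noteq> 0"
      by (auto simp: X poly_poly_graph)
    show ?thesis
      by (rule exI[of _ "poly f l"]) (use f in \<open>auto simp: X poly_poly_graph\<close>)
  qed
  show ?thesis
    unfolding irreducible_set_def
  proof (intro conjI allI impI)
    fix A B assume AB: "algebraic_set A \<and> algebraic_set B \<and> ?L \<subseteq> A \<union> B"
    show "?L \<subseteq> A \<or> ?L \<subseteq> B"
    proof (rule ccontr)
      assume "\<not> (?L \<subseteq> A \<or> ?L \<subseteq> B)"
      then obtain g h where gh: "g \<noteq> 0" "\<And>x. (x, poly l x) \<in> A \<Longrightarrow> poly g x = 0"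
        "h \<noteq> 0" "\<And>x. (x, poly l x) \<in> B \<Longrightarrow> poly h x = 0"
        using *[of A] *[of B] AB by blast
      have "poly (g * h) x = 0" for x
        using AB gh(2)[of x] gh(4)[of x] by auto
      hence "g * h = 0" using poly_all_0_iff_0 by blast
      thus False using gh by simp
    qed
  qed auto
qed

lemma irreducible_components_Un:
  assumes "algebraic_set A" "algebraic_set B" "irreducible_set A" "irreducible_set B"
    and "\<not> A \<subseteq> B" "\<not> B \<subseteq> A"
  shows "{S. irreducible_component (A \<union> B) S} = {A, B}"
proof -
  have *: "S \<subseteq> A \<or> S \<subseteq> B" if "irreducible_set S" "S \<subseteq> A \<union> B" for S
    using that assms(1,2) unfolding irreducible_set_def by blast
  have "irreducible_component (A \<union> B) A" "irreducible_component (A \<union> B) B"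
    unfolding irreducible_component_def using * assms by blast+
  moreover have "S = A \<or> S = B" if "irreducible_component (A \<union> B) S" for S
    using that * assms(3,4) unfolding irreducible_component_def by (metis Un_upper1 Un_upper2)
  ultimately show ?thesis by blast
qed

lemma algebraic_set_curve: "algebraic_set {(x, y). poly (poly f [:y:]) x = 0}"
  unfolding algebraic_set_def by (rule exI[of _ "{f}"]) simp

theorem theorem1p1:
  fixes n :: nat and \<tau> p :: complex
  assumes "n > 0"
    and "Im \<tau> > 0"
    and "2 * p \<notin> period_lattice \<tau>"
  shows "algebraic_set (log_free_variety n \<tau> p) \<and>
     log_free_variety n \<tau> p = log_free_variety0 n \<tau> p \<union> log_free_variety1 n \<tau> p \<and>
     {S. irreducible_component (log_free_variety n \<tau> p) S}
           = {log_free_variety0 n \<tau> p, log_free_variety1 n \<tau> p} \<and>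
     log_free_variety0 n \<tau> p \<noteq> log_free_variety1 n \<tau> p \<and>
     even_component n \<tau> p (log_free_variety0 n \<tau> p) \<and>
     noneven_component n \<tau> p (log_free_variety1 n \<tau> p) \<and>
     log_free_variety0 n \<tau> p \<inter> log_free_variety1 n \<tau> p
           = {(- (deriv (deriv (weierstrass_p \<tau>)) p / (4 * deriv (weierstrass_p \<tau>) p)),
               deriv (deriv (weierstrass_p \<tau>)) p / (4 * deriv (weierstrass_p \<tau>) p))}"
proof -
  interpret weierstrass_point \<tau> p by unfold_locales (use assms in auto)
  define e where "e = deriv (deriv wp) p / (4 * deriv wp p)"
  have c: "c = 2 * e" "deriv (deriv wp) p / (2 * deriv wp p) = c"
    unfolding c_eq e_def by simp_all
  let ?L = "log_free_variety n \<tau> p" and ?A = "log_free_variety0 n \<tau> p" and ?B = "log_free_variety1 n \<tau> p"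
  have V: "?L = {(x, y). x + y = 0 \<or> x - y + c = 0}" by (rule log_free_variety_eq[OF assms(1)])
  have V0: "?A = {(x, y). x + y = 0}" unfolding log_free_variety0_def V by auto
  have V1: "?B = {(x, y). x - y + c = 0}" unfolding log_free_variety1_def V c(2) by auto
  \<comment> \<open>The outer variable is y, so \<open>[: [:a, b:], d :]\<close> stands for a + b x
    + d y.\<close>
  have alg0: "algebraic_set ?A"
    using algebraic_set_curve[of "[: [:0, 1:], 1 :]"] unfolding V0 by (simp add: add.commute)
  have alg1: "algebraic_set ?B"
    using algebraic_set_curve[of "[: [:c, 1:], -1 :]"] unfolding V1 by (simp add: algebra_simps)
  have algV: "algebraic_set ?L"
  proof -
    have "algebraic_set {(x, y). poly (poly [: [:0, 1:], 1 :] [:y:]) x = 0 \<or>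
        poly (poly [: [:c, 1:], -1 :] [:y:]) x = 0}"
      using algebraic_set_curve[of "[: [:0, 1:], 1 :] * [: [:c, 1:], -1 :]"] by (simp only: poly_mult mult_eq_0_iff)
    thus ?thesis unfolding V by (simp add: algebra_simps)
  qed
  have "?A = {(x, y). y = poly [:0, -1:] x}" unfolding V0 by (auto simp: eq_neg_iff_add_eq_0 add.commute)
  hence irr0: "irreducible_set ?A" using irreducible_set_graph by metis
  have "?B = {(x, y). y = poly [:c, 1:] x}" unfolding V1 by (auto simp: algebra_simps)
  hence irr1: "irreducible_set ?B" using irreducible_set_graph by metis
  have un: "?L = ?A \<union> ?B" unfolding V V0 V1 by auto
  \<comment> \<open>Each point lies on one line and gives the equation of the other the value 1
    instead of 0, whatever c is.\<close>
  have "((1 - c) / 2, (1 + c) / 2) \<in> ?B - ?A" "((1 - c) / 2, - ((1 - c) / 2)) \<in> ?A - ?B"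
    unfolding V0 V1 by (auto simp: field_simps)
  hence sub: "\<not> ?B \<subseteq> ?A" "\<not> ?A \<subseteq> ?B" by blast+
  have comp: "{S. irreducible_component ?L S} = {?A, ?B}"
    unfolding un by (rule irreducible_components_Un[OF alg0 alg1 irr0 irr1 sub(2,1)])
  have even: "even_component n \<tau> p ?A"
    unfolding even_component_def V0 by (auto simp: even_potential_iff)
  have noneven: "noneven_component n \<tau> p ?B"
    unfolding noneven_component_def
    \<comment> \<open>The exceptional closed set is the even line, which does not contain this
      component.\<close>
    by (rule exI[of _ ?A]) (use alg0 sub in \<open>auto simp: even_potential_iff V0\<close>)
  have inter: "?A \<inter> ?B = {(- e, e)}"
  proof -
    have "x = - e \<and> y = e" if "x + y = 0" "x - y + 2 * e = 0" for x y
    proof -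
      have "x = - y" using that(1) by (simp add: eq_neg_iff_add_eq_0)
      with that(2) show ?thesis by simp
    qed
    thus ?thesis unfolding V0 V1 c(1) by auto
  qed
  show ?thesis
    using algV un comp sub even noneven inter unfolding e_def by blast
qed

end
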